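(* Let $A$ be a complex of countable free abelian groups, let $\mathcal{M}$ be a countably complete abelian category, and let $X$ be an object of $\mathcal{M}$. Then there is a natural short exact sequence of graded objects of $\mathcal{M}$ $$0\rightarrow \mathrm{Ext}(\mathrm{H}^{\bullet+1}(A),X)\rightarrow \mathrm{H}_{\bullet}(\mathrm{Hom}(A,X))\rightarrow \mathrm{Hom}(\mathrm{H}^{\bullet}(A),X)\rightarrow 0$$ that splits (unnaturally).
   Context: A complex $A$ is $\mathbb{Z}$-graded, written cohomologically as $\delta^n:A^n\to A^{n+1}$ (with $A_n=A^{-n}$), with no boundedness assumption; $\mathrm{H}^n(A)$ is its cohomology (a countable abelian group). For $X$ in $\mathcal{M}$ and a countable set $I$ put $\mathrm{Hom}(\mathbb{Z}^{(I)},X):=\prod_I X$ (product in $\mathcal{M}$), where $\mathbb{Z}^{(I)}$ is the free abelian group with basis $(e_i)_{i\in I}$. For a homomorphism $\varphi:\mathbb{Z}^{(I)}\to\mathbb{Z}^{(J)}$, $e_i\mapsto\sum_j a_{ij}e_j$, let $\mathrm{Hom}(\varphi,X):\prod_J X\to\prod_I X$ be given on generalized elements by $(\mathrm{Hom}(\varphi,X)(x))_i=\sum_{j}a_{ij}x_j$. This is an additive functor from (the opposite of) countable free abelian groups to $\mathcal{M}$. It is extended to all countable abelian groups by taking right derived functors: if $0\to R\to F\to C\to 0$ is exact with $R,F$ countable free abelian groups, then $\mathrm{Hom}(C,X)=\ker(\mathrm{Hom}(F,X)\to\mathrm{Hom}(R,X))$ and $\mathrm{Ext}(C,X)=\mathrm{coker}(\mathrm{Hom}(F,X)\to\mathrm{Hom}(R,X))$.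 For a complex $A$ of countable free abelian groups, $\mathrm{Hom}(A,X)$ is the complex in $\mathcal{M}$ with $\mathrm{Hom}(A,X)_n:=\mathrm{Hom}(A^n,X)$ and differentials $\mathrm{Hom}(A^{n},X)\to\mathrm{Hom}(A^{n-1},X)$ induced by $\delta^{n-1}$. *)

theory Defs
  imports "HOL-Algebra.Free_Abelian_Groups" "HOL-Library.Countable_Set"
begin

section \<open>Categories and countable limits\<close>

record ('o, 'm) cat =
  Obj :: "'o set"
  Arr :: "'m set"
  Src :: "'m \<Rightarrow> 'o"
  Tgt :: "'m \<Rightarrow> 'o"
  Ident :: "'o \<Rightarrow> 'm"
  Comp :: "'m \<Rightarrow> 'm \<Rightarrow> 'm" (infixl "\<cdot>\<index>" 70)

definition homs :: "('o, 'm, 'z) cat_scheme \<Rightarrow> 'o \<Rightarrow> 'o \<Rightarrow> 'm set"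
  where "homs M a b = {f \<in> Arr M. Src M f = a \<and> Tgt M f = b}"

text \<open>\<^term>\<open>Comp M g f\<close> is "g after f"; it is only meaningful if \<^term>\<open>Tgt M f = Src M g\<close>.\<close>

locale category =
  fixes M :: "('o, 'm, 'z) cat_scheme" (structure)
  assumes Src_Obj: "f \<in> Arr M \<Longrightarrow> Src M f \<in> Obj M"
    and Tgt_Obj: "f \<in> Arr M \<Longrightarrow> Tgt M f \<in> Obj M"
    and Ident_homs: "a \<in> Obj M \<Longrightarrow> Ident M a \<in> homs M a a"
    and Comp_homs: "\<lbrakk>f \<in> homs M a b; g \<in> homs M b c\<rbrakk> \<Longrightarrow> g \<cdot> f \<in> homs M a c"
    and Comp_assoc:
      "\<lbrakk>f \<in> homs M a b; g \<in> homs M b c; h \<in> homs M c d\<rbrakk> \<Longrightarrow> (h \<cdot> g) \<cdot> f = h \<cdot> (g \<cdot> f)"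
    and Comp_Ident_right: "f \<in> homs M a b \<Longrightarrow> f \<cdot> Ident M a = f"
    and Comp_Ident_left: "f \<in> homs M a b \<Longrightarrow> Ident M b \<cdot> f = f"

definition is_functor ::
  "('i, 'j, 'y) cat_scheme \<Rightarrow> ('o, 'm, 'z) cat_scheme \<Rightarrow> ('i \<Rightarrow> 'o) \<Rightarrow> ('j \<Rightarrow> 'm) \<Rightarrow> bool"
  where "is_functor J M Fo Fa \<longleftrightarrow>
    (\<forall>a\<in>Obj J. Fo a \<in> Obj M \<and> Fa (Ident J a) = Ident M (Fo a)) \<and>
    (\<forall>f\<in>Arr J. Fa f \<in> homs M (Fo (Src J f)) (Fo (Tgt J f))) \<and>
    (\<forall>f\<in>Arr J. \<forall>g\<in>Arr J. Tgt J f = Src J g \<longrightarrow>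
        Fa (g \<cdot>\<^bsub>J\<^esub> f) = Fa g \<cdot>\<^bsub>M\<^esub> Fa f)"

definition is_cone ::
  "('i, 'j, 'y) cat_scheme \<Rightarrow> ('o, 'm, 'z) cat_scheme \<Rightarrow> ('i \<Rightarrow> 'o) \<Rightarrow> ('j \<Rightarrow> 'm)
    \<Rightarrow> 'o \<Rightarrow> ('i \<Rightarrow> 'm) \<Rightarrow> bool"
  where "is_cone J M Fo Fa T t \<longleftrightarrow>
    T \<in> Obj M \<and> (\<forall>a\<in>Obj J. t a \<in> homs M T (Fo a)) \<and>
    (\<forall>f\<in>Arr J. Fa f \<cdot>\<^bsub>M\<^esub> t (Src J f) = t (Tgt J f))"

definition is_limit ::
  "('i, 'j, 'y) cat_scheme \<Rightarrow> ('o, 'm, 'z) cat_scheme \<Rightarrow> ('i \<Rightarrow> 'o) \<Rightarrow> ('j \<Rightarrow> 'm)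
    \<Rightarrow> 'o \<Rightarrow> ('i \<Rightarrow> 'm) \<Rightarrow> bool"
  where "is_limit J M Fo Fa L p \<longleftrightarrow>
    is_cone J M Fo Fa L p \<and>
    (\<forall>T t. is_cone J M Fo Fa T t \<longrightarrow>
      (\<exists>!h. h \<in> homs M T L \<and> (\<forall>a\<in>Obj J. p a \<cdot>\<^bsub>M\<^esub> h = t a)))"

text \<open>A category with countably many arrows has countably many objects, hence is isomorphic to
  one whose objects and arrows are natural numbers; so the index categories below represent all
  countable ones.\<close>

definition countably_complete :: "('o, 'm, 'z) cat_scheme \<Rightarrow> bool"
  where "countably_complete M \<longleftrightarrow>
    (\<forall>(J :: (nat, nat) cat) Fo Fa. category J \<and> is_functor J M Fo Fa \<longrightarrow>
      (\<exists>L p. is_limit J M Fo Fa L p))"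

section \<open>Abelian categories\<close>

record ('o, 'm) ab_cat = "('o, 'm) cat" +
  Add :: "'m \<Rightarrow> 'm \<Rightarrow> 'm"
  Zero :: "'o \<Rightarrow> 'o \<Rightarrow> 'm"

text \<open>The additive group of morphisms, in the (multiplicatively written) group format of the
  library; thus \<^term>\<open>f [^]\<^bsub>hom_group M a b\<^esub> (n::int)\<close> is the integer multiple
  \<open>n f\<close> and \<^term>\<open>finprod (hom_group M a b)\<close> is a finite sum of morphisms.\<close>

definition hom_group :: "('o, 'm, 'z) ab_cat_scheme \<Rightarrow> 'o \<Rightarrow> 'o \<Rightarrow> 'm monoid"
  where "hom_group M a b = \<lparr>carrier = homs M a b, monoid.mult = Add M, one = Zero M a b\<rparr>"

locale preadditive_category = category M for M :: "('o, 'm, 'z) ab_cat_scheme" (structure) +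
  assumes hom_comm_group: "\<lbrakk>a \<in> Obj M; b \<in> Obj M\<rbrakk> \<Longrightarrow> comm_group (hom_group M a b)"
    and Comp_Add_right: "\<lbrakk>f \<in> homs M a b; f' \<in> homs M a b; g \<in> homs M b c\<rbrakk>
      \<Longrightarrow> g \<cdot> Add M f f' = Add M (g \<cdot> f) (g \<cdot> f')"
    and Comp_Add_left: "\<lbrakk>f \<in> homs M a b; g \<in> homs M b c; g' \<in> homs M b c\<rbrakk>
      \<Longrightarrow> Add M g g' \<cdot> f = Add M (g \<cdot> f) (g' \<cdot> f)"

definition is_mono :: "('o, 'm, 'z) cat_scheme \<Rightarrow> 'm \<Rightarrow> bool"
  where "is_mono M f \<longleftrightarrow> f \<in> Arr M \<and>
    (\<forall>T. \<forall>g\<in>homs M T (Src M f). \<forall>h\<in>homs M T (Src M f).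
        f \<cdot>\<^bsub>M\<^esub> g = f \<cdot>\<^bsub>M\<^esub> h \<longrightarrow> g = h)"

definition is_epi :: "('o, 'm, 'z) cat_scheme \<Rightarrow> 'm \<Rightarrow> bool"
  where "is_epi M f \<longleftrightarrow> f \<in> Arr M \<and>
    (\<forall>T. \<forall>g\<in>homs M (Tgt M f) T. \<forall>h\<in>homs M (Tgt M f) T.
        g \<cdot>\<^bsub>M\<^esub> f = h \<cdot>\<^bsub>M\<^esub> f \<longrightarrow> g = h)"

definition is_kernel :: "('o, 'm, 'z) ab_cat_scheme \<Rightarrow> 'm \<Rightarrow> 'm \<Rightarrow> bool"
  where "is_kernel M f k \<longleftrightarrow>
    k \<in> Arr M \<and> Tgt M k = Src M f \<and> f \<cdot>\<^bsub>M\<^esub> k = Zero M (Src M k) (Tgt M f) \<and>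
    (\<forall>T. \<forall>h\<in>homs M T (Src M f). f \<cdot>\<^bsub>M\<^esub> h = Zero M T (Tgt M f) \<longrightarrow>
        (\<exists>!l. l \<in> homs M T (Src M k) \<and> k \<cdot>\<^bsub>M\<^esub> l = h))"

definition is_cokernel :: "('o, 'm, 'z) ab_cat_scheme \<Rightarrow> 'm \<Rightarrow> 'm \<Rightarrow> bool"
  where "is_cokernel M f q \<longleftrightarrow>
    q \<in> Arr M \<and> Src M q = Tgt M f \<and> q \<cdot>\<^bsub>M\<^esub> f = Zero M (Src M f) (Tgt M q) \<and>
    (\<forall>T. \<forall>h\<in>homs M (Tgt M f) T. h \<cdot>\<^bsub>M\<^esub> f = Zero M (Src M f) T \<longrightarrow>
        (\<exists>!l. l \<in> homs M (Tgt M q) T \<and> l \<cdot>\<^bsub>M\<^esub> q = h))"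

locale abelian_category = preadditive_category +
  assumes zero_object:
      "\<exists>z\<in>Obj M. \<forall>a\<in>Obj M. (\<exists>!f. f \<in> homs M z a) \<and> (\<exists>!f. f \<in> homs M a z)"
    and biproducts: "\<lbrakk>a \<in> Obj M; b \<in> Obj M\<rbrakk> \<Longrightarrow>
      \<exists>c\<in>Obj M. \<exists>i\<in>homs M a c. \<exists>j\<in>homs M b c. \<exists>p\<in>homs M c a. \<exists>q\<in>homs M c b.
        p \<cdot> i = Ident M a \<and> q \<cdot> j = Ident M b \<and>
        p \<cdot> j = Zero M b a \<and> q \<cdot> i = Zero M a b \<and>
        Add M (i \<cdot> p) (j \<cdot> q) = Ident M c"
    and kernels: "f \<in> Arr M \<Longrightarrow> \<exists>k. is_kernel M f k"
    and cokernels: "f \<in> Arr M \<Longrightarrow> \<exists>q. is_cokernel M f q"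
    and mono_normal: "is_mono M f \<Longrightarrow> \<exists>g\<in>Arr M. is_kernel M g f"
    and epi_conormal: "is_epi M f \<Longrightarrow> \<exists>g\<in>Arr M. is_cokernel M g f"

text \<open>Chosen kernels and cokernels, and the maps that a commutative square
  \<open>v f = f' u\<close> induces on them.\<close>

definition ker_arr :: "('o, 'm, 'z) ab_cat_scheme \<Rightarrow> 'm \<Rightarrow> 'm"
  where "ker_arr M f = (SOME k. is_kernel M f k)"

definition Ker :: "('o, 'm, 'z) ab_cat_scheme \<Rightarrow> 'm \<Rightarrow> 'o"
  where "Ker M f = Src M (ker_arr M f)"

definition coker_arr :: "('o, 'm, 'z) ab_cat_scheme \<Rightarrow> 'm \<Rightarrow> 'm"
  where "coker_arr M f = (SOME q. is_cokernel M f q)"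

definition Coker :: "('o, 'm, 'z) ab_cat_scheme \<Rightarrow> 'm \<Rightarrow> 'o"
  where "Coker M f = Tgt M (coker_arr M f)"

definition ker_map :: "('o, 'm, 'z) ab_cat_scheme \<Rightarrow> 'm \<Rightarrow> 'm \<Rightarrow> 'm \<Rightarrow> 'm"
  where "ker_map M f f' u = (THE l. l \<in> homs M (Ker M f) (Ker M f') \<and>
    ker_arr M f' \<cdot>\<^bsub>M\<^esub> l = u \<cdot>\<^bsub>M\<^esub> ker_arr M f)"

definition coker_map :: "('o, 'm, 'z) ab_cat_scheme \<Rightarrow> 'm \<Rightarrow> 'm \<Rightarrow> 'm \<Rightarrow> 'm"
  where "coker_map M f f' v = (THE l. l \<in> homs M (Coker M f) (Coker M f') \<and>
    l \<cdot>\<^bsub>M\<^esub> coker_arr M f = coker_arr M f' \<cdot>\<^bsub>M\<^esub> v)"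

text \<open>The image of \<open>f\<close> is the kernel of its cokernel; exactness at the middle object of
  \<open>g f\<close> says that the image of \<open>f\<close> is a kernel of \<open>g\<close>.\<close>

definition exact_at :: "('o, 'm, 'z) ab_cat_scheme \<Rightarrow> 'm \<Rightarrow> 'm \<Rightarrow> bool"
  where "exact_at M f g \<longleftrightarrow> is_kernel M g (ker_arr M (coker_arr M f))"

definition short_exact ::
  "('o, 'm, 'z) ab_cat_scheme \<Rightarrow> 'o \<Rightarrow> 'm \<Rightarrow> 'o \<Rightarrow> 'm \<Rightarrow> 'o \<Rightarrow> bool"
  where "short_exact M a f b g c \<longleftrightarrow>
    f \<in> homs M a b \<and> g \<in> homs M b c \<and> is_mono M f \<and> exact_at M f g \<and> is_epi M g"

definition splits :: "('o, 'm, 'z) cat_scheme \<Rightarrow> 'o \<Rightarrow> 'm \<Rightarrow> 'o \<Rightarrow> bool"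
  where "splits M b g c \<longleftrightarrow> (\<exists>s\<in>homs M c b. g \<cdot>\<^bsub>M\<^esub> s = Ident M c)"

section \<open>Homology of complexes in an abelian category\<close>

text \<open>A complex is given by its differentials \<open>d n : K n \<rightarrow> K (n - 1)\<close>. Its homology in degree
  \<open>n\<close> is the cokernel of the map \<open>K (n + 1) \<rightarrow> Ker (d n)\<close> induced by \<open>d (n + 1)\<close>.\<close>

definition boundary :: "('o, 'm, 'z) ab_cat_scheme \<Rightarrow> (int \<Rightarrow> 'm) \<Rightarrow> int \<Rightarrow> 'm"
  where "boundary M d n = (THE b. b \<in> homs M (Src M (d (n + 1))) (Ker M (d n)) \<and>
    ker_arr M (d n) \<cdot>\<^bsub>M\<^esub> b = d (n + 1))"

definition homology :: "('o, 'm, 'z) ab_cat_scheme \<Rightarrow> (int \<Rightarrow> 'm) \<Rightarrow> int \<Rightarrow> 'o"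
  where "homology M d n = Coker M (boundary M d n)"

definition homology_map ::
  "('o, 'm, 'z) ab_cat_scheme \<Rightarrow> (int \<Rightarrow> 'm) \<Rightarrow> (int \<Rightarrow> 'm) \<Rightarrow> (int \<Rightarrow> 'm) \<Rightarrow> int \<Rightarrow> 'm"
  where "homology_map M d d' h n =
    coker_map M (boundary M d n) (boundary M d' n) (ker_map M (d n) (d' n) (h n))"

section \<open>Free abelian groups\<close>

definition lin_comb :: "('a, 'b) monoid_scheme \<Rightarrow> ('a \<Rightarrow>\<^sub>0 int) \<Rightarrow> 'a"
  where "lin_comb G c =
    finprod G (\<lambda>x. x [^]\<^bsub>G\<^esub> Poly_Mapping.lookup c x) (Poly_Mapping.keys c)"

definition is_basis :: "('a, 'b) monoid_scheme \<Rightarrow> 'a set \<Rightarrow> bool"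
  where "is_basis G B \<longleftrightarrow> B \<subseteq> carrier G \<and> lin_comb G \<in> iso (free_Abelian_group B) G"

definition countable_free_abelian :: "('a, 'b) monoid_scheme \<Rightarrow> bool"
  where "countable_free_abelian G \<longleftrightarrow>
    comm_group G \<and> countable (carrier G) \<and> (\<exists>B. is_basis G B)"

definition basis :: "('a, 'b) monoid_scheme \<Rightarrow> 'a set"
  where "basis G = (SOME B. is_basis G B)"

definition coords :: "('a, 'b) monoid_scheme \<Rightarrow> 'a \<Rightarrow> ('a \<Rightarrow>\<^sub>0 int)"
  where "coords G x = (THE c. c \<in> carrier (free_Abelian_group (basis G)) \<and> lin_comb G c = x)"

section \<open>Hom from countable free abelian groups into an object\<close>

definition is_power ::
  "('o, 'm, 'z) cat_scheme \<Rightarrow> 'i set \<Rightarrow> 'o \<Rightarrow> 'o \<Rightarrow> ('i \<Rightarrow> 'm) \<Rightarrow> bool"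
  where "is_power M I X P p \<longleftrightarrow>
    P \<in> Obj M \<and> (\<forall>i\<in>I. p i \<in> homs M P X) \<and>
    (\<forall>T\<in>Obj M. \<forall>t. (\<forall>i\<in>I. t i \<in> homs M T X) \<longrightarrow>
      (\<exists>!h. h \<in> homs M T P \<and> (\<forall>i\<in>I. p i \<cdot>\<^bsub>M\<^esub> h = t i)))"

definition chosen_power :: "('o, 'm, 'z) cat_scheme \<Rightarrow> 'i set \<Rightarrow> 'o \<Rightarrow> 'o \<times> ('i \<Rightarrow> 'm)"
  where "chosen_power M I X = (SOME (P, p). is_power M I X P p)"

text \<open>\<open>free_Hom M F X\<close> is the product of copies of \<open>X\<close> indexed by the chosen basis of \<open>F\<close>.\<close>

definition free_Hom ::
  "('o, 'm, 'z) cat_scheme \<Rightarrow> ('a, 'b) monoid_scheme \<Rightarrow> 'o \<Rightarrow> 'o"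
  where "free_Hom M F X = fst (chosen_power M (basis F) X)"

definition free_proj ::
  "('o, 'm, 'z) cat_scheme \<Rightarrow> ('a, 'b) monoid_scheme \<Rightarrow> 'o \<Rightarrow> 'a \<Rightarrow> 'm"
  where "free_proj M F X = snd (chosen_power M (basis F) X)"

text \<open>For a homomorphism \<open>\<phi> : F \<rightarrow> G\<close>, the arrow from \<open>free_Hom M G X\<close> to
  \<open>free_Hom M F X\<close> whose component at the basis element \<open>i\<close> of \<open>F\<close> is the finite sum
  of \<open>a i j\<close> times the projection at \<open>j\<close>, where \<open>\<phi> i\<close> is the sum of the
  \<open>a i j\<close> times \<open>j\<close>.\<close>

definition free_Hom_arr ::
  "('o, 'm, 'z) ab_cat_scheme \<Rightarrow> ('a, 'b) monoid_scheme \<Rightarrow> ('c, 'd) monoid_scheme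
    \<Rightarrow> ('a \<Rightarrow> 'c) \<Rightarrow> 'o \<Rightarrow> 'm"
  where "free_Hom_arr M F G \<phi> X =
    (THE h. h \<in> homs M (free_Hom M G X) (free_Hom M F X) \<and>
      (\<forall>i\<in>basis F. free_proj M F X i \<cdot>\<^bsub>M\<^esub> h =
        finprod (hom_group M (free_Hom M G X) X)
          (\<lambda>j. free_proj M G X j [^]\<^bsub>hom_group M (free_Hom M G X) X\<^esub>
                 Poly_Mapping.lookup (coords G (\<phi> i)) j)
          (Poly_Mapping.keys (coords G (\<phi> i)))))"

definition free_Hom_push ::
  "('o, 'm, 'z) cat_scheme \<Rightarrow> ('a, 'b) monoid_scheme \<Rightarrow> 'o \<Rightarrow> 'o \<Rightarrow> 'm \<Rightarrow> 'm"
  where "free_Hom_push M F X Y u =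
    (THE h. h \<in> homs M (free_Hom M F X) (free_Hom M F Y) \<and>
      (\<forall>i\<in>basis F. free_proj M F Y i \<cdot>\<^bsub>M\<^esub> h = u \<cdot>\<^bsub>M\<^esub> free_proj M F X i))"

section \<open>Hom and Ext from countable abelian groups into an object\<close>

text \<open>The right derived functors are computed with the functorial free resolution
  \<open>0 \<rightarrow> Rel C \<rightarrow> Gen C \<rightarrow> C \<rightarrow> 0\<close>, where \<open>Gen C\<close> is free on the
  elements of \<open>C\<close>, the augmentation is \<^term>\<open>lin_comb C\<close>, and \<open>Rel C\<close> is its kernel. If
  \<open>C\<close> is countable, both groups are countable and free.\<close>

definition Gen :: "('a, 'b) monoid_scheme \<Rightarrow> ('a \<Rightarrow>\<^sub>0 int) monoid"
  where "Gen C = free_Abelian_group (carrier C)"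

definition Rel :: "('a, 'b) monoid_scheme \<Rightarrow> ('a \<Rightarrow>\<^sub>0 int) monoid"
  where "Rel C = (Gen C)\<lparr>carrier := kernel (Gen C) C (lin_comb C)\<rparr>"

text \<open>\<open>Gen_map f\<close> lifts \<open>f\<close> to the resolutions; it restricts to \<open>Rel\<close>.\<close>

definition Gen_map :: "('a \<Rightarrow> 'c) \<Rightarrow> ('a \<Rightarrow>\<^sub>0 int) \<Rightarrow> ('c \<Rightarrow>\<^sub>0 int)"
  where "Gen_map f = frag_extend (\<lambda>x. frag_of (f x))"

definition restr :: "('o, 'm, 'z) ab_cat_scheme \<Rightarrow> ('a, 'b) monoid_scheme \<Rightarrow> 'o \<Rightarrow> 'm"
  where "restr M C X = free_Hom_arr M (Rel C) (Gen C) (\<lambda>x. x) X"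

definition Hom :: "('o, 'm, 'z) ab_cat_scheme \<Rightarrow> ('a, 'b) monoid_scheme \<Rightarrow> 'o \<Rightarrow> 'o"
  where "Hom M C X = Ker M (restr M C X)"

definition Ext :: "('o, 'm, 'z) ab_cat_scheme \<Rightarrow> ('a, 'b) monoid_scheme \<Rightarrow> 'o \<Rightarrow> 'o"
  where "Ext M C X = Coker M (restr M C X)"

text \<open>Functoriality: for a homomorphism \<open>f : C \<rightarrow> D\<close> and for an arrow
  \<open>u : X \<rightarrow> Y\<close>.\<close>

definition Hom_arr ::
  "('o, 'm, 'z) ab_cat_scheme \<Rightarrow> ('a, 'b) monoid_scheme \<Rightarrow> ('c, 'd) monoid_scheme
    \<Rightarrow> ('a \<Rightarrow> 'c) \<Rightarrow> 'o \<Rightarrow> 'm"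
  where "Hom_arr M C D f X =
    ker_map M (restr M D X) (restr M C X) (free_Hom_arr M (Gen C) (Gen D) (Gen_map f) X)"

definition Ext_arr ::
  "('o, 'm, 'z) ab_cat_scheme \<Rightarrow> ('a, 'b) monoid_scheme \<Rightarrow> ('c, 'd) monoid_scheme
    \<Rightarrow> ('a \<Rightarrow> 'c) \<Rightarrow> 'o \<Rightarrow> 'm"
  where "Ext_arr M C D f X =
    coker_map M (restr M D X) (restr M C X) (free_Hom_arr M (Rel C) (Rel D) (Gen_map f) X)"

definition Hom_push ::
  "('o, 'm, 'z) ab_cat_scheme \<Rightarrow> ('a, 'b) monoid_scheme \<Rightarrow> 'o \<Rightarrow> 'o \<Rightarrow> 'm \<Rightarrow> 'm"
  where "Hom_push M C X Y u =
    ker_map M (restr M C X) (restr M C Y) (free_Hom_push M (Gen C) X Y u)"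

definition Ext_push ::
  "('o, 'm, 'z) ab_cat_scheme \<Rightarrow> ('a, 'b) monoid_scheme \<Rightarrow> 'o \<Rightarrow> 'o \<Rightarrow> 'm \<Rightarrow> 'm"
  where "Ext_push M C X Y u =
    coker_map M (restr M C X) (restr M C Y) (free_Hom_push M (Rel C) X Y u)"

section \<open>Complexes of countable free abelian groups\<close>

record 'a cochain =
  Grp :: "int \<Rightarrow> 'a monoid"
  Diff :: "int \<Rightarrow> 'a \<Rightarrow> 'a"

definition free_complex :: "'a cochain \<Rightarrow> bool"
  where "free_complex A \<longleftrightarrow>
    (\<forall>n. countable_free_abelian (Grp A n) \<and>
      Diff A n \<in> hom (Grp A n) (Grp A (n + 1)) \<and>
      (\<forall>x\<in>carrier (Grp A n). Diff A (n + 1) (Diff A n x) = \<one>\<^bsub>Grp A (n + 2)\<^esub>))"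

definition chain_map :: "'a cochain \<Rightarrow> 'a cochain \<Rightarrow> (int \<Rightarrow> 'a \<Rightarrow> 'a) \<Rightarrow> bool"
  where "chain_map A B f \<longleftrightarrow>
    (\<forall>n. f n \<in> hom (Grp A n) (Grp B n) \<and>
      (\<forall>x\<in>carrier (Grp A n). f (n + 1) (Diff A n x) = Diff B n (f n x)))"

definition coboundaries :: "'a cochain \<Rightarrow> int \<Rightarrow> 'a set"
  where "coboundaries A n = Diff A (n - 1) ` carrier (Grp A (n - 1))"

definition cohomology :: "'a cochain \<Rightarrow> int \<Rightarrow> 'a set monoid"
  where "cohomology A n =
    (Grp A n)\<lparr>carrier := kernel (Grp A n) (Grp A (n + 1)) (Diff A n)\<rparr> Mod coboundaries A n"

text \<open>The class of \<open>x\<close> is sent to the class of \<open>f n x\<close>, written without choosing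
  representatives.\<close>

definition cohomology_map ::
  "'a cochain \<Rightarrow> (int \<Rightarrow> 'a \<Rightarrow> 'a) \<Rightarrow> int \<Rightarrow> 'a set \<Rightarrow> 'a set"
  where "cohomology_map B f n c = coboundaries B n <#>\<^bsub>Grp B n\<^esub> (f n ` c)"

text \<open>The differential \<open>Hom(A n, X) \<rightarrow> Hom(A (n - 1), X)\<close> of the complex \<open>Hom(A, X)\<close>, and the
  maps of complexes induced by a chain map and by an arrow.\<close>

definition Hom_diff :: "('o, 'm, 'z) ab_cat_scheme \<Rightarrow> 'a cochain \<Rightarrow> 'o \<Rightarrow> int \<Rightarrow> 'm"
  where "Hom_diff M A X n = free_Hom_arr M (Grp A (n - 1)) (Grp A n) (Diff A (n - 1)) X"

definition Hom_homology :: "('o, 'm, 'z) ab_cat_scheme \<Rightarrow> 'a cochain \<Rightarrow> 'o \<Rightarrow> int \<Rightarrow> 'o"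
  where "Hom_homology M A X n = homology M (Hom_diff M A X) n"

definition Hom_homology_arr ::
  "('o, 'm, 'z) ab_cat_scheme \<Rightarrow> 'a cochain \<Rightarrow> 'a cochain \<Rightarrow> (int \<Rightarrow> 'a \<Rightarrow> 'a) \<Rightarrow> 'o
    \<Rightarrow> int \<Rightarrow> 'm"
  where "Hom_homology_arr M A B f X n =
    homology_map M (Hom_diff M B X) (Hom_diff M A X)
      (\<lambda>k. free_Hom_arr M (Grp A k) (Grp B k) (f k) X) n"

definition Hom_homology_push ::
  "('o, 'm, 'z) ab_cat_scheme \<Rightarrow> 'a cochain \<Rightarrow> 'o \<Rightarrow> 'o \<Rightarrow> 'm \<Rightarrow> int \<Rightarrow> 'm"
  where "Hom_homology_push M A X Y u n =
    homology_map M (Hom_diff M A X) (Hom_diff M A Y)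
      (\<lambda>k. free_Hom_push M (Grp A k) X Y u) n"

end

theory Submission
  imports Defs
begin

text \<open>For a countable free abelian group \<open>F\<close>, the power \<open>Hom(F, X)\<close> represents the functor that sends \<open>T\<close>
  to the group homomorphisms from \<open>F\<close> to \<open>M(T, X)\<close>; the universal homomorphism is written \<open>ev\<close>. Likewise
  \<open>Hom(C, X)\<close> represents the homomorphisms from \<open>C\<close> (with universal homomorphism \<open>hev\<close>), and the \<open>n\<close>-cycles
  of \<open>Hom(A, X)\<close> represent the homomorphisms from \<open>A\<^sup>n\<close> that kill the coboundaries (with \<open>cev\<close>). Arrows
  between these objects can therefore be given, composed and compared as homomorphisms of abelian groups.

  The subgroups of coboundaries are free, so each cocycle group \<open>Z\<^sup>n\<close> is a direct summand of \<open>A\<^sup>n\<close>.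
  Restriction of homomorphisms to \<open>Z\<^sup>n\<close> gives \<open>\<pi>\<close>, and a retraction onto \<open>Z\<^sup>n\<close> gives a section of it. A lift
  \<open>\<theta>\<close> of \<open>Z\<^bsup>n+1\<^esup> \<rightarrow> H\<^bsup>n+1\<^esup>\<close> to the resolution of \<open>H\<^bsup>n+1\<^esup>\<close> maps coboundaries to relations, and
  composition with \<open>\<theta> \<delta>\<close> gives \<open>\<iota>\<close>; a lift \<open>\<sigma>\<close> of the resolution to \<open>Z\<^bsup>n+1\<^esup>\<close>, composed with a section
  of \<open>\<delta>\<close>, gives a retraction of \<open>\<iota>\<close>. The deviations of \<open>\<theta> \<sigma>\<close> and \<open>\<sigma> \<theta>\<close> from the identity take values in
  relations and coboundaries, which makes all required identities hold up to homotopy.\<close>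

section \<open>Free abelian groups\<close>

text \<open>Countable products in a countably complete abelian category need not be exact, so
  exactness in \<open>M\<close> cannot simply be inherited from exact sequences of groups. It has to
  come from splittings, which every additive functor preserves. Were Ext(H, X) computed from the
  resolution of H by coboundaries and cocycles, the sequence would be little more than a reading of
  these splittings. But \<open>Hom\<close> and \<open>Ext\<close> are defined through a fixed
  functorial resolution, free on all elements of H; this is why comparison maps in both directions
  are required, and why they are inverse to each other only up to an error. The exact sequence is
  obtained without a diagram chase in \<open>M\<close>: the arrows satisfy the biproduct equations
  \<open>\<rho> \<iota> = 1\<close>, \<open>\<pi> s = 1\<close>, \<open>\<pi> \<iota> = 0\<close>
  and \<open>\<iota> \<rho> + s \<pi> = 1\<close>. Naturality has a separate source. The splitting
  depends on choices, whereas the equations that pin down \<pi> and \<iota> mention none of them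
  except the lift \<theta>.\<close>

lemma hom_apply_inv:
  "\<lbrakk>group G; group H; h \<in> hom G H; x \<in> carrier G\<rbrakk> \<Longrightarrow> h (inv\<^bsub>G\<^esub> x) = inv\<^bsub>H\<^esub> h x"
  by (metis group_hom.hom_inv group_hom.intro group_hom_axioms.intro)

lemma hom_divide:
  assumes "comm_group H" "f \<in> hom G H" "g \<in> hom G H"
  shows "(\<lambda>x. f x \<otimes>\<^bsub>H\<^esub> inv\<^bsub>H\<^esub> g x) \<in> hom G H"
proof -
  interpret comm_group H by fact
  show ?thesis
    using assms(2,3) by (auto simp: hom_def Pi_iff inv_mult m_ac)
qed

lemma hom_restrict_carrier:
  "\<lbrakk>f \<in> hom G H; S \<subseteq> carrier G\<rbrakk> \<Longrightarrow> f \<in> hom (G\<lparr>carrier := S\<rparr>) H"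
  by (auto simp: hom_def)

lemma hom_eq_on_free:
  assumes "group G" "h \<in> hom (free_Abelian_group S) G" "k \<in> hom (free_Abelian_group S) G"
    and "\<And>x. x \<in> S \<Longrightarrow> h (frag_of x) = k (frag_of x)" "Poly_Mapping.keys c \<subseteq> S"
  shows "h c = k c"
  using \<open>Poly_Mapping.keys c \<subseteq> S\<close>
proof (rule free_Abelian_group_induct[where P = "\<lambda>c. h c = k c"])
  show "h 0 = k 0"
    using hom_one[OF assms(2)] hom_one[OF assms(3)] assms(1) by simp
next
  fix x y
  assume 2: "Poly_Mapping.keys x \<subseteq> S" "Poly_Mapping.keys y \<subseteq> S" "h x = k x" "h y = k y"
  then have y: "- y \<in> carrier (free_Abelian_group S)" and x: "x \<in> carrier (free_Abelian_group S)" by simp_all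
  have "h (x - y) = h x \<otimes>\<^bsub>G\<^esub> inv\<^bsub>G\<^esub> h y" "k (x - y) = k x \<otimes>\<^bsub>G\<^esub> inv\<^bsub>G\<^esub> k y"
    using hom_mult[OF assms(2) x y] hom_mult[OF assms(3) x y] 2(2)
      hom_apply_inv[OF group_free_Abelian_group assms(1,2), of y]
      hom_apply_inv[OF group_free_Abelian_group assms(1,3), of y] by simp_all
  then show "h (x - y) = k (x - y)" using 2 by simp
next
  fix a assume "a \<in> S"
  then show "h (frag_of a) = k (frag_of a)" by (rule assms(4))
qed

text \<open>Zeroth powers contribute nothing, so combinations with different supports can be
  compared over one common finite index set.\<close>

lemma (in comm_group) finprod_lookup_superset:
  assumes "finite S" "Poly_Mapping.keys c \<subseteq> S" "t \<in> S \<rightarrow> carrier G"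
  shows "finprod G (\<lambda>x. t x [^] (Poly_Mapping.lookup c x :: int)) (Poly_Mapping.keys c)
       = finprod G (\<lambda>x. t x [^] Poly_Mapping.lookup c x) S"
  using assms by (intro finprod_mono_neutral_cong_left) (auto simp: in_keys_iff Pi_iff)

text \<open>The sum is kept in the shape that \<open>lin_comb\<close> and
  \<open>free_Hom_arr\<close> share, so that one proof makes both additive: \<open>t\<close> is the
  identity in the former and a family of projections in the latter.\<close>

lemma (in comm_group) finprod_lookup_hom:
  assumes t: "t \<in> S \<rightarrow> carrier G"
  shows "(\<lambda>c. finprod G (\<lambda>x. t x [^] (Poly_Mapping.lookup c x :: int)) (Poly_Mapping.keys c))
    \<in> hom (free_Abelian_group S) G"
proof (rule homI)
  fix c assume "c \<in> carrier (free_Abelian_group S)"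
  then show "finprod G (\<lambda>x. t x [^] Poly_Mapping.lookup c x) (Poly_Mapping.keys c) \<in> carrier G"
    using t by (intro finprod_closed) auto
next
  fix c d assume cd: "c \<in> carrier (free_Abelian_group S)" "d \<in> carrier (free_Abelian_group S)"
  let ?K = "Poly_Mapping.keys c \<union> Poly_Mapping.keys d"
  have K: "finite ?K" "t \<in> ?K \<rightarrow> carrier G" "Poly_Mapping.keys (c + d) \<subseteq> ?K"
    using cd t keys_add[of c d] by auto
  have "finprod G (\<lambda>x. t x [^] Poly_Mapping.lookup (c + d) x) ?K
      = finprod G (\<lambda>x. t x [^] Poly_Mapping.lookup c x \<otimes> t x [^] Poly_Mapping.lookup d x) ?K"
    using K by (intro finprod_cong') (auto simp: lookup_add int_pow_mult Pi_iff)
  also have "\<dots> = finprod G (\<lambda>x. t x [^] Poly_Mapping.lookup c x) ?K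
      \<otimes> finprod G (\<lambda>x. t x [^] Poly_Mapping.lookup d x) ?K"
    using K by (intro finprod_multf) (auto simp: Pi_iff)
  finally show "finprod G (\<lambda>x. t x [^] Poly_Mapping.lookup (c \<otimes>\<^bsub>free_Abelian_group S\<^esub> d) x)
      (Poly_Mapping.keys (c \<otimes>\<^bsub>free_Abelian_group S\<^esub> d))
    = finprod G (\<lambda>x. t x [^] Poly_Mapping.lookup c x) (Poly_Mapping.keys c)
      \<otimes> finprod G (\<lambda>x. t x [^] Poly_Mapping.lookup d x) (Poly_Mapping.keys d)"
    using K by (simp add: finprod_lookup_superset[of ?K])
qed

lemma (in comm_group) finprod_frag_of:
  assumes "t x \<in> carrier G"
  shows "finprod G (\<lambda>y. t y [^] (Poly_Mapping.lookup (frag_of x) y :: int)) (Poly_Mapping.keys (frag_of x)) = t x"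
proof -
  have "finprod G (\<lambda>y. t y [^] (Poly_Mapping.lookup (frag_of x) y :: int)) {x}
      = t x [^] (Poly_Mapping.lookup (frag_of x) x :: int) \<otimes> finprod G (\<lambda>y. t y [^] (Poly_Mapping.lookup (frag_of x) y :: int)) {}"
    using assms by (intro finprod_insert) auto
  then show ?thesis using assms by simp
qed

lemma (in comm_group) lin_comb_hom:
  "S \<subseteq> carrier G \<Longrightarrow> lin_comb G \<in> hom (free_Abelian_group S) G"
  using finprod_lookup_hom[of "\<lambda>x. x" S] unfolding lin_comb_def by auto

lemma (in comm_group) lin_comb_frag_of:
  "x \<in> carrier G \<Longrightarrow> lin_comb G (frag_of x) = x"
  using finprod_frag_of[of "\<lambda>x. x" x] by (simp add: lin_comb_def)

section \<open>Bases and coordinates of countable free abelian groups\<close>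

lemma cfa_comm_group: "countable_free_abelian F \<Longrightarrow> comm_group F"
  by (simp add: countable_free_abelian_def)

lemma is_basis_basis: "countable_free_abelian F \<Longrightarrow> is_basis F (basis F)"
  unfolding countable_free_abelian_def basis_def by (auto intro: someI)

lemma basis_subset: "countable_free_abelian F \<Longrightarrow> basis F \<subseteq> carrier F"
  using is_basis_basis by (auto simp: is_basis_def)

lemma countable_basis: "countable_free_abelian F \<Longrightarrow> countable (basis F)"
  using basis_subset[of F] countable_subset[of "basis F" "carrier F"] by (simp add: countable_free_abelian_def)

lemma coords_unique:
  assumes "countable_free_abelian F" "x \<in> carrier F"
  shows "\<exists>!c. c \<in> carrier (free_Abelian_group (basis F)) \<and> lin_comb F c = x"
proof -
  have "bij_betw (lin_comb F) (carrier (free_Abelian_group (basis F))) (carrier F)"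
    using is_basis_basis[OF assms(1)] by (auto simp: is_basis_def iso_def)
  then obtain c where "c \<in> carrier (free_Abelian_group (basis F))" "lin_comb F c = x"
    using assms(2) by (metis bij_betw_imp_surj_on imageE)
  then show ?thesis
    using \<open>bij_betw _ _ _\<close> by (metis bij_betw_imp_inj_on inj_on_contraD)
qed

lemma coords:
  assumes "countable_free_abelian F" "x \<in> carrier F"
  shows "coords F x \<in> carrier (free_Abelian_group (basis F))" "lin_comb F (coords F x) = x"
  using theI'[OF coords_unique[OF assms]] unfolding coords_def by auto

lemma lin_comb_basis_hom:
  "countable_free_abelian F \<Longrightarrow> lin_comb F \<in> hom (free_Abelian_group (basis F)) F"
  by (simp add: basis_subset cfa_comm_group comm_group.lin_comb_hom)

lemma coords_eqI:
  assumes "countable_free_abelian F" "c \<in> carrier (free_Abelian_group (basis F))" "lin_comb F c = x"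
  shows "coords F x = c"
proof -
  have "x \<in> carrier F"
    using hom_in_carrier[OF lin_comb_basis_hom[OF assms(1)] assms(2)] assms(3) by simp
  then show ?thesis
    unfolding coords_def using assms by (intro the1_equality coords_unique) auto
qed

lemma coords_hom:
  assumes "countable_free_abelian F"
  shows "coords F \<in> hom F (free_Abelian_group (basis F))"
proof (rule homI)
  fix x y assume xy: "x \<in> carrier F" "y \<in> carrier F"
  show "coords F (x \<otimes>\<^bsub>F\<^esub> y) = coords F x \<otimes>\<^bsub>free_Abelian_group (basis F)\<^esub> coords F y"
    using coords[OF assms xy(1)] coords[OF assms xy(2)] lin_comb_basis_hom[OF assms]
    by (intro coords_eqI[OF assms])
       (auto simp: hom_mult simp del: mult_free_Abelian_group carrier_free_Abelian_group_iff
        intro: monoid.m_closed group.is_monoid[OF group_free_Abelian_group])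
qed (use coords[OF assms] in auto)

lemma coords_basis:
  assumes "countable_free_abelian F" "x \<in> basis F"
  shows "coords F x = frag_of x"
  using assms basis_subset[OF assms(1)]
  by (intro coords_eqI) (auto simp: comm_group.lin_comb_frag_of[OF cfa_comm_group])

text \<open>Spelling out the extension of \<open>t\<close> as a sum over coordinates, instead of
  only asserting its existence, makes \<open>ev\<close> below an instance by definition.\<close>

lemma free_extension:
  assumes "countable_free_abelian F" "comm_group G" "t \<in> basis F \<rightarrow> carrier G"
  shows "(\<lambda>x. finprod G (\<lambda>j. t j [^]\<^bsub>G\<^esub> Poly_Mapping.lookup (coords F x) j) (Poly_Mapping.keys (coords F x)))
      \<in> hom F G" (is "?h \<in> _")
    and "x \<in> basis F \<Longrightarrow>
      finprod G (\<lambda>j. t j [^]\<^bsub>G\<^esub> Poly_Mapping.lookup (coords F x) j) (Poly_Mapping.keys (coords F x)) = t x"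
proof -
  show "?h \<in> hom F G"
    using Group.hom_compose[OF coords_hom[OF assms(1)] comm_group.finprod_lookup_hom[OF assms(2,3)]]
    by (simp add: o_def)
  show "x \<in> basis F \<Longrightarrow> ?h x = t x"
    using comm_group.finprod_frag_of[OF assms(2), of t x] coords_basis[OF assms(1)] assms(3) by auto
qed

lemma free_hom_eq:
  assumes F: "countable_free_abelian F" and "group G" "h \<in> hom F G" "k \<in> hom F G"
    and "\<And>x. x \<in> basis F \<Longrightarrow> h x = k x" "x \<in> carrier F"
  shows "h x = k x"
proof -
  have "h (lin_comb F c) = k (lin_comb F c)" if "Poly_Mapping.keys c \<subseteq> basis F" for c
  proof -
    have "(h \<circ> lin_comb F) c = (k \<circ> lin_comb F) c"
      by (rule hom_eq_on_free[OF \<open>group G\<close> Group.hom_compose[OF lin_comb_basis_hom[OF F] assms(3)]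
            Group.hom_compose[OF lin_comb_basis_hom[OF F] assms(4)] _ that])
         (use assms(5) basis_subset[OF F] in \<open>auto simp: comm_group.lin_comb_frag_of[OF cfa_comm_group[OF F]]\<close>)
    then show ?thesis by simp
  qed
  then show ?thesis using coords[OF F assms(6)] by (metis carrier_free_Abelian_group_iff)
qed

text \<open>It suffices to lift the basis. An inclusion of images takes the place of surjectivity of
  \<open>p\<close>, because \<open>p\<close> will also be a differential, which maps only onto the
  coboundaries.\<close>

lemma free_projective:
  assumes F: "countable_free_abelian F" and E: "comm_group E" and C: "group C"
    and p: "p \<in> hom E C" and f: "f \<in> hom F C" and sub: "f ` carrier F \<subseteq> p ` carrier E"
  obtains l where "l \<in> hom F E" "\<And>x. x \<in> carrier F \<Longrightarrow> p (l x) = f x"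
proof -
  have "\<forall>x\<in>basis F. \<exists>y\<in>carrier E. p y = f x"
    using sub basis_subset[OF F] by fastforce
  then obtain t where t: "\<And>x. x \<in> basis F \<Longrightarrow> t x \<in> carrier E \<and> p (t x) = f x"
    by metis
  then obtain l where l: "l \<in> hom F E" "\<And>x. x \<in> basis F \<Longrightarrow> l x = t x"
    using free_extension[OF F E, of t] by (metis (no_types, lifting) Pi_I)
  have "(p \<circ> l) x = f x" if "x \<in> carrier F" for x
    using free_hom_eq[OF F C Group.hom_compose[OF l(1) p] f _ that] t l(2) by auto
  then show ?thesis using that l(1) by auto
qed

text \<open>Induction along the filtration of \<open>G\<close> by the subgroups on which all but the first \<open>n\<close>
  functionals vanish: the image of each step under the next functional is an ideal of the integers, and
  preimages of generators of the nonzero ideals form a basis. Unlike freeness, the hypotheses obviously pass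
  to subgroups.\<close>

lemma basis_exists:
  fixes G (structure) and \<pi> :: "nat \<Rightarrow> 'a \<Rightarrow> int"
  assumes G: "comm_group G" and hom: "\<And>k. \<pi> k \<in> hom G integer_group"
    and fin: "\<And>x. x \<in> carrier G \<Longrightarrow> \<exists>N. \<forall>k\<ge>N. \<pi> k x = 0"
    and inj: "\<And>x. \<lbrakk>x \<in> carrier G; \<forall>k. \<pi> k x = 0\<rbrakk> \<Longrightarrow> x = \<one>\<^bsub>G\<^esub>"
  shows "\<exists>B. is_basis G B"
proof -
  interpret comm_group G by fact
  have \<pi>_mult: "\<pi> k (x \<otimes> y) = \<pi> k x + \<pi> k y" if "x \<in> carrier G" "y \<in> carrier G" for k x y
    using hom_mult[OF hom that] by simp
  have \<pi>_pow: "\<pi> k (x [^] i) = i * \<pi> k x" if "x \<in> carrier G" for k x and i :: int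
    using hom_int_pow[OF hom that group_axioms group_integer_group] by simp
  define L where "L n = {x \<in> carrier G. \<forall>k\<ge>n. \<pi> k x = 0}" for n
  \<comment> \<open>Adding a multiple is the one operation that is used, both in the division with
    remainder and in the elimination that proves \<open>span\<close>.\<close>
  have L_closed: "x \<otimes> y [^] i \<in> L n" if "x \<in> L n" "y \<in> L n" for x y n and i :: int
    using that by (auto simp: L_def \<pi>_mult \<pi>_pow)
  have one_L: "\<one> \<in> L n" for n
    using \<pi>_pow[of \<one> _ 0] by (auto simp: L_def)
  have "\<exists>h\<in>L (Suc n). \<forall>x\<in>L (Suc n). \<pi> n h dvd \<pi> n x" for n
  proof (cases "\<forall>x\<in>L (Suc n). \<pi> n x = 0")
    case True
    then show ?thesis using one_L by force
  next
    case False
    \<comment> \<open>A generator of the ideal of values is an element whose value has least nonzero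
      absolute value.\<close>
    define P where "P m \<longleftrightarrow> (\<exists>h\<in>L (Suc n). \<pi> n h \<noteq> 0 \<and> nat \<bar>\<pi> n h\<bar> = m)" for m
    have "\<exists>m. P m" using False by (auto simp: P_def)
    then have "P (LEAST m. P m)" by (rule LeastI_ex)
    then obtain h where h: "h \<in> L (Suc n)" "\<pi> n h \<noteq> 0" "nat \<bar>\<pi> n h\<bar> = (LEAST m. P m)"
      by (auto simp: P_def)
    have "\<pi> n h dvd \<pi> n x" if x: "x \<in> L (Suc n)" for x
    proof (rule ccontr)
      assume nd: "\<not> \<pi> n h dvd \<pi> n x"
      \<comment> \<open>Under \<open>\<pi> n\<close> this element has the remainder of the division
        as its value, which would be nonzero and smaller than the minimum.\<close>
      let ?y = "x \<otimes> h [^] (- (\<pi> n x div \<pi> n h))"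
      have y: "?y \<in> L (Suc n)" using L_closed x h by blast
      have "\<pi> n ?y = \<pi> n x mod \<pi> n h"
        using x h by (simp add: \<pi>_mult \<pi>_pow L_def minus_div_mult_eq_mod[symmetric])
      then have "\<pi> n ?y \<noteq> 0" "nat \<bar>\<pi> n ?y\<bar> < nat \<bar>\<pi> n h\<bar>"
        using nd h(2) abs_mod_less[of "\<pi> n h" "\<pi> n x"] by (auto simp: dvd_eq_mod_eq_0)
      then show False
        using y h(3) not_less_Least[of "nat \<bar>\<pi> n ?y\<bar>" P] by (auto simp: P_def)
    qed
    then show ?thesis using h by blast
  qed
  then obtain h where h: "\<And>n. h n \<in> L (Suc n)" "\<And>n x. x \<in> L (Suc n) \<Longrightarrow> \<pi> n (h n) dvd \<pi> n x"
    by metis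
  \<comment> \<open>Where the ideal is zero, \<open>h n\<close> lies already in \<open>L n\<close>
    and would be redundant, so only the other indices contribute basis elements.\<close>
  define N where "N = {n. \<pi> n (h n) \<noteq> 0}"
  have hc: "h n \<in> carrier G" for n using h(1) by (auto simp: L_def)
  have h0: "\<pi> k (h n) = 0" if "k > n" for k n using h(1)[of n] that by (auto simp: L_def)
  \<comment> \<open>For n < k the functional \<open>\<pi> k\<close> vanishes at \<open>h n\<close>
    but not at \<open>h k\<close>.\<close>
  have "inj_on h N"
    by (rule inj_onI) (metis (mono_tags, lifting) N_def h0 linorder_neqE_nat mem_Collect_eq)
  let ?B = "h ` N"
  let ?F = "free_Abelian_group ?B"
  have sub: "?B \<subseteq> carrier G" using hc by auto
  have lh: "lin_comb G \<in> hom ?F G" by (rule lin_comb_hom[OF sub])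
  have span: "x \<in> lin_comb G ` carrier ?F" if "x \<in> L n" for x n
    using that
  proof (induction n arbitrary: x)
    case 0
    then have "x = \<one>" using inj by (auto simp: L_def)
    moreover have "lin_comb G 0 = \<one>"
      using hom_one[OF lh] by (simp add: group_axioms)
    ultimately show ?case by (force simp: image_iff)
  next
    case (Suc n)
    show ?case
    proof (cases "n \<in> N")
      case False
      then have "\<pi> n x = 0" using h(2)[OF Suc.prems] by (auto simp: N_def)
      then have "x \<in> L n" using Suc.prems by (auto simp: L_def) (metis le_antisym not_less_eq_eq)
      then show ?thesis by (rule Suc.IH)
    next
      case True
      obtain m where m: "\<pi> n x = m * \<pi> n (h n)" using h(2)[OF Suc.prems] by (metis dvdE mult.commute)
      let ?y = "x \<otimes> h n [^] (- m)"
      have y: "?y \<in> L (Suc n)" using L_closed Suc.prems h(1) by blast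
      have "\<pi> n ?y = 0" using Suc.prems hc m by (simp add: \<pi>_mult \<pi>_pow L_def)
      then have "?y \<in> L n" using y by (auto simp: L_def) (metis le_antisym not_less_eq_eq)
      then obtain c where c: "c \<in> carrier ?F" "lin_comb G c = ?y"
        using Suc.IH by (metis imageE)
      let ?g = "frag_of (h n)"
      have g: "?g \<in> carrier ?F" using True by simp
      have "lin_comb G (c \<otimes>\<^bsub>?F\<^esub> ?g [^]\<^bsub>?F\<^esub> m) = lin_comb G c \<otimes> lin_comb G (?g [^]\<^bsub>?F\<^esub> m)"
        by (intro hom_mult[OF lh] c(1) group.int_pow_closed g group_free_Abelian_group)
      also have "lin_comb G (?g [^]\<^bsub>?F\<^esub> m) = h n [^] m"
        using hom_int_pow[OF lh g group_free_Abelian_group group_axioms] hc by (simp add: lin_comb_frag_of)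
      also have "lin_comb G c \<otimes> h n [^] m = x"
        using c(2) hc Suc.prems by (simp add: L_def int_pow_neg m_assoc)
      finally show ?thesis
        using c(1) g by (metis group.int_pow_closed group_free_Abelian_group image_eqI monoid.m_closed group.is_monoid)
    qed
  qed
  have kern: "c = 0" if c: "c \<in> carrier ?F" "lin_comb G c = \<one>" for c
  proof (rule ccontr)
    assume "c \<noteq> 0"
    define I where "I = {n \<in> N. h n \<in> Poly_Mapping.keys c}"
    have "h ` I = Poly_Mapping.keys c" using c(1) by (auto simp: I_def)
    moreover have "inj_on h I" using \<open>inj_on h N\<close> by (rule inj_on_subset) (auto simp: I_def)
    ultimately have I: "finite I" "I \<noteq> {}"
      using \<open>c \<noteq> 0\<close> by (metis finite_imageD finite_keys, metis image_empty keys_eq_empty)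
    \<comment> \<open>The family is triangular: among the \<open>h m\<close> with \<open>m\<close>
      in \<open>I\<close>, only \<open>h n\<close> has a nonzero value under \<open>\<pi> n\<close>.
      Applying \<open>\<pi> n\<close> therefore isolates the coefficient at the top index, which is
      nonzero by the choice of \<open>I\<close>.\<close>
    define n where "n = Max I"
    have n: "n \<in> I" "\<And>k. k \<in> I \<Longrightarrow> k \<le> n" using I by (auto simp: n_def)
    let ?k = "\<lambda>m. Poly_Mapping.lookup c (h m)"
    define H where "H d = finprod G (\<lambda>x. x [^] Poly_Mapping.lookup c x) d" for d
    have "\<pi> n (H (h ` J)) = (\<Sum>m\<in>J. ?k m * \<pi> n (h m))" if "J \<subseteq> I" for J
    proof -
      have "finite J" using that I finite_subset by blast
      then show ?thesis using that
      proof (induction J)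
        case empty
        then show ?case using \<pi>_pow[of \<one> _ 0] by (simp add: H_def)
      next
        case (insert m J)
        have "h m \<notin> h ` J"
          using insert.hyps(2) insert.prems inj_onD[OF \<open>inj_on h I\<close>] by blast
        then have "H (h ` insert m J) = h m [^] ?k m \<otimes> H (h ` J)"
          unfolding H_def using insert.hyps hc by (simp add: Pi_iff image_iff)
        moreover have "H (h ` J) \<in> carrier G"
          unfolding H_def using hc by (intro finprod_closed) auto
        ultimately show ?case using insert hc by (simp add: \<pi>_mult \<pi>_pow)
      qed
    qed
    from this[of I] have "\<pi> n \<one> = (\<Sum>m\<in>I. ?k m * \<pi> n (h m))"
      using c(2) \<open>h ` I = Poly_Mapping.keys c\<close> by (simp add: lin_comb_def H_def)
    also have "\<dots> = (\<Sum>m\<in>{n}. ?k m * \<pi> n (h m))"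
      by (rule sum.mono_neutral_right) (use I n h0 in \<open>auto simp: le_neq_implies_less\<close>)
    finally have "?k n * \<pi> n (h n) = 0" using \<pi>_pow[of \<one> n 0] by simp
    then show False using n(1) by (auto simp: I_def N_def in_keys_iff)
  qed
  have "bij_betw (lin_comb G) (carrier ?F) (carrier G)"
  proof (rule bij_betwI')
    fix c d assume cd: "c \<in> carrier ?F" "d \<in> carrier ?F"
    have "c - d = 0" if "lin_comb G c = lin_comb G d"
    proof (rule kern)
      have i: "inv\<^bsub>?F\<^esub> d \<in> carrier ?F" using cd by simp
      have "lin_comb G (c \<otimes>\<^bsub>?F\<^esub> inv\<^bsub>?F\<^esub> d) = lin_comb G c \<otimes> inv lin_comb G d"
        using hom_mult[OF lh cd(1) i] hom_apply_inv[OF _ group_axioms lh cd(2)] by simp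
      then show "lin_comb G (c - d) = \<one>"
        using that cd hom_carrier[OF lh] by (simp add: image_subset_iff)
    qed (use cd keys_diff[of c d] in auto)
    then show "(lin_comb G c = lin_comb G d) = (c = d)" by auto
  next
    show "lin_comb G c \<in> carrier G" if "c \<in> carrier ?F" for c
      using that hom_carrier[OF lh] by blast
  next
    fix x assume x: "x \<in> carrier G"
    then obtain n where "x \<in> L n" using fin by (auto simp: L_def)
    then show "\<exists>c\<in>carrier ?F. x = lin_comb G c" using span by blast
  qed
  then show ?thesis using lh sub by (auto simp: is_basis_def iso_def)
qed

text \<open>Numbering the index set and padding with zero functionals turns finiteness of supports
  into vanishing from some index on.\<close>

lemma basis_exists_countable:
  fixes G (structure) and \<pi> :: "'i \<Rightarrow> 'a \<Rightarrow> int"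
  assumes G: "comm_group G" and I: "countable I" and hom: "\<And>i. i \<in> I \<Longrightarrow> \<pi> i \<in> hom G integer_group"
    and fin: "\<And>x. x \<in> carrier G \<Longrightarrow> finite {i \<in> I. \<pi> i x \<noteq> 0}"
    and inj: "\<And>x. \<lbrakk>x \<in> carrier G; \<forall>i\<in>I. \<pi> i x = 0\<rbrakk> \<Longrightarrow> x = \<one>"
  shows "\<exists>B. is_basis G B"
proof -
  define \<pi>' where "\<pi>' k x = (if k \<in> to_nat_on I ` I then \<pi> (from_nat_into I k) x else 0)" for k x
  have eq: "\<pi>' (to_nat_on I i) x = \<pi> i x" if "i \<in> I" for i x
    using that I by (simp add: \<pi>'_def)
  show ?thesis
  proof (rule basis_exists[OF G])
    show "\<pi>' k \<in> hom G integer_group" for k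
    proof (cases "k \<in> to_nat_on I ` I")
      case True
      then obtain i where "i \<in> I" "k = to_nat_on I i" by blast
      then show ?thesis using hom[of i] eq[of i] by (simp add: hom_def)
    qed (simp add: \<pi>'_def hom_def)
    show "\<exists>N. \<forall>k\<ge>N. \<pi>' k x = 0" if "x \<in> carrier G" for x
    proof -
      have "{k. \<pi>' k x \<noteq> 0} \<subseteq> to_nat_on I ` {i \<in> I. \<pi> i x \<noteq> 0}"
        using eq by (auto simp: \<pi>'_def split: if_splits)
      then have "finite {k. \<pi>' k x \<noteq> 0}"
        using fin[OF that] finite_surj by blast
      then obtain N where "\<forall>k\<in>{k. \<pi>' k x \<noteq> 0}. k < N"
        using finite_nat_set_iff_bounded by blast
      then show ?thesis by (intro exI[of _ N]) force
    qed
    show "x = \<one>" if "x \<in> carrier G" "\<forall>k. \<pi>' k x = 0" for x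
      using inj[OF that(1)] that(2) eq by metis
  qed
qed

lemma comm_group_restrict:
  assumes "comm_group G" "subgroup S G"
  shows "comm_group (G\<lparr>carrier := S\<rparr>)"
proof -
  interpret comm_group G by fact
  have "group (G\<lparr>carrier := S\<rparr>)"
    by (rule subgroup.subgroup_is_group[OF assms(2) group_axioms])
  then show ?thesis
    using subgroup.subset[OF assms(2)] by (intro group.group_comm_groupI) (auto intro: m_comm)
qed

text \<open>The coordinates of \<open>F\<close>, restricted to \<open>S\<close>, are functionals of
  the required kind. Both the freeness of the coboundaries and that of the relations
  \<open>Rel C\<close> come from here.\<close>

lemma countable_free_abelian_subgroup:
  assumes F: "countable_free_abelian F" and S: "subgroup S F"
  shows "countable_free_abelian (F\<lparr>carrier := S\<rparr>)"
proof -
  interpret comm_group F by (rule cfa_comm_group[OF F])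
  have SF: "S \<subseteq> carrier F" by (rule subgroup.subset[OF S])
  have cg: "comm_group (F\<lparr>carrier := S\<rparr>)" by (rule comm_group_restrict[OF comm_group_axioms S])
  have keys: "Poly_Mapping.keys (coords F x) \<subseteq> basis F" if "x \<in> S" for x
    using coords(1)[OF F, of x] that SF by auto
  have "\<exists>B. is_basis (F\<lparr>carrier := S\<rparr>) B"
  proof (rule basis_exists_countable[OF cg countable_basis[OF F]])
    show "(\<lambda>x. Poly_Mapping.lookup (coords F x) b) \<in> hom (F\<lparr>carrier := S\<rparr>) integer_group" for b
      using hom_mult[OF coords_hom[OF F]] SF by (auto simp: hom_def lookup_add subset_iff)
    show "finite {b \<in> basis F. Poly_Mapping.lookup (coords F x) b \<noteq> 0}" for x
      by (rule finite_subset[of _ "Poly_Mapping.keys (coords F x)"]) (auto simp: in_keys_iff)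
  next
    fix x assume x: "x \<in> carrier (F\<lparr>carrier := S\<rparr>)" "\<forall>b\<in>basis F. Poly_Mapping.lookup (coords F x) b = 0"
    then have "Poly_Mapping.keys (coords F x) = {}"
      using keys[of x] x(1) by (simp add: in_keys_iff[symmetric] del: keys_eq_empty) blast
    then show "x = \<one>\<^bsub>F\<lparr>carrier := S\<rparr>\<^esub>"
      using coords(2)[OF F, of x] x(1) SF hom_one[OF lin_comb_basis_hom[OF F]] by (auto simp: group_axioms)
  qed
  moreover have "countable S"
    using F SF countable_subset by (auto simp: countable_free_abelian_def)
  ultimately show ?thesis
    using cg by (simp add: countable_free_abelian_def)
qed

section \<open>The free resolution by generators and relations\<close>

lemma comm_group_Gen: "comm_group (Gen C)"
  by (simp add: Gen_def abelian_free_Abelian_group)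

lemma carrier_Gen: "g \<in> carrier (Gen C) \<longleftrightarrow> Poly_Mapping.keys g \<subseteq> carrier C"
  by (simp add: Gen_def)

text \<open>A combination is determined by its graph on the support, a finite set of pairs, and a
  countable set has only countably many finite subsets.\<close>

lemma countable_carrier_free_Abelian_group:
  assumes "countable S"
  shows "countable (carrier (free_Abelian_group S))"
proof -
  let ?g = "\<lambda>c :: 'a \<Rightarrow>\<^sub>0 int. (\<lambda>x. (x, Poly_Mapping.lookup c x)) ` Poly_Mapping.keys c"
  have "?g ` carrier (free_Abelian_group S) \<subseteq> {X. X \<subseteq> S \<times> UNIV \<and> finite X}"
    by auto
  moreover have "countable {X. X \<subseteq> S \<times> (UNIV :: int set) \<and> finite X}"
    using countable_Collect_finite_subset[of "S \<times> (UNIV :: int set)"] assms by (simp add: conj_commute)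
  ultimately have "countable (?g ` carrier (free_Abelian_group S))"
    by (rule countable_subset)
  moreover have "inj_on ?g (carrier (free_Abelian_group S))"
  proof (rule inj_onI, rule poly_mapping_eqI)
    fix c d :: "'a \<Rightarrow>\<^sub>0 int" and x
    assume "?g c = ?g d"
    then have "\<And>x n. (x, n) \<in> ?g c \<longleftrightarrow> (x, n) \<in> ?g d" by simp
    then show "Poly_Mapping.lookup c x = Poly_Mapping.lookup d x"
      by (auto simp: image_iff in_keys_iff) metis
  qed
  ultimately show ?thesis
    using countable_image_inj_on by blast
qed

text \<open>The coefficients serve as functionals. This avoids verifying that the elements
  \<open>frag_of c\<close> form a basis; no later argument refers to a particular basis of
  \<open>Gen C\<close>.\<close>

lemma countable_free_abelian_Gen:
  assumes "countable (carrier C)"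
  shows "countable_free_abelian (Gen C)"
proof -
  have "\<exists>B. is_basis (Gen C) B"
  proof (rule basis_exists_countable[OF comm_group_Gen assms])
    show "(\<lambda>x. Poly_Mapping.lookup x b) \<in> hom (Gen C) integer_group" for b
      by (auto simp: hom_def lookup_add Gen_def)
    show "finite {b \<in> carrier C. Poly_Mapping.lookup x b \<noteq> 0}" for x :: "'a \<Rightarrow>\<^sub>0 int"
      by (rule finite_subset[of _ "Poly_Mapping.keys x"]) (auto simp: in_keys_iff)
  next
    fix x assume x: "x \<in> carrier (Gen C)" "\<forall>b\<in>carrier C. Poly_Mapping.lookup x b = 0"
    then have "Poly_Mapping.keys x = {}"
      by (simp add: carrier_Gen in_keys_iff[symmetric] del: keys_eq_empty) blast
    then show "x = \<one>\<^bsub>Gen C\<^esub>" by (simp add: Gen_def)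
  qed
  then show ?thesis
    using countable_carrier_free_Abelian_group[OF assms] comm_group_Gen
    by (simp add: countable_free_abelian_def Gen_def)
qed

lemma mult_Gen [simp]: "x \<otimes>\<^bsub>Gen C\<^esub> y = x + y" and one_Gen [simp]: "\<one>\<^bsub>Gen C\<^esub> = 0"
  by (simp_all add: Gen_def)

lemma frag_of_Gen: "c \<in> carrier C \<Longrightarrow> frag_of c \<in> carrier (Gen C)"
  by (simp add: carrier_Gen)

lemma lin_comb_Gen_hom: "comm_group C \<Longrightarrow> lin_comb C \<in> hom (Gen C) C"
  by (simp add: Gen_def comm_group.lin_comb_hom)

lemma carrier_Rel: "g \<in> carrier (Rel C) \<longleftrightarrow> g \<in> carrier (Gen C) \<and> lin_comb C g = \<one>\<^bsub>C\<^esub>"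
  by (simp add: Rel_def kernel_def)

lemma subgroup_Rel:
  assumes "comm_group C" shows "subgroup (carrier (Rel C)) (Gen C)"
proof -
  interpret C: comm_group C by fact
  interpret G: comm_group "Gen C" by (rule comm_group_Gen)
  interpret group_hom "Gen C" C "lin_comb C"
    by unfold_locales (rule lin_comb_Gen_hom[OF assms])
  show ?thesis using subgroup_kernel by (simp add: Rel_def)
qed

lemma Rel_eq: "Rel C = (Gen C)\<lparr>carrier := carrier (Rel C)\<rparr>"
  by (simp add: Rel_def)

lemma countable_free_abelian_Rel:
  assumes "comm_group C" "countable (carrier C)"
  shows "countable_free_abelian (Rel C)"
  using countable_free_abelian_subgroup[OF countable_free_abelian_Gen[OF assms(2)] subgroup_Rel[OF assms(1)]]
  by (simp flip: Rel_eq)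

lemma mult_Rel [simp]: "x \<otimes>\<^bsub>Rel C\<^esub> y = x + y" and one_Rel [simp]: "\<one>\<^bsub>Rel C\<^esub> = 0"
  by (simp_all add: Rel_def)

lemma Gen_map_hom:
  assumes "f ` carrier C \<subseteq> carrier D"
  shows "Gen_map f \<in> hom (Gen C) (Gen D)"
proof (rule homI)
  fix c assume "c \<in> carrier (Gen C)"
  then show "Gen_map f c \<in> carrier (Gen D)"
    using assms keys_frag_extend[of "\<lambda>x. frag_of (f x)" c] unfolding Gen_map_def carrier_Gen by fastforce
qed (simp add: Gen_map_def frag_extend_add)

lemma lin_comb_Gen_map:
  assumes "comm_group C" "comm_group D" "f \<in> hom C D" "g \<in> carrier (Gen C)"
  shows "lin_comb D (Gen_map f g) = f (lin_comb C g)"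
proof -
  interpret C: comm_group C by fact
  interpret D: comm_group D by fact
  have f: "f ` carrier C \<subseteq> carrier D" by (rule hom_carrier[OF assms(3)])
  have h1: "lin_comb D \<circ> Gen_map f \<in> hom (free_Abelian_group (carrier C)) D"
    using Group.hom_compose[OF Gen_map_hom[OF f] lin_comb_Gen_hom[OF assms(2)]] by (simp add: Gen_def)
  have h2: "f \<circ> lin_comb C \<in> hom (free_Abelian_group (carrier C)) D"
    using Group.hom_compose[OF lin_comb_Gen_hom[OF assms(1)] assms(3)] by (simp add: Gen_def)
  have "(lin_comb D \<circ> Gen_map f) g = (f \<circ> lin_comb C) g"
    by (rule hom_eq_on_free[OF D.group_axioms h1 h2])
       (use f assms(4) in \<open>auto simp: Gen_map_def C.lin_comb_frag_of D.lin_comb_frag_of carrier_Gen image_subset_iff\<close>)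
  then show ?thesis by simp
qed

lemma Gen_map_Rel_hom:
  assumes "comm_group C" "comm_group D" "f \<in> hom C D"
  shows "Gen_map f \<in> hom (Rel C) (Rel D)"
proof -
  have G: "Gen_map f \<in> hom (Gen C) (Gen D)" by (rule Gen_map_hom[OF hom_carrier[OF assms(3)]])
  have "f \<one>\<^bsub>C\<^esub> = \<one>\<^bsub>D\<^esub>"
    using assms by (meson comm_group.axioms(2) hom_one)
  then show ?thesis
    using lin_comb_Gen_map[OF assms] hom_carrier[OF G] hom_mult[OF G]
    by (intro homI) (auto simp: carrier_Rel)
qed

section \<open>Cohomology of cochain complexes of free groups\<close>

definition cocycles :: "'a cochain \<Rightarrow> int \<Rightarrow> 'a set"
  where "cocycles A n = kernel (Grp A n) (Grp A (n + 1)) (Diff A n)"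

text \<open>The coset is taken in the whole group. Restricting the carrier keeps the multiplication,
  so for a cocycle it is the same set as the coset inside the cocycles.\<close>

definition coh_class :: "'a cochain \<Rightarrow> int \<Rightarrow> 'a \<Rightarrow> 'a set"
  where "coh_class A n x = coboundaries A n #>\<^bsub>Grp A n\<^esub> x"

context
  fixes A :: "'a cochain"
  assumes A: "free_complex A"
begin

lemma countable_free_abelian_Grp: "countable_free_abelian (Grp A n)"
  using A by (simp add: free_complex_def)

lemma comm_group_Grp: "comm_group (Grp A n)"
  by (rule cfa_comm_group[OF countable_free_abelian_Grp])

lemma group_Grp: "group (Grp A n)"
  by (rule comm_group.axioms(2)[OF comm_group_Grp])

lemma Diff_hom: "Diff A n \<in> hom (Grp A n) (Grp A (n + 1))"
  using A by (simp add: free_complex_def)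

lemma Diff_closed: "x \<in> carrier (Grp A n) \<Longrightarrow> Diff A n x \<in> carrier (Grp A (n + 1))"
  by (rule hom_in_carrier[OF Diff_hom])

lemma Diff_Diff: "x \<in> carrier (Grp A n) \<Longrightarrow> Diff A (n + 1) (Diff A n x) = \<one>\<^bsub>Grp A (n + 1 + 1)\<^esub>"
  using A by (simp add: free_complex_def add.commute[of 2])

lemma cocycles_iff: "x \<in> cocycles A n \<longleftrightarrow> x \<in> carrier (Grp A n) \<and> Diff A n x = \<one>\<^bsub>Grp A (n + 1)\<^esub>"
  by (simp add: cocycles_def kernel_def)

lemma coboundaries_Suc: "coboundaries A (n + 1) = Diff A n ` carrier (Grp A n)"
  by (simp add: coboundaries_def)

lemma Diff_group_hom: "group_hom (Grp A n) (Grp A (n + 1)) (Diff A n)"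
  by (simp add: group_hom_def group_hom_axioms_def group_Grp Diff_hom)

lemma subgroup_cocycles: "subgroup (cocycles A n) (Grp A n)"
  unfolding cocycles_def by (rule group_hom.subgroup_kernel[OF Diff_group_hom])

lemma subgroup_coboundaries: "subgroup (coboundaries A n) (Grp A n)"
  using group_hom.img_is_subgroup[OF Diff_group_hom[of "n - 1"]] by (simp add: coboundaries_def)

lemma coboundaries_subset_cocycles: "coboundaries A n \<subseteq> cocycles A n"
proof
  fix y assume "y \<in> coboundaries A n"
  then obtain x where "x \<in> carrier (Grp A (n - 1))" "y = Diff A (n - 1) x"
    by (auto simp: coboundaries_def)
  then show "y \<in> cocycles A n"
    using Diff_closed[of x "n - 1"] Diff_Diff[of x "n - 1"] by (simp add: cocycles_iff)
qed

lemma cohomology_eq: "cohomology A n = (Grp A n)\<lparr>carrier := cocycles A n\<rparr> Mod coboundaries A n"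
  by (simp add: cohomology_def cocycles_def)

lemma comm_group_cocycles: "comm_group ((Grp A n)\<lparr>carrier := cocycles A n\<rparr>)"
  by (rule comm_group_restrict[OF comm_group_Grp subgroup_cocycles])

lemma subgroup_coboundaries_cocycles: "subgroup (coboundaries A n) ((Grp A n)\<lparr>carrier := cocycles A n\<rparr>)"
  by (rule group.subgroup_incl[OF group_Grp subgroup_coboundaries subgroup_cocycles coboundaries_subset_cocycles])

lemma normal_coboundaries: "coboundaries A n \<lhd> (Grp A n)\<lparr>carrier := cocycles A n\<rparr>"
  by (rule comm_group.subgroup_imp_normal[OF comm_group_cocycles subgroup_coboundaries_cocycles])

lemma comm_group_cohomology: "comm_group (cohomology A n)"
  unfolding cohomology_eq by (rule comm_group.abelian_FactGroup[OF comm_group_cocycles subgroup_coboundaries_cocycles])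

lemma group_cohomology: "group (cohomology A n)"
  by (rule comm_group.axioms(2)[OF comm_group_cohomology])

lemma coh_class_hom: "coh_class A n \<in> hom ((Grp A n)\<lparr>carrier := cocycles A n\<rparr>) (cohomology A n)"
  using normal.r_coset_hom_Mod[OF normal_coboundaries, of n]
  by (simp add: cohomology_eq coh_class_def[abs_def] r_coset_def)

lemma coh_class_mult: "\<lbrakk>x \<in> cocycles A n; y \<in> cocycles A n\<rbrakk> \<Longrightarrow>
    coh_class A n (x \<otimes>\<^bsub>Grp A n\<^esub> y) = coh_class A n x \<otimes>\<^bsub>cohomology A n\<^esub> coh_class A n y"
  using hom_mult[OF coh_class_hom] by simp

lemma carrier_cohomology: "carrier (cohomology A n) = coh_class A n ` cocycles A n"
  by (auto simp: cohomology_eq carrier_FactGroup coh_class_def r_coset_def image_def)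

lemma countable_cohomology: "countable (carrier (cohomology A n))"
proof -
  have "countable (cocycles A n)"
    using countable_free_abelian_Grp[of n] countable_subset[of "cocycles A n" "carrier (Grp A n)"]
    by (simp add: countable_free_abelian_def cocycles_iff subset_iff)
  then show ?thesis by (simp add: carrier_cohomology)
qed

lemma coh_class_closed: "x \<in> cocycles A n \<Longrightarrow> coh_class A n x \<in> carrier (cohomology A n)"
  by (simp add: carrier_cohomology)

lemma coh_class_eq_one_iff:
  assumes "x \<in> cocycles A n"
  shows "coh_class A n x = \<one>\<^bsub>cohomology A n\<^esub> \<longleftrightarrow> x \<in> coboundaries A n"
proof -
  let ?Z = "(Grp A n)\<lparr>carrier := cocycles A n\<rparr>"
  have "coboundaries A n #>\<^bsub>?Z\<^esub> x = coboundaries A n \<longleftrightarrow> x \<in> coboundaries A n"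
    using assms comm_group.axioms(2)[OF comm_group_cocycles]
    by (metis group.coset_join1 group.coset_join2 partial_object.select_convs(1) partial_object.surjective
        partial_object.update_convs(1) subgroup_coboundaries_cocycles subgroup.subset)
  then show ?thesis
    by (simp add: coh_class_def cohomology_eq FactGroup_def r_coset_def)
qed

section \<open>Splittings of the differential and lifts between cocycles and generators\<close>

lemma countable_free_abelian_coboundaries:
  "countable_free_abelian ((Grp A n)\<lparr>carrier := coboundaries A n\<rparr>)"
  by (rule countable_free_abelian_subgroup[OF countable_free_abelian_Grp subgroup_coboundaries])

text \<open>Projectivity is applied to the inclusion of the coboundaries, which is lifted through
  the differential.\<close>

lemma coboundary_section:
  obtains s where "s \<in> hom ((Grp A (n + 1))\<lparr>carrier := coboundaries A (n + 1)\<rparr>) (Grp A n)"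
    "\<And>y. y \<in> coboundaries A (n + 1) \<Longrightarrow> Diff A n (s y) = y"
proof (rule free_projective[OF countable_free_abelian_coboundaries comm_group_Grp group_Grp Diff_hom])
  show "(\<lambda>y. y) \<in> hom ((Grp A (n + 1))\<lparr>carrier := coboundaries A (n + 1)\<rparr>) (Grp A (n + 1))"
    using subgroup.subset[OF subgroup_coboundaries] by (auto simp: hom_def)
qed (use that in \<open>auto simp: coboundaries_Suc\<close>)

text \<open>In additive notation \<open>r\<close> is the projection 1 - s d, where d s = 1 on
  coboundaries. The section is a parameter because the main construction needs one and the same
  \<open>s\<close> here and in the retraction of \<iota>.\<close>

lemma cocycle_retraction:
  assumes s: "s \<in> hom ((Grp A (n + 1))\<lparr>carrier := coboundaries A (n + 1)\<rparr>) (Grp A n)"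
    and Ds: "\<And>y. y \<in> coboundaries A (n + 1) \<Longrightarrow> Diff A n (s y) = y"
  defines "r \<equiv> \<lambda>x. x \<otimes>\<^bsub>Grp A n\<^esub> inv\<^bsub>Grp A n\<^esub> s (Diff A n x)"
  shows "r \<in> hom (Grp A n) (Grp A n)"
    and "\<And>x. x \<in> carrier (Grp A n) \<Longrightarrow> r x \<in> cocycles A n"
    and "\<And>x. x \<in> cocycles A n \<Longrightarrow> r x = x"
proof -
  interpret G: comm_group "Grp A n" by (rule comm_group_Grp)
  interpret G1: comm_group "Grp A (n + 1)" by (rule comm_group_Grp)
  have D: "Diff A n \<in> hom (Grp A n) ((Grp A (n + 1))\<lparr>carrier := coboundaries A (n + 1)\<rparr>)"
    using Diff_hom by (auto simp: hom_def coboundaries_Suc)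
  have sD: "(\<lambda>x. s (Diff A n x)) \<in> hom (Grp A n) (Grp A n)"
    using Group.hom_compose[OF D s] by (simp add: o_def)
  show "r \<in> hom (Grp A n) (Grp A n)"
    unfolding r_def by (rule hom_divide[OF comm_group_Grp _ sD]) (simp add: hom_def)
  show "r x \<in> cocycles A n" if x: "x \<in> carrier (Grp A n)" for x
  proof -
    have sx: "s (Diff A n x) \<in> carrier (Grp A n)" using hom_in_carrier[OF sD x] .
    have "Diff A n (r x) = Diff A n x \<otimes>\<^bsub>Grp A (n + 1)\<^esub> inv\<^bsub>Grp A (n + 1)\<^esub> Diff A n (s (Diff A n x))"
      unfolding r_def using x sx
      by (simp add: hom_mult[OF Diff_hom] hom_apply_inv[OF group_Grp group_Grp Diff_hom])
    also have "\<dots> = \<one>\<^bsub>Grp A (n + 1)\<^esub>"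
      using x Diff_closed[OF x] by (simp add: Ds coboundaries_Suc)
    finally show ?thesis using x sx by (simp add: cocycles_iff r_def)
  qed
  show "r x = x" if x: "x \<in> cocycles A n" for x
  proof -
    have "s (\<one>\<^bsub>Grp A (n + 1)\<^esub>) = \<one>\<^bsub>Grp A n\<^esub>"
      using hom_one[OF s] G.group_axioms subgroup.subgroup_is_group[OF subgroup_coboundaries group_Grp] by simp
    then show ?thesis using x by (simp add: r_def cocycles_iff)
  qed
qed

lemma ex_cocycle_retraction:
  fixes n :: int
  obtains r where "r \<in> hom (Grp A n) (Grp A n)"
    "\<And>x. x \<in> carrier (Grp A n) \<Longrightarrow> r x \<in> cocycles A n" "\<And>x. x \<in> cocycles A n \<Longrightarrow> r x = x"
proof -
  obtain s where "s \<in> hom ((Grp A (n + 1))\<lparr>carrier := coboundaries A (n + 1)\<rparr>) (Grp A n)"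
    "\<And>y. y \<in> coboundaries A (n + 1) \<Longrightarrow> Diff A n (s y) = y"
    using coboundary_section by blast
  from cocycle_retraction[OF this] show thesis by (rule that)
qed

lemma coh_class_retraction_hom:
  assumes "r \<in> hom (Grp A n) (Grp A n)" "\<And>x. x \<in> carrier (Grp A n) \<Longrightarrow> r x \<in> cocycles A n"
  shows "(\<lambda>x. coh_class A n (r x)) \<in> hom (Grp A n) (cohomology A n)"
  using assms by (intro homI) (auto simp: coh_class_closed hom_mult coh_class_mult)

text \<open>The class map lives only on cocycles. Composed with a retraction onto them it is defined
  on the free group \<open>Grp A n\<close>, and so it lifts through the surjection
  \<open>lin_comb\<close>. With the whole group as domain, the lift can be dualized to an arrow into
  Hom(\<open>Grp A n\<close>, X).\<close>

lemma cocycle_lift_to_Gen: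
  "\<exists>\<theta>. \<theta> \<in> hom (Grp A n) (Gen (cohomology A n)) \<and>
    (\<forall>z\<in>cocycles A n. lin_comb (cohomology A n) (\<theta> z) = coh_class A n z)"
proof -
  obtain r where r: "r \<in> hom (Grp A n) (Grp A n)"
    "\<And>x. x \<in> carrier (Grp A n) \<Longrightarrow> r x \<in> cocycles A n" "\<And>x. x \<in> cocycles A n \<Longrightarrow> r x = x"
    using ex_cocycle_retraction[of n] by blast
  let ?H = "cohomology A n"
  have "(\<lambda>x. coh_class A n (r x)) ` carrier (Grp A n) \<subseteq> lin_comb ?H ` carrier (Gen ?H)"
  proof clarify
    fix x assume "x \<in> carrier (Grp A n)"
    then have "coh_class A n (r x) \<in> carrier ?H" using r(2) coh_class_closed by blast
    then show "coh_class A n (r x) \<in> lin_comb ?H ` carrier (Gen ?H)"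
      using comm_group.lin_comb_frag_of[OF comm_group_cohomology] frag_of_Gen by (metis image_eqI)
  qed
  then obtain \<theta> where "\<theta> \<in> hom (Grp A n) (Gen ?H)"
    "\<And>x. x \<in> carrier (Grp A n) \<Longrightarrow> lin_comb ?H (\<theta> x) = coh_class A n (r x)"
    using free_projective[OF countable_free_abelian_Grp comm_group_Gen group_cohomology
        lin_comb_Gen_hom[OF comm_group_cohomology] coh_class_retraction_hom[OF r(1,2)]] by blast
  then show ?thesis
    using r(3) by (metis cocycles_iff)
qed

text \<open>The universal property of the quotient, phrased for a homomorphism on all of
  \<open>Grp A n\<close> because \<open>cev\<close> comes in this form; \<open>t'\<close> reflects
  only its values on cocycles.\<close>

lemma cohomology_hom:
  assumes L: "group L" and t: "t \<in> hom (Grp A n) L" and t1: "\<And>y. y \<in> coboundaries A n \<Longrightarrow> t y = \<one>\<^bsub>L\<^esub>"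
  obtains t' where "t' \<in> hom (cohomology A n) L" "\<And>z. z \<in> cocycles A n \<Longrightarrow> t' (coh_class A n z) = t z"
proof -
  interpret L: group L by fact
  interpret Z: comm_group "(Grp A n)\<lparr>carrier := cocycles A n\<rparr>" by (rule comm_group_cocycles)
  have tZ: "t \<in> hom ((Grp A n)\<lparr>carrier := cocycles A n\<rparr>) L"
    using t by (rule hom_restrict_carrier) (auto simp: cocycles_iff)
  have cong: "t x = t y" if xy: "x \<in> cocycles A n" "y \<in> cocycles A n" "coh_class A n x = coh_class A n y" for x y
  proof -
    let ?Z = "(Grp A n)\<lparr>carrier := cocycles A n\<rparr>"
    let ?d = "x \<otimes>\<^bsub>?Z\<^esub> inv\<^bsub>?Z\<^esub> y"
    have iy: "inv\<^bsub>?Z\<^esub> y \<in> carrier ?Z" and d: "?d \<in> carrier ?Z"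
      using Z.inv_closed[of y] Z.m_closed[of x "inv\<^bsub>?Z\<^esub> y"] xy by simp_all
    have "coh_class A n ?d = coh_class A n x \<otimes>\<^bsub>cohomology A n\<^esub> inv\<^bsub>cohomology A n\<^esub> coh_class A n y"
      using hom_mult[OF coh_class_hom, of x n "inv\<^bsub>?Z\<^esub> y"] iy xy
        hom_apply_inv[OF Z.group_axioms group_cohomology coh_class_hom, of y] by simp
    then have "coh_class A n ?d = \<one>\<^bsub>cohomology A n\<^esub>"
      using group.r_inv[OF group_cohomology coh_class_closed[OF xy(2)]] xy(3) by simp
    then have "?d \<in> coboundaries A n" using coh_class_eq_one_iff d by simp
    then have "t x \<otimes>\<^bsub>L\<^esub> inv\<^bsub>L\<^esub> t y = \<one>\<^bsub>L\<^esub>"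
      using t1[of ?d] hom_mult[OF tZ, of x "inv\<^bsub>?Z\<^esub> y"] iy xy
        hom_apply_inv[OF Z.group_axioms L tZ, of y] by simp
    then show ?thesis
      using hom_in_carrier[OF tZ, of x] hom_in_carrier[OF tZ, of y] xy L.inv_equality[of "t x" "inv\<^bsub>L\<^esub> t y"] by simp
  qed
  define t' where "t' c = t (SOME z. z \<in> cocycles A n \<and> coh_class A n z = c)" for c
  have t': "t' (coh_class A n z) = t z" if z: "z \<in> cocycles A n" for z
  proof -
    have "\<exists>w. w \<in> cocycles A n \<and> coh_class A n w = coh_class A n z" using z by blast
    from someI_ex[OF this] show ?thesis unfolding t'_def using cong z by blast
  qed
  have "t' \<in> hom (cohomology A n) L"
  proof (rule homI)
    fix c assume "c \<in> carrier (cohomology A n)"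
    then show "t' c \<in> carrier L"
      using hom_in_carrier[OF t] by (auto simp: carrier_cohomology t' cocycles_iff)
  next
    fix c d assume "c \<in> carrier (cohomology A n)" "d \<in> carrier (cohomology A n)"
    then obtain x y where xy: "x \<in> cocycles A n" "y \<in> cocycles A n" "c = coh_class A n x" "d = coh_class A n y"
      by (auto simp: carrier_cohomology)
    have "x \<otimes>\<^bsub>Grp A n\<^esub> y \<in> cocycles A n"
      using xy subgroup.m_closed[OF subgroup_cocycles] by blast
    then show "t' (c \<otimes>\<^bsub>cohomology A n\<^esub> d) = t' c \<otimes>\<^bsub>L\<^esub> t' d"
      using xy hom_mult[OF tZ, of x y] by (simp add: t' flip: coh_class_mult)
  qed
  then show thesis using that t' by blast
qed

text \<open>Projectivity is applied with the group of cocycles as target, where the class map is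
  surjective, so that the values of the lift are cocycles by construction.\<close>

lemma Gen_lift_to_cocycles:
  obtains \<sigma> where "\<sigma> \<in> hom (Gen (cohomology A n)) (Grp A n)"
    "\<And>g. g \<in> carrier (Gen (cohomology A n)) \<Longrightarrow> \<sigma> g \<in> cocycles A n"
    "\<And>g. g \<in> carrier (Gen (cohomology A n)) \<Longrightarrow> coh_class A n (\<sigma> g) = lin_comb (cohomology A n) g"
proof -
  let ?H = "cohomology A n"
  have "lin_comb ?H ` carrier (Gen ?H) \<subseteq> coh_class A n ` carrier ((Grp A n)\<lparr>carrier := cocycles A n\<rparr>)"
    using hom_carrier[OF lin_comb_Gen_hom[OF comm_group_cohomology]] by (simp add: carrier_cohomology)
  then obtain \<sigma> where "\<sigma> \<in> hom (Gen ?H) ((Grp A n)\<lparr>carrier := cocycles A n\<rparr>)"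
    "\<And>g. g \<in> carrier (Gen ?H) \<Longrightarrow> coh_class A n (\<sigma> g) = lin_comb ?H g"
    using free_projective[OF countable_free_abelian_Gen[OF countable_cohomology] comm_group_cocycles
        group_cohomology coh_class_hom lin_comb_Gen_hom[OF comm_group_cohomology]] by blast
  then show thesis
    using that[of \<sigma>] by (auto simp: hom_def cocycles_iff Pi_iff)
qed

end

section \<open>Chain maps on cohomology\<close>

lemma chain_map_hom: "chain_map A B f \<Longrightarrow> f n \<in> hom (Grp A n) (Grp B n)"
  and chain_map_Diff: "\<lbrakk>chain_map A B f; x \<in> carrier (Grp A n)\<rbrakk> \<Longrightarrow> f (n + 1) (Diff A n x) = Diff B n (f n x)"
  by (auto simp: chain_map_def)

lemma chain_map_cocycles:
  assumes "free_complex A" "free_complex B" "chain_map A B f" "x \<in> cocycles A n"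
  shows "f n x \<in> cocycles B n"
  using assms chain_map_Diff[OF assms(3), of x n] hom_in_carrier[OF chain_map_hom[OF assms(3)], of x n]
    hom_one[OF chain_map_hom[OF assms(3), of "n + 1"]]
  by (simp add: cocycles_iff group_Grp)

text \<open>A chain map may carry a coset of coboundaries onto a proper part of a coset. The product
  with \<open>coboundaries B n\<close> in \<open>cohomology_map\<close> fills it up.\<close>

lemma cohomology_map_coh_class:
  assumes A: "free_complex A" and B: "free_complex B" and f: "chain_map A B f" and x: "x \<in> cocycles A n"
  shows "cohomology_map B f n (coh_class A n x) = coh_class B n (f n x)"
proof -
  interpret GB: comm_group "Grp B n" by (rule comm_group_Grp[OF B])
  have BA: "coboundaries A n \<subseteq> carrier (Grp A n)" and BB: "coboundaries B n \<subseteq> carrier (Grp B n)"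
    using subgroup.subset subgroup_coboundaries A B by blast+
  have fh: "f n \<in> hom (Grp A n) (Grp B n)" by (rule chain_map_hom[OF f])
  have xc: "x \<in> carrier (Grp A n)" using x cocycles_iff[OF A] by blast
  have fx: "f n x \<in> carrier (Grp B n)" by (rule hom_in_carrier[OF fh xc])
  have fb: "f n y \<in> coboundaries B n" if "y \<in> coboundaries A n" for y
    using that chain_map_Diff[OF f, of _ "n - 1"] hom_in_carrier[OF chain_map_hom[OF f, of "n - 1"]]
    by (auto simp: coboundaries_def)
  have one: "\<one>\<^bsub>Grp A n\<^esub> \<in> coboundaries A n" by (rule subgroup.one_closed[OF subgroup_coboundaries[OF A]])
  show ?thesis
  proof
    show "cohomology_map B f n (coh_class A n x) \<subseteq> coh_class B n (f n x)"
    proof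
      fix y assume "y \<in> cohomology_map B f n (coh_class A n x)"
      then obtain b a where ba: "b \<in> coboundaries B n" "a \<in> coboundaries A n"
        "y = b \<otimes>\<^bsub>Grp B n\<^esub> f n (a \<otimes>\<^bsub>Grp A n\<^esub> x)"
        by (auto simp: cohomology_map_def coh_class_def r_coset_def set_mult_def)
      then have "y = (b \<otimes>\<^bsub>Grp B n\<^esub> f n a) \<otimes>\<^bsub>Grp B n\<^esub> f n x"
        using BA BB fb fx xc hom_mult[OF fh, of a x] GB.m_assoc[of b "f n a" "f n x"] by (auto simp: subset_iff)
      moreover have "b \<otimes>\<^bsub>Grp B n\<^esub> f n a \<in> coboundaries B n"
        using ba fb subgroup.m_closed[OF subgroup_coboundaries[OF B]] by blast
      ultimately show "y \<in> coh_class B n (f n x)"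
        by (auto simp: coh_class_def r_coset_def)
    qed
    show "coh_class B n (f n x) \<subseteq> cohomology_map B f n (coh_class A n x)"
    proof
      fix y assume "y \<in> coh_class B n (f n x)"
      then obtain b where b: "b \<in> coboundaries B n" "y = b \<otimes>\<^bsub>Grp B n\<^esub> f n x"
        by (auto simp: coh_class_def r_coset_def)
      have "x = \<one>\<^bsub>Grp A n\<^esub> \<otimes>\<^bsub>Grp A n\<^esub> x"
        using xc group.is_monoid[OF group_Grp[OF A]] by (simp add: monoid.l_one)
      then have "x \<in> coh_class A n x"
        using one by (auto simp: coh_class_def r_coset_def)
      then show "y \<in> cohomology_map B f n (coh_class A n x)"
        using b by (auto simp: cohomology_map_def set_mult_def)
    qed
  qed
qed

lemma cohomology_map_hom:
  assumes A: "free_complex A" and B: "free_complex B" and f: "chain_map A B f"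
  shows "cohomology_map B f n \<in> hom (cohomology A n) (cohomology B n)"
proof (rule homI)
  fix c assume "c \<in> carrier (cohomology A n)"
  then show "cohomology_map B f n c \<in> carrier (cohomology B n)"
    using chain_map_cocycles[OF assms] by (auto simp: carrier_cohomology[OF A] cohomology_map_coh_class[OF assms] coh_class_closed[OF B])
next
  fix c d assume "c \<in> carrier (cohomology A n)" "d \<in> carrier (cohomology A n)"
  then obtain x y where xy: "x \<in> cocycles A n" "y \<in> cocycles A n" "c = coh_class A n x" "d = coh_class A n y"
    by (auto simp: carrier_cohomology[OF A])
  have m: "x \<otimes>\<^bsub>Grp A n\<^esub> y \<in> cocycles A n"
    using xy subgroup.m_closed[OF subgroup_cocycles[OF A]] by blast
  have "f n (x \<otimes>\<^bsub>Grp A n\<^esub> y) = f n x \<otimes>\<^bsub>Grp B n\<^esub> f n y"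
    using xy hom_mult[OF chain_map_hom[OF f]] by (simp add: cocycles_iff[OF A])
  then show "cohomology_map B f n (c \<otimes>\<^bsub>cohomology A n\<^esub> d)
      = cohomology_map B f n c \<otimes>\<^bsub>cohomology B n\<^esub> cohomology_map B f n d"
    using xy m chain_map_cocycles[OF assms]
    by (simp add: cohomology_map_coh_class[OF assms] coh_class_mult[OF B] flip: coh_class_mult[OF A])
qed

section \<open>Categories\<close>

context category
begin

lemma homs_iff: "f \<in> homs M a b \<longleftrightarrow> f \<in> Arr M \<and> Src M f = a \<and> Tgt M f = b"
  by (auto simp: homs_def)

lemma homs_Obj: "f \<in> homs M a b \<Longrightarrow> a \<in> Obj M" "f \<in> homs M a b \<Longrightarrow> b \<in> Obj M"
  using Src_Obj Tgt_Obj by (auto simp: homs_def)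

text \<open>Associativity carries typing premises with an intermediate object that rewriting cannot
  guess. This rule rewrites the two leftmost factors with the typings supplied; most evaluations of
  a composite arrow at a group element below are an application of it.\<close>

lemma Comp_eq_left:
  "\<lbrakk>h \<cdot> g = k; f \<in> homs M a b; g \<in> homs M b c; h \<in> homs M c d\<rbrakk> \<Longrightarrow> h \<cdot> (g \<cdot> f) = k \<cdot> f"
  using Comp_assoc by metis

lemma split_epi:
  assumes g: "g \<in> homs M a b" and s: "s \<in> homs M b a" and gs: "g \<cdot> s = Ident M b"
  shows "is_epi M g"
  unfolding is_epi_def
proof (intro conjI allI ballI impI)
  show "g \<in> Arr M" using g by (simp add: homs_def)
  fix T h k assume hk: "h \<in> homs M (Tgt M g) T" "k \<in> homs M (Tgt M g) T" "h \<cdot> g = k \<cdot> g"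
  have "Tgt M g = b" using g by (simp add: homs_def)
  then show "h = k"
    using hk Comp_assoc[OF s g, of h T] Comp_assoc[OF s g, of k T] gs Comp_Ident_right by metis
qed

lemma split_mono:
  assumes f: "f \<in> homs M a b" and r: "r \<in> homs M b a" and rf: "r \<cdot> f = Ident M a"
  shows "is_mono M f"
  unfolding is_mono_def
proof (intro conjI allI ballI impI)
  show "f \<in> Arr M" using f by (simp add: homs_def)
  fix T h k assume hk: "h \<in> homs M T (Src M f)" "k \<in> homs M T (Src M f)" "f \<cdot> h = f \<cdot> k"
  have "Src M f = a" using f by (simp add: homs_def)
  then show "h = k"
    using hk Comp_assoc[OF _ f r, of h T] Comp_assoc[OF _ f r, of k T] rf Comp_Ident_left by metis
qed

end

section \<open>Additivity of composition and representing objects\<close>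

context preadditive_category
begin

abbreviation add_arr (infixl "\<oplus>" 65) where "f \<oplus> g \<equiv> Add M f g"

lemma hom_group_simps [simp]:
  "carrier (hom_group M a b) = homs M a b"
  "f \<otimes>\<^bsub>hom_group M a b\<^esub> g = f \<oplus> g"
  "\<one>\<^bsub>hom_group M a b\<^esub> = Zero M a b"
  by (simp_all add: hom_group_def)

lemma group_hom_group: "\<lbrakk>a \<in> Obj M; b \<in> Obj M\<rbrakk> \<Longrightarrow> group (hom_group M a b)"
  by (rule comm_group.axioms(2)[OF hom_comm_group])

lemma Zero_homs: "\<lbrakk>a \<in> Obj M; b \<in> Obj M\<rbrakk> \<Longrightarrow> Zero M a b \<in> homs M a b"
  using monoid.one_closed[OF group.is_monoid[OF group_hom_group]] by simp

lemma Add_homs: "\<lbrakk>f \<in> homs M a b; g \<in> homs M a b\<rbrakk> \<Longrightarrow> f \<oplus> g \<in> homs M a b"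
  using monoid.m_closed[OF group.is_monoid[OF group_hom_group], of a b f g] homs_Obj[of f a b] by simp

lemma Add_Zero_right: "f \<in> homs M a b \<Longrightarrow> f \<oplus> Zero M a b = f"
  using monoid.r_one[OF group.is_monoid[OF group_hom_group], of a b f] homs_Obj[of f a b] by simp

lemma Add_Zero_left: "f \<in> homs M a b \<Longrightarrow> Zero M a b \<oplus> f = f"
  using monoid.l_one[OF group.is_monoid[OF group_hom_group], of a b f] homs_Obj[of f a b] by simp

lemma precomp_hom: "\<lbrakk>h \<in> homs M S T; X \<in> Obj M\<rbrakk> \<Longrightarrow> (\<lambda>g. g \<cdot> h) \<in> hom (hom_group M T X) (hom_group M S X)"
  by (intro homI) (auto simp: Comp_homs Comp_Add_left)

lemma postcomp_hom: "\<lbrakk>u \<in> homs M X Y; T \<in> Obj M\<rbrakk> \<Longrightarrow> (\<lambda>g. u \<cdot> g) \<in> hom (hom_group M T X) (hom_group M T Y)"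
  by (intro homI) (auto simp: Comp_homs Comp_Add_right)

lemma Zero_Comp: "\<lbrakk>h \<in> homs M S T; X \<in> Obj M\<rbrakk> \<Longrightarrow> Zero M T X \<cdot> h = Zero M S X"
  using hom_one[OF precomp_hom, of h S T X] homs_Obj[of h S T] by (simp add: group_hom_group)

lemma Comp_Zero: "\<lbrakk>u \<in> homs M X Y; T \<in> Obj M\<rbrakk> \<Longrightarrow> u \<cdot> Zero M T X = Zero M T Y"
  using hom_one[OF postcomp_hom, of u X Y T] homs_Obj[of u X Y] by (simp add: group_hom_group)

lemma hom_precomp:
  assumes "t \<in> hom F (hom_group M T X)" "h \<in> homs M S T" "X \<in> Obj M"
  shows "(\<lambda>x. t x \<cdot> h) \<in> hom F (hom_group M S X)"
  using Group.hom_compose[OF assms(1) precomp_hom[OF assms(2,3)]] by (simp add: o_def)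

lemma hom_postcomp:
  assumes "t \<in> hom F (hom_group M T X)" "u \<in> homs M X Y" "T \<in> Obj M"
  shows "(\<lambda>x. u \<cdot> t x) \<in> hom F (hom_group M T Y)"
  using Group.hom_compose[OF assms(1) postcomp_hom[OF assms(2,3)]] by (simp add: o_def)

text \<open>Naturality in \<open>T\<close> is built in, since the correspondence between arrows and
  homomorphisms is composition with the arrows \<open>e x\<close>. The homomorphism \<open>e\<close>
  itself corresponds to the identity of \<open>P\<close>.\<close>

definition represents :: "('a, 'b) monoid_scheme \<Rightarrow> 'o \<Rightarrow> 'o \<Rightarrow> ('a \<Rightarrow> 'm) \<Rightarrow> bool"
  where "represents F X P e \<longleftrightarrow> X \<in> Obj M \<and> P \<in> Obj M \<and> group F \<and> e \<in> hom F (hom_group M P X) \<and>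
    (\<forall>T\<in>Obj M. \<forall>t\<in>hom F (hom_group M T X). \<exists>!h. h \<in> homs M T P \<and> (\<forall>x\<in>carrier F. e x \<cdot> h = t x))"

lemma represents_homs: "\<lbrakk>represents F X P e; x \<in> carrier F\<rbrakk> \<Longrightarrow> e x \<in> homs M P X"
  using hom_in_carrier by (fastforce simp: represents_def)

lemma represents_Add: "\<lbrakk>represents F X P e; x \<in> carrier F; y \<in> carrier F\<rbrakk> \<Longrightarrow> e (x \<otimes>\<^bsub>F\<^esub> y) = e x \<oplus> e y"
  using hom_mult[of e F "hom_group M P X" x y] by (simp add: represents_def)

lemma represents_one: "represents F X P e \<Longrightarrow> e \<one>\<^bsub>F\<^esub> = Zero M P X"
  using hom_one[of e F "hom_group M P X"] by (auto simp: represents_def group_hom_group)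

lemma represents_arr:
  assumes "represents F X P e" "T \<in> Obj M" "t \<in> hom F (hom_group M T X)"
  obtains h where "h \<in> homs M T P" "\<And>x. x \<in> carrier F \<Longrightarrow> e x \<cdot> h = t x"
  using assms unfolding represents_def by blast

text \<open>The arrows \<open>e x\<close> are jointly monic: uniqueness is applied to the
  homomorphism that \<open>k\<close> induces.\<close>

lemma represents_eqI:
  assumes R: "represents F X P e" and h: "h \<in> homs M T P" and k: "k \<in> homs M T P"
    and eq: "\<And>x. x \<in> carrier F \<Longrightarrow> e x \<cdot> h = e x \<cdot> k"
  shows "h = k"
proof -
  have "(\<lambda>x. e x \<cdot> k) \<in> hom F (hom_group M T X)"
    using R k by (intro hom_precomp) (auto simp: represents_def)
  then have "\<exists>!h. h \<in> homs M T P \<and> (\<forall>x\<in>carrier F. e x \<cdot> h = e x \<cdot> k)"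
    using R homs_Obj(1)[OF h] by (simp add: represents_def)
  then show ?thesis using h k eq by blast
qed

end

section \<open>Kernels, cokernels and split exact sequences\<close>

context abelian_category
begin

lemma ker_arr_kernel: "f \<in> Arr M \<Longrightarrow> is_kernel M f (ker_arr M f)"
  unfolding ker_arr_def by (rule someI_ex[OF kernels])

lemma coker_arr_cokernel: "f \<in> Arr M \<Longrightarrow> is_cokernel M f (coker_arr M f)"
  unfolding coker_arr_def by (rule someI_ex[OF cokernels])

lemma ker_arr_homs: "f \<in> homs M a b \<Longrightarrow> ker_arr M f \<in> homs M (Ker M f) a"
  using ker_arr_kernel[of f] by (simp add: is_kernel_def homs_def Ker_def)

lemma coker_arr_homs: "f \<in> homs M a b \<Longrightarrow> coker_arr M f \<in> homs M b (Coker M f)"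
  using coker_arr_cokernel[of f] by (simp add: is_cokernel_def homs_def Coker_def)

lemma Comp_ker_arr: "f \<in> homs M a b \<Longrightarrow> f \<cdot> ker_arr M f = Zero M (Ker M f) b"
  using ker_arr_kernel[of f] by (simp add: is_kernel_def homs_def Ker_def)

lemma coker_arr_Comp: "f \<in> homs M a b \<Longrightarrow> coker_arr M f \<cdot> f = Zero M a (Coker M f)"
  using coker_arr_cokernel[of f] by (simp add: is_cokernel_def homs_def Coker_def)

lemma ker_arr_factor:
  "\<lbrakk>f \<in> homs M a b; h \<in> homs M T a; f \<cdot> h = Zero M T b\<rbrakk>
    \<Longrightarrow> \<exists>!l. l \<in> homs M T (Ker M f) \<and> ker_arr M f \<cdot> l = h"
  using ker_arr_kernel[of f] by (simp add: is_kernel_def homs_iff Ker_def)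

lemma coker_arr_factor:
  "\<lbrakk>f \<in> homs M a b; h \<in> homs M b T; h \<cdot> f = Zero M a T\<rbrakk>
    \<Longrightarrow> \<exists>!l. l \<in> homs M (Coker M f) T \<and> l \<cdot> coker_arr M f = h"
  using coker_arr_cokernel[of f] by (simp add: is_cokernel_def homs_iff Coker_def)

lemma ker_arr_cancel:
  assumes "f \<in> homs M a b" "h \<in> homs M T (Ker M f)" "k \<in> homs M T (Ker M f)"
    "ker_arr M f \<cdot> h = ker_arr M f \<cdot> k"
  shows "h = k"
proof -
  have "f \<cdot> (ker_arr M f \<cdot> k) = Zero M T b"
    using Comp_eq_left[OF Comp_ker_arr[OF assms(1)] assms(3) ker_arr_homs[OF assms(1)] assms(1)]
      Zero_Comp[OF assms(3)] homs_Obj[OF assms(1)] by simp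
  then show ?thesis
    using ker_arr_factor[OF assms(1) Comp_homs[OF assms(3) ker_arr_homs[OF assms(1)]]] assms by blast
qed

lemma coker_arr_cancel:
  assumes "f \<in> homs M a b" "h \<in> homs M (Coker M f) T" "k \<in> homs M (Coker M f) T"
    "h \<cdot> coker_arr M f = k \<cdot> coker_arr M f"
  shows "h = k"
proof -
  have "(k \<cdot> coker_arr M f) \<cdot> f = Zero M a T"
    using Comp_assoc[OF assms(1) coker_arr_homs[OF assms(1)] assms(3)] coker_arr_Comp[OF assms(1)]
      Comp_Zero[OF assms(3)] homs_Obj[OF assms(1)] by simp
  then show ?thesis
    using coker_arr_factor[OF assms(1) Comp_homs[OF coker_arr_homs[OF assms(1)] assms(3)]] assms by blast
qed

text \<open>The arrow \<open>v\<close> completes the square: it shows that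
  \<open>u \<cdot> ker_arr M f\<close> is annihilated by \<open>f'\<close>, so that the description
  in \<open>ker_map\<close> denotes an arrow. In the dual statement \<open>u\<close> has this
  role.\<close>

lemma ker_map:
  assumes f: "f \<in> homs M a b" and f': "f' \<in> homs M a' b'" and u: "u \<in> homs M a a'" and v: "v \<in> homs M b b'"
    and sq: "f' \<cdot> u = v \<cdot> f"
  shows "ker_map M f f' u \<in> homs M (Ker M f) (Ker M f')"
    and "ker_arr M f' \<cdot> ker_map M f f' u = u \<cdot> ker_arr M f"
proof -
  let ?k = "ker_arr M f"
  have k: "?k \<in> homs M (Ker M f) a" by (rule ker_arr_homs[OF f])
  have "f' \<cdot> (u \<cdot> ?k) = v \<cdot> (f \<cdot> ?k)"
    using Comp_eq_left[OF sq k u f'] Comp_assoc[OF k f v] by simp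
  also have "\<dots> = Zero M (Ker M f) b'"
    using Comp_ker_arr[OF f] Comp_Zero[OF v] homs_Obj[OF k] by simp
  finally show "ker_map M f f' u \<in> homs M (Ker M f) (Ker M f')"
    "ker_arr M f' \<cdot> ker_map M f f' u = u \<cdot> ker_arr M f"
    using theI'[OF ker_arr_factor[OF f' Comp_homs[OF k u]]] unfolding ker_map_def by auto
qed

lemma coker_map:
  assumes f: "f \<in> homs M a b" and f': "f' \<in> homs M a' b'" and u: "u \<in> homs M a a'" and v: "v \<in> homs M b b'"
    and sq: "f' \<cdot> u = v \<cdot> f"
  shows "coker_map M f f' v \<in> homs M (Coker M f) (Coker M f')"
    and "coker_map M f f' v \<cdot> coker_arr M f = coker_arr M f' \<cdot> v"
proof -
  let ?q = "coker_arr M f'"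
  have q: "?q \<in> homs M b' (Coker M f')" by (rule coker_arr_homs[OF f'])
  have "(?q \<cdot> v) \<cdot> f = (?q \<cdot> f') \<cdot> u"
    using Comp_assoc[OF f v q] Comp_assoc[OF u f' q] sq by simp
  also have "\<dots> = Zero M a (Coker M f')"
    using coker_arr_Comp[OF f'] Zero_Comp[OF u] homs_Obj[OF q] by simp
  finally show "coker_map M f f' v \<in> homs M (Coker M f) (Coker M f')"
    "coker_map M f f' v \<cdot> coker_arr M f = coker_arr M f' \<cdot> v"
    using theI'[OF coker_arr_factor[OF f Comp_homs[OF v q]]] unfolding coker_map_def by auto
qed

text \<open>Exactness at \<open>b\<close> asks that a kernel of the cokernel of \<open>f\<close> be
  a kernel of \<open>g\<close>, so it suffices that \<open>g\<close> and this cokernel annihilate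
  the same arrows. One direction holds because \<open>g\<close> factors through the cokernel; for
  the other, \<open>g \<cdot> h = 0\<close> reduces the equation \<open>sum\<close>, composed with
  \<open>h\<close>, to \<open>h = f \<cdot> (r \<cdot> h)\<close>.\<close>

lemma short_exact_if_split:
  assumes f: "f \<in> homs M a b" and g: "g \<in> homs M b c" and r: "r \<in> homs M b a" and s: "s \<in> homs M c b"
    and rf: "r \<cdot> f = Ident M a" and gs: "g \<cdot> s = Ident M c" and gf: "g \<cdot> f = Zero M a c"
    and sum: "f \<cdot> r \<oplus> s \<cdot> g = Ident M b"
  shows "short_exact M a f b g c"
proof -
  let ?q = "coker_arr M f" and ?k = "ker_arr M (coker_arr M f)"
  have q: "?q \<in> homs M b (Coker M f)" by (rule coker_arr_homs[OF f])
  have k: "?k \<in> homs M (Ker M ?q) b" by (rule ker_arr_homs[OF q])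
  have Obj: "a \<in> Obj M" "b \<in> Obj M" "c \<in> Obj M" using homs_Obj f g by blast+
  obtain l where l: "l \<in> homs M (Coker M f) c" "l \<cdot> ?q = g"
    using coker_arr_factor[OF f g gf] by blast
  have "g \<cdot> ?k = l \<cdot> (?q \<cdot> ?k)"
    using Comp_assoc[OF k q l(1)] l(2) by simp
  then have gk: "g \<cdot> ?k = Zero M (Ker M ?q) c"
    using Comp_ker_arr[OF q] Comp_Zero[OF l(1)] homs_Obj[OF k] by simp
  have "\<exists>!m. m \<in> homs M T (Ker M ?q) \<and> ?k \<cdot> m = h"
    if h: "h \<in> homs M T b" "g \<cdot> h = Zero M T c" for T h
  proof -
    have T: "T \<in> Obj M" using homs_Obj h by blast
    have "h = (f \<cdot> r \<oplus> s \<cdot> g) \<cdot> h" using sum Comp_Ident_left h by simp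
    also have "\<dots> = (f \<cdot> r) \<cdot> h \<oplus> (s \<cdot> g) \<cdot> h"
      by (rule Comp_Add_left[OF h(1) Comp_homs[OF r f] Comp_homs[OF g s]])
    also have "\<dots> = f \<cdot> (r \<cdot> h) \<oplus> s \<cdot> (g \<cdot> h)"
      using Comp_assoc[OF h(1) r f] Comp_assoc[OF h(1) g s] by simp
    also have "\<dots> = f \<cdot> (r \<cdot> h)"
      using h Comp_Zero[OF s T] Add_Zero_right Comp_homs[OF Comp_homs[OF h(1) r] f] by simp
    finally have "?q \<cdot> h = (?q \<cdot> f) \<cdot> (r \<cdot> h)"
      using Comp_assoc[OF Comp_homs[OF h(1) r] f q] by simp
    then have "?q \<cdot> h = Zero M T (Coker M f)"
      using coker_arr_Comp[OF f] Zero_Comp[OF Comp_homs[OF h(1) r]] homs_Obj[OF q] by simp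
    then show ?thesis using ker_arr_factor[OF q h(1)] by blast
  qed
  then have "is_kernel M g ?k"
    using k g gk by (simp add: is_kernel_def homs_iff[of "?k"] homs_iff[of g])
  then show ?thesis
    using f g split_mono[OF f r rf] split_epi[OF g s gs] by (simp add: short_exact_def exact_at_def)
qed

end

section \<open>Representing objects\<close>

locale complete_abelian_category = abelian_category M for M :: "('o, 'm, 'z) ab_cat_scheme" (structure) +
  assumes complete: "countably_complete M"
begin

text \<open>A power is the limit of a constant functor on a discrete category. The index set is
  numbered first, because \<open>countably_complete\<close> speaks of index categories on the
  natural numbers.\<close>

lemma ex_power:
  assumes I: "countable I" and X: "X \<in> Obj M"
  shows "\<exists>P p. is_power M I X P p"
proof -
  let ?n = "to_nat_on I"
  \<comment> \<open>Every number is its own identity arrow. Only the pairs (i, i) are composable, so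
    the first projection serves as composition.\<close>
  let ?J = "\<lparr>Obj = ?n ` I, Arr = ?n ` I, Src = \<lambda>i. i, Tgt = \<lambda>i. i, Ident = \<lambda>i. i, Comp = \<lambda>i j. i\<rparr> :: (nat, nat) cat"
  let ?Fo = "\<lambda>_ :: nat. X" and ?Fa = "\<lambda>_ :: nat. Ident M X"
  have IdX: "Ident M X \<in> homs M X X" by (rule Ident_homs[OF X])
  have "category ?J"
    by unfold_locales (auto simp: homs_def)
  moreover have "is_functor ?J M ?Fo ?Fa"
    using X IdX Comp_Ident_left[OF IdX] by (simp add: is_functor_def)
  ultimately obtain P p where lim: "is_limit ?J M ?Fo ?Fa P p"
    using complete unfolding countably_complete_def by blast
  have cone: "is_cone ?J M ?Fo ?Fa T t \<longleftrightarrow> T \<in> Obj M \<and> (\<forall>i\<in>I. t (?n i) \<in> homs M T X)" for T t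
    using Comp_Ident_left by (auto simp: is_cone_def)
  have from_nat: "from_nat_into I (?n i) = i" if "i \<in> I" for i using I that by simp
  have "is_power M I X P (\<lambda>i. p (?n i))"
    unfolding is_power_def
  proof (intro conjI ballI allI impI)
    have "is_cone ?J M ?Fo ?Fa P p" using lim by (simp add: is_limit_def)
    then show "P \<in> Obj M" "i \<in> I \<Longrightarrow> p (?n i) \<in> homs M P X" for i
      using cone by blast+
  next
    fix T t assume T: "T \<in> Obj M" and t: "\<forall>i\<in>I. t i \<in> homs M T X"
    have "is_cone ?J M ?Fo ?Fa T (\<lambda>k. t (from_nat_into I k))"
      using T t from_nat by (simp add: cone)
    then have "\<exists>!h. h \<in> homs M T P \<and> (\<forall>k\<in>Obj ?J. p k \<cdot> h = t (from_nat_into I k))"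
      using lim unfolding is_limit_def by blast
    then show "\<exists>!h. h \<in> homs M T P \<and> (\<forall>i\<in>I. p (?n i) \<cdot> h = t i)"
      using from_nat by simp
  qed
  then show ?thesis by blast
qed

lemma is_power_free_Hom:
  assumes "countable_free_abelian F" "X \<in> Obj M"
  shows "is_power M (basis F) X (free_Hom M F X) (free_proj M F X)"
proof -
  have "\<exists>z. case z of (P, p) \<Rightarrow> is_power M (basis F) X P p"
    using ex_power[OF countable_basis[OF assms(1)] assms(2)] by auto
  from someI_ex[OF this] show ?thesis
    by (simp add: free_Hom_def free_proj_def chosen_power_def case_prod_unfold)
qed

text \<open>Evaluation at \<open>x\<close> on Hom(F, X). The body is the sum in
  \<open>free_Hom_arr\<close>, whose defining equation thereby reads
  \<open>free_proj M F X i \<cdot> h = ev G X (\<phi> i)\<close>.\<close>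

definition ev :: "('a, 'b) monoid_scheme \<Rightarrow> 'o \<Rightarrow> 'a \<Rightarrow> 'm"
  where "ev F X x = finprod (hom_group M (free_Hom M F X) X)
    (\<lambda>j. free_proj M F X j [^]\<^bsub>hom_group M (free_Hom M F X) X\<^esub> Poly_Mapping.lookup (coords F x) j)
    (Poly_Mapping.keys (coords F x))"

text \<open>A homomorphism from \<open>F\<close> and an arrow into the power are both given by a
  family of arrows to \<open>X\<close> indexed by the basis. Equations at basis elements extend to
  all of \<open>F\<close> because composition with \<open>h\<close> is additive. Once
  \<open>free_Hom_arr\<close> and \<open>free_Hom_push\<close> are described by \<open>ev\<close>,
  the chosen bases no longer appear.\<close>

lemma represents_free_Hom:
  assumes F: "countable_free_abelian F" and X: "X \<in> Obj M"
  shows "represents F X (free_Hom M F X) (ev F X)"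
    and "i \<in> basis F \<Longrightarrow> ev F X i = free_proj M F X i"
proof -
  let ?P = "free_Hom M F X" and ?p = "free_proj M F X"
  have pow: "is_power M (basis F) X ?P ?p" by (rule is_power_free_Hom[OF assms])
  then have P: "?P \<in> Obj M" and p: "?p \<in> basis F \<rightarrow> carrier (hom_group M ?P X)"
    by (auto simp: is_power_def)
  note ext = free_extension[OF F hom_comm_group[OF P X] p]
  have e: "ev F X \<in> hom F (hom_group M ?P X)" unfolding ev_def[abs_def] by (rule ext(1))
  show ev_basis: "ev F X i = ?p i" if "i \<in> basis F" for i
    unfolding ev_def by (rule ext(2)[OF that])
  have "\<exists>!h. h \<in> homs M T ?P \<and> (\<forall>x\<in>carrier F. ev F X x \<cdot> h = t x)"
    if T: "T \<in> Obj M" and t: "t \<in> hom F (hom_group M T X)" for T t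
  proof -
    have "\<forall>i\<in>basis F. t i \<in> homs M T X"
      using hom_in_carrier[OF t] basis_subset[OF F] by auto
    then have ex1: "\<exists>!h. h \<in> homs M T ?P \<and> (\<forall>i\<in>basis F. ?p i \<cdot> h = t i)"
      using pow T by (simp add: is_power_def)
    have "(\<forall>x\<in>carrier F. ev F X x \<cdot> h = t x) \<longleftrightarrow> (\<forall>i\<in>basis F. ?p i \<cdot> h = t i)"
      if h: "h \<in> homs M T ?P" for h
    proof
      assume "\<forall>x\<in>carrier F. ev F X x \<cdot> h = t x"
      then show "\<forall>i\<in>basis F. ?p i \<cdot> h = t i" using basis_subset[OF F] ev_basis by fastforce
    next
      assume *: "\<forall>i\<in>basis F. ?p i \<cdot> h = t i"
      show "\<forall>x\<in>carrier F. ev F X x \<cdot> h = t x"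
      proof
        fix x assume "x \<in> carrier F"
        then show "ev F X x \<cdot> h = t x"
          by (rule free_hom_eq[OF F group_hom_group[OF T X] hom_precomp[OF e h X] t, rotated])
             (simp add: * ev_basis)
      qed
    qed
    then have eq: "h \<in> homs M T ?P \<and> (\<forall>x\<in>carrier F. ev F X x \<cdot> h = t x)
        \<longleftrightarrow> h \<in> homs M T ?P \<and> (\<forall>i\<in>basis F. ?p i \<cdot> h = t i)" for h
      by blast
    show ?thesis unfolding eq by (rule ex1)
  qed
  then show "represents F X ?P (ev F X)"
    using P X e cfa_comm_group[OF F] by (auto simp: represents_def comm_group.axioms(2))
qed

lemmas ev_homs = represents_homs[OF represents_free_Hom(1)]

lemma free_Hom_Obj: "\<lbrakk>countable_free_abelian F; X \<in> Obj M\<rbrakk> \<Longrightarrow> free_Hom M F X \<in> Obj M"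
  using represents_free_Hom(1) by (auto simp: represents_def)

lemma free_Hom_arr:
  assumes F: "countable_free_abelian F" and G: "countable_free_abelian G"
    and \<phi>: "\<phi> \<in> hom F G" and X: "X \<in> Obj M"
  shows "free_Hom_arr M F G \<phi> X \<in> homs M (free_Hom M G X) (free_Hom M F X)"
    and "x \<in> carrier F \<Longrightarrow> ev F X x \<cdot> free_Hom_arr M F G \<phi> X = ev G X (\<phi> x)"
proof -
  let ?P = "free_Hom M G X" and ?a = "free_Hom_arr M F G \<phi> X"
  have RG: "represents G X ?P (ev G X)" by (rule represents_free_Hom(1)[OF G X])
  have RF: "represents F X (free_Hom M F X) (ev F X)" by (rule represents_free_Hom(1)[OF F X])
  have P: "?P \<in> Obj M" by (rule free_Hom_Obj[OF G X])
  have t: "(\<lambda>x. ev G X (\<phi> x)) \<in> hom F (hom_group M ?P X)"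
    using Group.hom_compose[OF \<phi>, of "ev G X" "hom_group M ?P X"] RG by (simp add: o_def represents_def)
  have "\<exists>!h. h \<in> homs M ?P (free_Hom M F X) \<and> (\<forall>i\<in>basis F. free_proj M F X i \<cdot> h = ev G X (\<phi> i))"
    using is_power_free_Hom[OF F X] P hom_in_carrier[OF t] basis_subset[OF F]
    by (auto simp: is_power_def subset_iff)
  then have a: "?a \<in> homs M ?P (free_Hom M F X) \<and> (\<forall>i\<in>basis F. free_proj M F X i \<cdot> ?a = ev G X (\<phi> i))"
    unfolding free_Hom_arr_def ev_def by (rule theI')
  then show "?a \<in> homs M ?P (free_Hom M F X)" by blast
  have e: "ev F X \<in> hom F (hom_group M (free_Hom M F X) X)" using RF by (simp add: represents_def)
  show "ev F X x \<cdot> ?a = ev G X (\<phi> x)" if "x \<in> carrier F"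
    by (rule free_hom_eq[OF F group_hom_group[OF P X] hom_precomp[OF e _ X] t _ that])
       (use a in \<open>auto simp: represents_free_Hom(2)[OF F X]\<close>)
qed

lemma free_Hom_push:
  assumes F: "countable_free_abelian F" and u: "u \<in> homs M X Y"
  shows "free_Hom_push M F X Y u \<in> homs M (free_Hom M F X) (free_Hom M F Y)"
    and "x \<in> carrier F \<Longrightarrow> ev F Y x \<cdot> free_Hom_push M F X Y u = u \<cdot> ev F X x"
proof -
  let ?a = "free_Hom_push M F X Y u" and ?P = "free_Hom M F X"
  have X: "X \<in> Obj M" and Y: "Y \<in> Obj M" using homs_Obj[OF u] by auto
  have RX: "represents F X ?P (ev F X)" by (rule represents_free_Hom(1)[OF F X])
  have RY: "represents F Y (free_Hom M F Y) (ev F Y)" by (rule represents_free_Hom(1)[OF F Y])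
  have P: "?P \<in> Obj M" by (rule free_Hom_Obj[OF F X])
  have t: "(\<lambda>x. u \<cdot> ev F X x) \<in> hom F (hom_group M ?P Y)"
    using RX by (intro hom_postcomp[OF _ u P]) (simp add: represents_def)
  have "\<exists>!h. h \<in> homs M ?P (free_Hom M F Y) \<and> (\<forall>i\<in>basis F. free_proj M F Y i \<cdot> h = u \<cdot> free_proj M F X i)"
    using is_power_free_Hom[OF F Y] is_power_free_Hom[OF F X] P Comp_homs[OF _ u]
    by (auto simp: is_power_def)
  then have a: "?a \<in> homs M ?P (free_Hom M F Y) \<and> (\<forall>i\<in>basis F. free_proj M F Y i \<cdot> ?a = u \<cdot> free_proj M F X i)"
    unfolding free_Hom_push_def by (rule theI')
  then show "?a \<in> homs M ?P (free_Hom M F Y)" by blast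
  have e: "ev F Y \<in> hom F (hom_group M (free_Hom M F Y) Y)" using RY by (simp add: represents_def)
  show "ev F Y x \<cdot> ?a = u \<cdot> ev F X x" if "x \<in> carrier F"
    by (rule free_hom_eq[OF F group_hom_group[OF P Y] hom_precomp[OF e _ Y] t _ that])
       (use a in \<open>auto simp: represents_free_Hom(2)[OF F X] represents_free_Hom(2)[OF F Y]\<close>)
qed

text \<open>Since \<open>f\<close> acts as precomposition with \<phi>, its kernel represents the
  homomorphisms that vanish on the image of \<phi>. There are two instances: for \<phi> the
  inclusion of the relations the kernel is \<open>Hom M C X\<close>, and for \<phi> a differential
  it is the object of cycles.\<close>

lemma Ker_arr_ex:
  assumes F: "represents F X P e" and R: "represents R X Q e'"
    and f: "f \<in> homs M P Q" and ef: "\<And>x. x \<in> carrier R \<Longrightarrow> e' x \<cdot> f = e (\<phi> x)" and \<phi>: "\<phi> ` carrier R \<subseteq> carrier F"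
    and T: "T \<in> Obj M" and t: "t \<in> hom F (hom_group M T X)" and t\<phi>: "\<And>x. x \<in> carrier R \<Longrightarrow> t (\<phi> x) = Zero M T X"
  obtains h where "h \<in> homs M T (Ker M f)" "\<And>x. x \<in> carrier F \<Longrightarrow> e x \<cdot> ker_arr M f \<cdot> h = t x"
proof -
  obtain h where h: "h \<in> homs M T P" "\<And>x. x \<in> carrier F \<Longrightarrow> e x \<cdot> h = t x"
    using represents_arr[OF F T t] by blast
  have Q: "Q \<in> Obj M" using R by (simp add: represents_def)
  have "f \<cdot> h = Zero M T Q"
  proof (rule represents_eqI[OF R Comp_homs[OF h(1) f] Zero_homs[OF T Q]])
    fix x assume x: "x \<in> carrier R"
    have "e' x \<cdot> (f \<cdot> h) = e (\<phi> x) \<cdot> h"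
      by (rule Comp_eq_left[OF ef[OF x] h(1) f represents_homs[OF R x]])
    also have "\<dots> = Zero M T X" using x \<phi> h(2) t\<phi> by auto
    finally show "e' x \<cdot> (f \<cdot> h) = e' x \<cdot> Zero M T Q"
      using Comp_Zero[OF represents_homs[OF R x] T] by simp
  qed
  then obtain l where l: "l \<in> homs M T (Ker M f)" "ker_arr M f \<cdot> l = h"
    using ker_arr_factor[OF f h(1)] by blast
  then have "e x \<cdot> ker_arr M f \<cdot> l = t x" if "x \<in> carrier F" for x
    using Comp_assoc[OF l(1) ker_arr_homs[OF f] represents_homs[OF F that]] h(2)[OF that] by simp
  then show thesis using that l by blast
qed

lemma Ker_arr_eqI:
  assumes F: "represents F X P e" and f: "f \<in> homs M P Q"
    and h: "h \<in> homs M T (Ker M f)" and k: "k \<in> homs M T (Ker M f)"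
    and eq: "\<And>x. x \<in> carrier F \<Longrightarrow> e x \<cdot> ker_arr M f \<cdot> h = e x \<cdot> ker_arr M f \<cdot> k"
  shows "h = k"
proof (rule ker_arr_cancel[OF f h k], rule represents_eqI[OF F Comp_homs[OF h ker_arr_homs[OF f]] Comp_homs[OF k ker_arr_homs[OF f]]])
  fix x assume x: "x \<in> carrier F"
  then show "e x \<cdot> (ker_arr M f \<cdot> h) = e x \<cdot> (ker_arr M f \<cdot> k)"
    using Comp_assoc[OF h ker_arr_homs[OF f] represents_homs[OF F x]]
      Comp_assoc[OF k ker_arr_homs[OF f] represents_homs[OF F x]] eq[OF x] by simp
qed

section \<open>Hom and Ext of countable abelian groups\<close>

definition countable_abelian :: "('a, 'b) monoid_scheme \<Rightarrow> bool"
  where "countable_abelian C \<longleftrightarrow> comm_group C \<and> countable (carrier C)"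

text \<open>Evaluation at \<open>c\<close>, computed at the lift \<open>frag_of c\<close>; by
  \<open>ev_Gen_ker\<close> every other lift to the generators gives the same arrow.\<close>

definition hev :: "('a, 'b) monoid_scheme \<Rightarrow> 'o \<Rightarrow> 'a \<Rightarrow> 'm"
  where "hev C X c = ev (Gen C) X (frag_of c) \<cdot> ker_arr M (restr M C X)"

lemma cfa_Gen: "countable_abelian C \<Longrightarrow> countable_free_abelian (Gen C)"
  by (simp add: countable_abelian_def countable_free_abelian_Gen)

lemma cfa_Rel: "countable_abelian C \<Longrightarrow> countable_free_abelian (Rel C)"
  by (simp add: countable_abelian_def countable_free_abelian_Rel)

context
  fixes C :: "('a, 'b) monoid_scheme" and X :: 'o
  assumes C: "countable_abelian C" and X: "X \<in> Obj M"
begin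

lemma comm_group_C: "comm_group C"
  using C by (simp add: countable_abelian_def)

lemmas represents_Gen = represents_free_Hom(1)[OF cfa_Gen[OF C] X]
lemmas represents_Rel = represents_free_Hom(1)[OF cfa_Rel[OF C] X]

lemma Rel_incl_hom: "(\<lambda>x. x) \<in> hom (Rel C) (Gen C)"
  by (auto simp: hom_def carrier_Rel)

lemma Rel_subset_Gen: "(\<lambda>x. x) ` carrier (Rel C) \<subseteq> carrier (Gen C)"
  by (auto simp: carrier_Rel)

lemma restr_homs: "restr M C X \<in> homs M (free_Hom M (Gen C) X) (free_Hom M (Rel C) X)"
  unfolding restr_def by (rule free_Hom_arr(1)[OF cfa_Rel[OF C] cfa_Gen[OF C] Rel_incl_hom X])

lemma ev_restr: "g \<in> carrier (Rel C) \<Longrightarrow> ev (Rel C) X g \<cdot> restr M C X = ev (Gen C) X g"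
  unfolding restr_def by (rule free_Hom_arr(2)[OF cfa_Rel[OF C] cfa_Gen[OF C] Rel_incl_hom X])

lemma ker_restr_homs: "ker_arr M (restr M C X) \<in> homs M (Hom M C X) (free_Hom M (Gen C) X)"
  unfolding Hom_def by (rule ker_arr_homs[OF restr_homs])

lemma Hom_Obj: "Hom M C X \<in> Obj M"
  using ker_restr_homs homs_Obj by blast

text \<open>\<open>g\<close> and \<open>frag_of (lin_comb C g)\<close> have the same image in
  \<open>C\<close>, so they differ by a relation, and evaluation at a relation vanishes on the
  kernel of the restriction.\<close>

lemma ev_Gen_ker:
  assumes g: "g \<in> carrier (Gen C)"
  shows "ev (Gen C) X g \<cdot> ker_arr M (restr M C X) = hev C X (lin_comb C g)"
proof -
  let ?k = "ker_arr M (restr M C X)" and ?c = "lin_comb C g"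
  interpret C: comm_group C by (rule comm_group_C)
  have c: "?c \<in> carrier C" by (rule hom_in_carrier[OF lin_comb_Gen_hom[OF comm_group_C] g])
  have fc: "frag_of ?c \<in> carrier (Gen C)" by (rule frag_of_Gen[OF c])
  let ?d = "g - frag_of ?c"
  have gG: "group (Gen C)" by (rule comm_group.axioms(2)[OF comm_group_Gen])
  have inv: "inv\<^bsub>Gen C\<^esub> frag_of ?c = - frag_of ?c" using fc by (simp add: Gen_def)
  have mc: "- frag_of ?c \<in> carrier (Gen C)" using fc by (simp add: carrier_Gen)
  have "lin_comb C (- frag_of ?c) = inv\<^bsub>C\<^esub> ?c"
    using hom_apply_inv[OF gG C.group_axioms lin_comb_Gen_hom[OF comm_group_C] fc] inv c
    by (simp add: C.lin_comb_frag_of)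
  then have "lin_comb C ?d = \<one>\<^bsub>C\<^esub>"
    using hom_mult[OF lin_comb_Gen_hom[OF comm_group_C] g mc] c by simp
  moreover have "?d \<in> carrier (Gen C)"
    using monoid.m_closed[OF group.is_monoid[OF gG] g mc] by simp
  ultimately have d: "?d \<in> carrier (Rel C)" "?d \<in> carrier (Gen C)" by (auto simp: carrier_Rel)
  have eH: "ev (Gen C) X x \<in> homs M (free_Hom M (Gen C) X) X" if "x \<in> carrier (Gen C)" for x
    by (rule ev_homs[OF cfa_Gen[OF C] X that])
  have "ev (Gen C) X ?d \<cdot> ?k = ev (Rel C) X ?d \<cdot> (restr M C X \<cdot> ?k)"
    using Comp_eq_left[OF ev_restr[OF d(1)] ker_restr_homs restr_homs ev_homs[OF cfa_Rel[OF C] X d(1)]] by simp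
  also have "\<dots> = Zero M (Hom M C X) X"
    using Comp_ker_arr[OF restr_homs] Comp_Zero[OF ev_homs[OF cfa_Rel[OF C] X d(1)] Hom_Obj] by (simp add: Hom_def)
  finally have z: "ev (Gen C) X ?d \<cdot> ?k = Zero M (Hom M C X) X" .
  have "ev (Gen C) X g = ev (Gen C) X (frag_of ?c) \<oplus> ev (Gen C) X ?d"
    using represents_Add[OF represents_Gen fc d(2)] by simp
  then have "ev (Gen C) X g \<cdot> ?k = ev (Gen C) X (frag_of ?c) \<cdot> ?k \<oplus> ev (Gen C) X ?d \<cdot> ?k"
    using Comp_Add_left[OF ker_restr_homs eH[OF fc] eH[OF d(2)]] by simp
  then show ?thesis
    using z Add_Zero_right[OF Comp_homs[OF ker_restr_homs eH[OF fc]]] by (simp add: hev_def)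
qed

text \<open>Homomorphisms from \<open>C\<close> are those from \<open>Gen C\<close> that vanish on
  \<open>Rel C\<close>. Additivity of \<open>hev\<close> is the independence of the lift:
  \<open>frag_of c + frag_of d\<close> is another lift of the product of \<open>c\<close> and
  \<open>d\<close>.\<close>

lemma represents_Hom: "represents C X (Hom M C X) (hev C X)"
proof -
  interpret C: comm_group C by (rule comm_group_C)
  let ?k = "ker_arr M (restr M C X)"
  have eH: "ev (Gen C) X x \<in> homs M (free_Hom M (Gen C) X) X" if "x \<in> carrier (Gen C)" for x
    by (rule ev_homs[OF cfa_Gen[OF C] X that])
  have hev_homs: "hev C X c \<in> homs M (Hom M C X) X" if "c \<in> carrier C" for c
    unfolding hev_def by (rule Comp_homs[OF ker_restr_homs eH[OF frag_of_Gen[OF that]]])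
  have hev_hom: "hev C X \<in> hom C (hom_group M (Hom M C X) X)"
  proof (rule homI)
    fix c d assume cd: "c \<in> carrier C" "d \<in> carrier C"
    note f = frag_of_Gen[OF cd(1)] frag_of_Gen[OF cd(2)]
    have s: "frag_of c + frag_of d \<in> carrier (Gen C)"
      using monoid.m_closed[OF group.is_monoid[OF comm_group.axioms(2)[OF comm_group_Gen]] f] by simp
    have "lin_comb C (frag_of c + frag_of d) = c \<otimes>\<^bsub>C\<^esub> d"
      using hom_mult[OF lin_comb_Gen_hom[OF comm_group_C] f] cd by (simp add: C.lin_comb_frag_of)
    then have "hev C X (c \<otimes>\<^bsub>C\<^esub> d) = ev (Gen C) X (frag_of c + frag_of d) \<cdot> ?k"
      using ev_Gen_ker[OF s] by simp
    also have "\<dots> = hev C X c \<oplus> hev C X d"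
      using represents_Add[OF represents_Gen f] Comp_Add_left[OF ker_restr_homs eH[OF f(1)] eH[OF f(2)]]
      by (simp add: hev_def)
    finally show "hev C X (c \<otimes>\<^bsub>C\<^esub> d) = hev C X c \<otimes>\<^bsub>hom_group M (Hom M C X) X\<^esub> hev C X d" by simp
  qed (simp add: hev_homs)
  have "\<exists>!h. h \<in> homs M T (Hom M C X) \<and> (\<forall>c\<in>carrier C. hev C X c \<cdot> h = t c)"
    if T: "T \<in> Obj M" and t: "t \<in> hom C (hom_group M T X)" for T t
  proof -
    have tl: "(\<lambda>g. t (lin_comb C g)) \<in> hom (Gen C) (hom_group M T X)"
      using Group.hom_compose[OF lin_comb_Gen_hom[OF comm_group_C] t] by (simp add: o_def)
    have "t \<one>\<^bsub>C\<^esub> = Zero M T X"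
      using hom_one[OF t C.group_axioms group_hom_group[OF T X]] by simp
    then obtain h where h: "h \<in> homs M T (Hom M C X)"
      "\<And>g. g \<in> carrier (Gen C) \<Longrightarrow> ev (Gen C) X g \<cdot> ?k \<cdot> h = t (lin_comb C g)"
      using Ker_arr_ex[OF represents_Gen represents_Rel restr_homs ev_restr _ T tl]
      by (metis Hom_def Rel_subset_Gen carrier_Rel)
    have "hev C X c \<cdot> h = t c" if "c \<in> carrier C" for c
      using h(2)[OF frag_of_Gen[OF that]] that by (simp add: hev_def C.lin_comb_frag_of)
    moreover have "h' = h" if h': "h' \<in> homs M T (Hom M C X)" "\<forall>c\<in>carrier C. hev C X c \<cdot> h' = t c" for h'
    proof (rule Ker_arr_eqI[OF represents_Gen restr_homs])
      show "h' \<in> homs M T (Ker M (restr M C X))" "h \<in> homs M T (Ker M (restr M C X))"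
        using h' h by (simp_all add: Hom_def)
      fix g assume g: "g \<in> carrier (Gen C)"
      then show "ev (Gen C) X g \<cdot> ?k \<cdot> h' = ev (Gen C) X g \<cdot> ?k \<cdot> h"
        using h(2)[OF g] h'(2) hom_in_carrier[OF lin_comb_Gen_hom[OF comm_group_C] g] by (simp add: ev_Gen_ker)
    qed
    ultimately show ?thesis using h(1) by blast
  qed
  then show ?thesis
    using X Hom_Obj hev_hom C.group_axioms by (simp add: represents_def)
qed

lemmas hev_homs = represents_homs[OF represents_Hom]

lemma coker_restr_homs: "coker_arr M (restr M C X) \<in> homs M (free_Hom M (Rel C) X) (Ext M C X)"
  unfolding Ext_def by (rule coker_arr_homs[OF restr_homs])

lemma coker_restr_restr: "coker_arr M (restr M C X) \<cdot> restr M C X = Zero M (free_Hom M (Gen C) X) (Ext M C X)"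
  unfolding Ext_def by (rule coker_arr_Comp[OF restr_homs])

end

text \<open>One commuting square yields both functors, as its kernel map and its cokernel map. For
  \<open>Hom\<close> the result can be restated by evaluation; \<open>Ext\<close> is a quotient, so
  its arrow is described by what it does after the cokernel.\<close>

lemma Hom_arr:
  assumes C: "countable_abelian C" and D: "countable_abelian D" and f: "f \<in> hom C D" and X: "X \<in> Obj M"
  shows "Hom_arr M C D f X \<in> homs M (Hom M D X) (Hom M C X)"
    and "c \<in> carrier C \<Longrightarrow> hev C X c \<cdot> Hom_arr M C D f X = hev D X (f c)"
    and "Ext_arr M C D f X \<in> homs M (Ext M D X) (Ext M C X)"
    and "Ext_arr M C D f X \<cdot> coker_arr M (restr M D X)
      = coker_arr M (restr M C X) \<cdot> free_Hom_arr M (Rel C) (Rel D) (Gen_map f) X"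
proof -
  let ?G = "free_Hom_arr M (Gen C) (Gen D) (Gen_map f) X" and ?R = "free_Hom_arr M (Rel C) (Rel D) (Gen_map f) X"
  have cC: "comm_group C" and cD: "comm_group D" using C D by (auto simp: countable_abelian_def)
  have Gh: "Gen_map f \<in> hom (Gen C) (Gen D)" by (rule Gen_map_hom[OF hom_carrier[OF f]])
  have Rh: "Gen_map f \<in> hom (Rel C) (Rel D)" by (rule Gen_map_Rel_hom[OF cC cD f])
  note G = free_Hom_arr[OF cfa_Gen[OF C] cfa_Gen[OF D] Gh X]
  note R = free_Hom_arr[OF cfa_Rel[OF C] cfa_Rel[OF D] Rh X]
  note rC = restr_homs[OF C X] and rD = restr_homs[OF D X]
  have sq: "restr M C X \<cdot> ?G = ?R \<cdot> restr M D X"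
  proof (rule represents_eqI[OF represents_Rel[OF C X] Comp_homs[OF G(1) rC] Comp_homs[OF rD R(1)]])
    fix g assume g: "g \<in> carrier (Rel C)"
    then have gG: "g \<in> carrier (Gen C)" by (simp add: carrier_Rel)
    have gD: "Gen_map f g \<in> carrier (Rel D)" by (rule hom_in_carrier[OF Rh g])
    note e = ev_homs[OF cfa_Rel[OF C] X g]
    have "ev (Rel C) X g \<cdot> (restr M C X \<cdot> ?G) = ev (Gen D) X (Gen_map f g)"
      using Comp_eq_left[OF ev_restr[OF C X g] G(1) rC e] G(2)[OF gG] by simp
    moreover have "ev (Rel C) X g \<cdot> (?R \<cdot> restr M D X) = ev (Gen D) X (Gen_map f g)"
      using Comp_eq_left[OF R(2)[OF g] rD R(1) e] ev_restr[OF D X gD] by simp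
    ultimately show "ev (Rel C) X g \<cdot> (restr M C X \<cdot> ?G) = ev (Rel C) X g \<cdot> (?R \<cdot> restr M D X)" by simp
  qed
  note K = ker_map[OF rD rC G(1) R(1) sq]
  show H: "Hom_arr M C D f X \<in> homs M (Hom M D X) (Hom M C X)"
    using K(1) by (simp add: Hom_arr_def Hom_def)
  show "hev C X c \<cdot> Hom_arr M C D f X = hev D X (f c)" if c: "c \<in> carrier C"
  proof -
    note fc = frag_of_Gen[OF c] and eC = ev_homs[OF cfa_Gen[OF C] X frag_of_Gen[OF c]]
    have "hev C X c \<cdot> Hom_arr M C D f X = ev (Gen C) X (frag_of c) \<cdot> (?G \<cdot> ker_arr M (restr M D X))"
      using Comp_assoc[OF H ker_restr_homs[OF C X] eC] K(2) by (simp add: hev_def Hom_arr_def)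
    also have "\<dots> = ev (Gen D) X (Gen_map f (frag_of c)) \<cdot> ker_arr M (restr M D X)"
      by (rule Comp_eq_left[OF G(2)[OF fc] ker_restr_homs[OF D X] G(1) eC])
    finally show ?thesis by (simp add: hev_def Gen_map_def)
  qed
  note E = coker_map[OF rD rC G(1) R(1) sq]
  show "Ext_arr M C D f X \<in> homs M (Ext M D X) (Ext M C X)"
    and "Ext_arr M C D f X \<cdot> coker_arr M (restr M D X) = coker_arr M (restr M C X) \<cdot> ?R"
    using E by (simp_all add: Ext_arr_def Ext_def)
qed

lemma Hom_push:
  assumes C: "countable_abelian C" and u: "u \<in> homs M X Y"
  shows "Hom_push M C X Y u \<in> homs M (Hom M C X) (Hom M C Y)"
    and "c \<in> carrier C \<Longrightarrow> hev C Y c \<cdot> Hom_push M C X Y u = u \<cdot> hev C X c"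
    and "Ext_push M C X Y u \<in> homs M (Ext M C X) (Ext M C Y)"
    and "Ext_push M C X Y u \<cdot> coker_arr M (restr M C X)
      = coker_arr M (restr M C Y) \<cdot> free_Hom_push M (Rel C) X Y u"
proof -
  let ?G = "free_Hom_push M (Gen C) X Y u" and ?R = "free_Hom_push M (Rel C) X Y u"
  have X: "X \<in> Obj M" and Y: "Y \<in> Obj M" using homs_Obj[OF u] by auto
  note G = free_Hom_push[OF cfa_Gen[OF C] u]
  note R = free_Hom_push[OF cfa_Rel[OF C] u]
  note rX = restr_homs[OF C X] and rY = restr_homs[OF C Y]
  have sq: "restr M C Y \<cdot> ?G = ?R \<cdot> restr M C X"
  proof (rule represents_eqI[OF represents_Rel[OF C Y] Comp_homs[OF G(1) rY] Comp_homs[OF rX R(1)]])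
    fix g assume g: "g \<in> carrier (Rel C)"
    then have gG: "g \<in> carrier (Gen C)" by (simp add: carrier_Rel)
    note e = ev_homs[OF cfa_Rel[OF C] Y g] and e' = ev_homs[OF cfa_Rel[OF C] X g]
    have "ev (Rel C) Y g \<cdot> (restr M C Y \<cdot> ?G) = u \<cdot> ev (Gen C) X g"
      using Comp_eq_left[OF ev_restr[OF C Y g] G(1) rY e] G(2)[OF gG] by simp
    moreover have "ev (Rel C) Y g \<cdot> (?R \<cdot> restr M C X) = u \<cdot> ev (Gen C) X g"
      using Comp_eq_left[OF R(2)[OF g] rX R(1) e] Comp_assoc[OF rX e' u] ev_restr[OF C X g] by simp
    ultimately show "ev (Rel C) Y g \<cdot> (restr M C Y \<cdot> ?G) = ev (Rel C) Y g \<cdot> (?R \<cdot> restr M C X)" by simp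
  qed
  note K = ker_map[OF rX rY G(1) R(1) sq]
  show H: "Hom_push M C X Y u \<in> homs M (Hom M C X) (Hom M C Y)"
    using K(1) by (simp add: Hom_push_def Hom_def)
  show "hev C Y c \<cdot> Hom_push M C X Y u = u \<cdot> hev C X c" if c: "c \<in> carrier C"
  proof -
    note fc = frag_of_Gen[OF c]
    note eX = ev_homs[OF cfa_Gen[OF C] X fc] and eY = ev_homs[OF cfa_Gen[OF C] Y fc]
    have "hev C Y c \<cdot> Hom_push M C X Y u = ev (Gen C) Y (frag_of c) \<cdot> (?G \<cdot> ker_arr M (restr M C X))"
      using Comp_assoc[OF H ker_restr_homs[OF C Y] eY] K(2) by (simp add: hev_def Hom_push_def)
    also have "\<dots> = u \<cdot> hev C X c"
      using Comp_eq_left[OF G(2)[OF fc] ker_restr_homs[OF C X] G(1) eY]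
        Comp_assoc[OF ker_restr_homs[OF C X] eX u] by (simp add: hev_def)
    finally show ?thesis .
  qed
  note E = coker_map[OF rX rY G(1) R(1) sq]
  show "Ext_push M C X Y u \<in> homs M (Ext M C X) (Ext M C Y)"
    and "Ext_push M C X Y u \<cdot> coker_arr M (restr M C X) = coker_arr M (restr M C Y) \<cdot> ?R"
    using E by (simp_all add: Ext_push_def Ext_def)
qed

end

section \<open>Cycles and homology of the dual complex\<close>

text \<open>The choice need not be natural: two lifts differ on cocycles by a map into \<open>Rel\<close>, which changes the
  induced map from \<open>Hom(Rel, X)\<close> to the cycles by a map that vanishes in homology.\<close>

definition Gen_lift :: "'a cochain \<Rightarrow> int \<Rightarrow> 'a \<Rightarrow> ('a set \<Rightarrow>\<^sub>0 int)"
  where "Gen_lift A n = (SOME \<theta>. \<theta> \<in> hom (Grp A n) (Gen (cohomology A n)) \<and>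
    (\<forall>z\<in>cocycles A n. lin_comb (cohomology A n) (\<theta> z) = coh_class A n z))"

lemma Gen_lift:
  assumes "free_complex A"
  shows "Gen_lift A n \<in> hom (Grp A n) (Gen (cohomology A n))"
    and "z \<in> cocycles A n \<Longrightarrow> lin_comb (cohomology A n) (Gen_lift A n z) = coh_class A n z"
  using someI_ex[OF cocycle_lift_to_Gen[OF assms, of n]] unfolding Gen_lift_def by blast+

lemma Gen_lift_Diff_hom:
  assumes A: "free_complex A"
  shows "(\<lambda>x. Gen_lift A (n + 1) (Diff A n x)) \<in> hom (Grp A n) (Rel (cohomology A (n + 1)))"
proof (rule homI)
  fix x assume x: "x \<in> carrier (Grp A n)"
  then have b: "Diff A n x \<in> coboundaries A (n + 1)" by (simp add: coboundaries_Suc[OF A])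
  then have z: "Diff A n x \<in> cocycles A (n + 1)" using coboundaries_subset_cocycles[OF A] by blast
  then have "lin_comb (cohomology A (n + 1)) (Gen_lift A (n + 1) (Diff A n x)) = \<one>\<^bsub>cohomology A (n + 1)\<^esub>"
    using Gen_lift(2)[OF A z] coh_class_eq_one_iff[OF A z] b by simp
  then show "Gen_lift A (n + 1) (Diff A n x) \<in> carrier (Rel (cohomology A (n + 1)))"
    using hom_in_carrier[OF Gen_lift(1)[OF A] Diff_closed[OF A x]] by (simp add: carrier_Rel)
next
  fix x y assume "x \<in> carrier (Grp A n)" "y \<in> carrier (Grp A n)"
  then show "Gen_lift A (n + 1) (Diff A n (x \<otimes>\<^bsub>Grp A n\<^esub> y))
      = Gen_lift A (n + 1) (Diff A n x) \<otimes>\<^bsub>Rel (cohomology A (n + 1))\<^esub> Gen_lift A (n + 1) (Diff A n y)"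
    using hom_mult[OF Gen_lift(1)[OF A]] Diff_closed[OF A] hom_mult[OF Diff_hom[OF A]] by simp
qed

context complete_abelian_category
begin

lemma countable_abelian_cohomology: "free_complex A \<Longrightarrow> countable_abelian (cohomology A n)"
  by (simp add: countable_abelian_def comm_group_cohomology countable_cohomology)

abbreviation cycles :: "'a cochain \<Rightarrow> 'o \<Rightarrow> int \<Rightarrow> 'o"
  where "cycles A X n \<equiv> Ker M (Hom_diff M A X n)"

text \<open>Evaluation at \<open>x\<close> of the universal homomorphism on \<open>Grp A n\<close>
  that kills the coboundaries.\<close>

definition cev :: "'a cochain \<Rightarrow> 'o \<Rightarrow> int \<Rightarrow> 'a \<Rightarrow> 'm"
  where "cev A X n x = ev (Grp A n) X x \<cdot> ker_arr M (Hom_diff M A X n)"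

abbreviation bd :: "'a cochain \<Rightarrow> 'o \<Rightarrow> int \<Rightarrow> 'm"
  where "bd A X n \<equiv> boundary M (Hom_diff M A X) n"

abbreviation hq :: "'a cochain \<Rightarrow> 'o \<Rightarrow> int \<Rightarrow> 'm"
  where "hq A X n \<equiv> coker_arr M (bd A X n)"

context
  fixes A :: "'a cochain" and X :: 'o
  assumes A: "free_complex A" and X: "X \<in> Obj M"
begin

lemmas represents_Grp = represents_free_Hom(1)[OF countable_free_abelian_Grp[OF A] X]
lemmas ev_Grp_homs = ev_homs[OF countable_free_abelian_Grp[OF A] X]

lemma Hom_diff_homs: "Hom_diff M A X n \<in> homs M (free_Hom M (Grp A n) X) (free_Hom M (Grp A (n - 1)) X)"
  and ev_Hom_diff: "x \<in> carrier (Grp A (n - 1)) \<Longrightarrow>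
    ev (Grp A (n - 1)) X x \<cdot> Hom_diff M A X n = ev (Grp A n) X (Diff A (n - 1) x)"
proof -
  have D: "Diff A (n - 1) \<in> hom (Grp A (n - 1)) (Grp A n)" using Diff_hom[OF A, of "n - 1"] by simp
  note * = free_Hom_arr[OF countable_free_abelian_Grp[OF A] countable_free_abelian_Grp[OF A] D X]
  show "Hom_diff M A X n \<in> homs M (free_Hom M (Grp A n) X) (free_Hom M (Grp A (n - 1)) X)"
    "x \<in> carrier (Grp A (n - 1)) \<Longrightarrow>
      ev (Grp A (n - 1)) X x \<cdot> Hom_diff M A X n = ev (Grp A n) X (Diff A (n - 1) x)"
    unfolding Hom_diff_def using * by blast+
qed

text \<open>The preceding facts in degree \<open>n + 1\<close>, normalized so that the index
  \<open>n + 1 - 1\<close> does not occur.\<close>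

lemma Hom_diff_Suc_homs: "Hom_diff M A X (n + 1) \<in> homs M (free_Hom M (Grp A (n + 1)) X) (free_Hom M (Grp A n) X)"
  and ev_Hom_diff_Suc: "x \<in> carrier (Grp A n) \<Longrightarrow>
    ev (Grp A n) X x \<cdot> Hom_diff M A X (n + 1) = ev (Grp A (n + 1)) X (Diff A n x)"
  using Hom_diff_homs[of "n + 1"] ev_Hom_diff[of x "n + 1"] by simp_all

lemma Hom_diff_Hom_diff:
  "Hom_diff M A X n \<cdot> Hom_diff M A X (n + 1) = Zero M (free_Hom M (Grp A (n + 1)) X) (free_Hom M (Grp A (n - 1)) X)"
proof (rule represents_eqI[OF represents_Grp Comp_homs[OF Hom_diff_Suc_homs Hom_diff_homs]])
  have P: "free_Hom M (Grp A k) X \<in> Obj M" for k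
    by (rule free_Hom_Obj[OF countable_free_abelian_Grp[OF A] X])
  show "Zero M (free_Hom M (Grp A (n + 1)) X) (free_Hom M (Grp A (n - 1)) X)
    \<in> homs M (free_Hom M (Grp A (n + 1)) X) (free_Hom M (Grp A (n - 1)) X)"
    by (rule Zero_homs[OF P P])
  fix x assume x: "x \<in> carrier (Grp A (n - 1))"
  have Dx: "Diff A (n - 1) x \<in> carrier (Grp A n)" using Diff_closed[OF A x] by simp
  have "ev (Grp A (n - 1)) X x \<cdot> (Hom_diff M A X n \<cdot> Hom_diff M A X (n + 1))
      = ev (Grp A n) X (Diff A (n - 1) x) \<cdot> Hom_diff M A X (n + 1)"
    by (rule Comp_eq_left[OF ev_Hom_diff[OF x] Hom_diff_Suc_homs Hom_diff_homs ev_Grp_homs[OF x]])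
  also have "\<dots> = ev (Grp A (n + 1)) X (Diff A n (Diff A (n - 1) x))" by (rule ev_Hom_diff_Suc[OF Dx])
  also have "\<dots> = Zero M (free_Hom M (Grp A (n + 1)) X) X"
    using Diff_Diff[OF A x] represents_one[OF represents_Grp] by simp
  finally show "ev (Grp A (n - 1)) X x \<cdot> (Hom_diff M A X n \<cdot> Hom_diff M A X (n + 1))
      = ev (Grp A (n - 1)) X x \<cdot> Zero M (free_Hom M (Grp A (n + 1)) X) (free_Hom M (Grp A (n - 1)) X)"
    using Comp_Zero[OF ev_Grp_homs[OF x] P] by simp
qed

lemma bd_homs: "bd A X n \<in> homs M (free_Hom M (Grp A (n + 1)) X) (cycles A X n)"
  and ker_bd: "ker_arr M (Hom_diff M A X n) \<cdot> bd A X n = Hom_diff M A X (n + 1)"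
proof -
  have S: "Src M (Hom_diff M A X (n + 1)) = free_Hom M (Grp A (n + 1)) X"
    using Hom_diff_Suc_homs by (simp add: homs_def)
  show "bd A X n \<in> homs M (free_Hom M (Grp A (n + 1)) X) (cycles A X n)"
    "ker_arr M (Hom_diff M A X n) \<cdot> bd A X n = Hom_diff M A X (n + 1)"
    using theI'[OF ker_arr_factor[OF Hom_diff_homs Hom_diff_Suc_homs Hom_diff_Hom_diff]]
    unfolding boundary_def S by auto
qed

lemma cev_homs: "x \<in> carrier (Grp A n) \<Longrightarrow> cev A X n x \<in> homs M (cycles A X n) X"
  unfolding cev_def by (rule Comp_homs[OF ker_arr_homs[OF Hom_diff_homs] ev_Grp_homs])

lemma cycles_Obj: "cycles A X n \<in> Obj M"
  using homs_Obj[OF bd_homs] by blast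

lemma cev_hom: "cev A X n \<in> hom (Grp A n) (hom_group M (cycles A X n) X)"
  unfolding cev_def[abs_def] using represents_Grp
  by (intro hom_precomp[OF _ ker_arr_homs[OF Hom_diff_homs] X]) (simp add: represents_def)

lemma cev_Add: "\<lbrakk>x \<in> carrier (Grp A n); y \<in> carrier (Grp A n)\<rbrakk> \<Longrightarrow>
    cev A X n (x \<otimes>\<^bsub>Grp A n\<^esub> y) = cev A X n x \<oplus> cev A X n y"
  using hom_mult[OF cev_hom] by simp

text \<open>The dual differential is precomposition with \<open>Diff\<close>. Hence boundaries
  vanish on cocycles, and conversely \<open>hq_eqI\<close> recognizes a boundary by this
  formula.\<close>

lemma cev_bd: "x \<in> carrier (Grp A n) \<Longrightarrow> cev A X n x \<cdot> bd A X n = ev (Grp A (n + 1)) X (Diff A n x)"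
  unfolding cev_def
  using Comp_assoc[OF bd_homs ker_arr_homs[OF Hom_diff_homs] ev_Grp_homs] by (simp add: ker_bd ev_Hom_diff_Suc)

lemma cev_coboundary:
  assumes "y \<in> coboundaries A n"
  shows "cev A X n y = Zero M (cycles A X n) X"
proof -
  obtain x where x: "x \<in> carrier (Grp A (n - 1))" "y = Diff A (n - 1) x"
    using assms by (auto simp: coboundaries_def)
  have "cev A X n y = (ev (Grp A (n - 1)) X x \<cdot> Hom_diff M A X n) \<cdot> ker_arr M (Hom_diff M A X n)"
    using ev_Hom_diff[OF x(1)] x(2) by (simp add: cev_def)
  also have "\<dots> = ev (Grp A (n - 1)) X x \<cdot> (Hom_diff M A X n \<cdot> ker_arr M (Hom_diff M A X n))"
    by (rule Comp_assoc[OF ker_arr_homs[OF Hom_diff_homs] Hom_diff_homs ev_Grp_homs[OF x(1)]])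
  finally show ?thesis
    using Comp_ker_arr[OF Hom_diff_homs] Comp_Zero[OF ev_Grp_homs[OF x(1)] cycles_Obj] by simp
qed

lemma cev_arr:
  assumes T: "T \<in> Obj M" and t: "t \<in> hom (Grp A n) (hom_group M T X)"
    and tb: "\<And>y. y \<in> coboundaries A n \<Longrightarrow> t y = Zero M T X"
  obtains h where "h \<in> homs M T (cycles A X n)" "\<And>x. x \<in> carrier (Grp A n) \<Longrightarrow> cev A X n x \<cdot> h = t x"
  unfolding cev_def
proof (rule Ker_arr_ex[OF represents_Grp represents_Grp Hom_diff_homs ev_Hom_diff _ T t])
  show "Diff A (n - 1) ` carrier (Grp A (n - 1)) \<subseteq> carrier (Grp A n)"
    using Diff_closed[OF A, of _ "n - 1"] by auto
  show "t (Diff A (n - 1) x) = Zero M T X" if "x \<in> carrier (Grp A (n - 1))" for x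
    using tb that by (simp add: coboundaries_def)
qed (use that in \<open>auto simp: cev_def\<close>)

lemma cev_eqI:
  assumes "h \<in> homs M T (cycles A X n)" "k \<in> homs M T (cycles A X n)"
    "\<And>x. x \<in> carrier (Grp A n) \<Longrightarrow> cev A X n x \<cdot> h = cev A X n x \<cdot> k"
  shows "h = k"
  using Ker_arr_eqI[OF represents_Grp Hom_diff_homs assms(1,2)] assms(3) by (simp add: cev_def)

lemma hq_homs: "hq A X n \<in> homs M (cycles A X n) (Hom_homology M A X n)"
  unfolding Hom_homology_def homology_def by (rule coker_arr_homs[OF bd_homs])

lemma hq_bd: "hq A X n \<cdot> bd A X n = Zero M (free_Hom M (Grp A (n + 1)) X) (Hom_homology M A X n)"
  unfolding Hom_homology_def homology_def by (rule coker_arr_Comp[OF bd_homs])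

lemma hq_factor:
  assumes "h \<in> homs M (cycles A X n) T" "h \<cdot> bd A X n = Zero M (free_Hom M (Grp A (n + 1)) X) T"
  obtains l where "l \<in> homs M (Hom_homology M A X n) T" "l \<cdot> hq A X n = h"
  using coker_arr_factor[OF bd_homs assms] unfolding Hom_homology_def homology_def by blast

lemma hq_cancel:
  "\<lbrakk>h \<in> homs M (Hom_homology M A X n) T; k \<in> homs M (Hom_homology M A X n) T; h \<cdot> hq A X n = k \<cdot> hq A X n\<rbrakk> \<Longrightarrow> h = k"
  unfolding Hom_homology_def homology_def by (rule coker_arr_cancel[OF bd_homs])

text \<open>Here \<open>v\<close> plays the role of a chain homotopy.\<close>

lemma hq_eqI:
  assumes h: "h \<in> homs M T (cycles A X n)" and k: "k \<in> homs M T (cycles A X n)"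
    and v: "v \<in> homs M T (free_Hom M (Grp A (n + 1)) X)"
    and eq: "\<And>x. x \<in> carrier (Grp A n) \<Longrightarrow>
      cev A X n x \<cdot> h = cev A X n x \<cdot> k \<oplus> ev (Grp A (n + 1)) X (Diff A n x) \<cdot> v"
  shows "hq A X n \<cdot> h = hq A X n \<cdot> k"
proof -
  let ?b = "bd A X n" and ?q = "hq A X n"
  have bv: "?b \<cdot> v \<in> homs M T (cycles A X n)" by (rule Comp_homs[OF v bd_homs])
  have "h = k \<oplus> ?b \<cdot> v"
  proof (rule cev_eqI[OF h Add_homs[OF k bv]])
    fix x assume x: "x \<in> carrier (Grp A n)"
    show "cev A X n x \<cdot> h = cev A X n x \<cdot> (k \<oplus> ?b \<cdot> v)"
      using eq[OF x] Comp_Add_right[OF k bv cev_homs[OF x]]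
        Comp_eq_left[OF cev_bd[OF x] v bd_homs cev_homs[OF x]] by simp
  qed
  then have "?q \<cdot> h = ?q \<cdot> k \<oplus> ?q \<cdot> (?b \<cdot> v)"
    using Comp_Add_right[OF k bv hq_homs] by simp
  also have "?q \<cdot> (?b \<cdot> v) = Zero M T (Hom_homology M A X n)"
    using Comp_eq_left[OF hq_bd v bd_homs hq_homs] Zero_Comp[OF v] homs_Obj[OF hq_homs] by simp
  finally show ?thesis
    using Add_Zero_right[OF Comp_homs[OF k hq_homs]] by simp
qed

end

text \<open>The arrow on homology is defined through \<open>ker_map\<close> and
  \<open>coker_map\<close>. What is left after eliminating both is an arrow \<open>k\<close> on
  cycles that acts as precomposition with \<open>f\<close>; the naturality proofs use only the four
  facts listed here.\<close>

lemma Hom_homology_arr: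
  assumes A: "free_complex A" and B: "free_complex B" and f: "chain_map A B f" and X: "X \<in> Obj M"
  obtains k where "k \<in> homs M (cycles B X n) (cycles A X n)"
    "\<And>x. x \<in> carrier (Grp A n) \<Longrightarrow> cev A X n x \<cdot> k = cev B X n (f n x)"
    "Hom_homology_arr M A B f X n \<in> homs M (Hom_homology M B X n) (Hom_homology M A X n)"
    "Hom_homology_arr M A B f X n \<cdot> hq B X n = hq A X n \<cdot> k"
proof -
  define g where "g k = free_Hom_arr M (Grp A k) (Grp B k) (f k) X" for k
  have g: "g k \<in> homs M (free_Hom M (Grp B k) X) (free_Hom M (Grp A k) X)"
    and evg: "x \<in> carrier (Grp A k) \<Longrightarrow> ev (Grp A k) X x \<cdot> g k = ev (Grp B k) X (f k x)" for k x
    using free_Hom_arr[OF countable_free_abelian_Grp[OF A] countable_free_abelian_Grp[OF B] chain_map_hom[OF f] X]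
    unfolding g_def by blast+
  have fc: "f k x \<in> carrier (Grp B k)" if "x \<in> carrier (Grp A k)" for k x
    using hom_in_carrier[OF chain_map_hom[OF f] that] .
  note dA = Hom_diff_homs[OF A X] and dB = Hom_diff_homs[OF B X]
  have sq: "Hom_diff M A X k \<cdot> g k = g (k - 1) \<cdot> Hom_diff M B X k" for k
  proof (rule represents_eqI[OF represents_Grp[OF A X] Comp_homs[OF g dA] Comp_homs[OF dB g]])
    fix x assume x: "x \<in> carrier (Grp A (k - 1))"
    note e = ev_Grp_homs[OF A X x]
    have Dx: "Diff A (k - 1) x \<in> carrier (Grp A k)" using Diff_closed[OF A x] by simp
    have "ev (Grp A (k - 1)) X x \<cdot> (Hom_diff M A X k \<cdot> g k) = ev (Grp B k) X (f k (Diff A (k - 1) x))"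
      using Comp_eq_left[OF ev_Hom_diff[OF A X x] g dA e] evg[OF Dx] by simp
    also have "\<dots> = ev (Grp B k) X (Diff B (k - 1) (f (k - 1) x))"
      using chain_map_Diff[OF f x] by simp
    also have "\<dots> = ev (Grp A (k - 1)) X x \<cdot> (g (k - 1) \<cdot> Hom_diff M B X k)"
      using Comp_eq_left[OF evg[OF x] dB g e] ev_Hom_diff[OF B X fc[OF x]] by simp
    finally show "ev (Grp A (k - 1)) X x \<cdot> (Hom_diff M A X k \<cdot> g k)
      = ev (Grp A (k - 1)) X x \<cdot> (g (k - 1) \<cdot> Hom_diff M B X k)" .
  qed
  define k where "k = ker_map M (Hom_diff M B X n) (Hom_diff M A X n) (g n)"
  have k: "k \<in> homs M (cycles B X n) (cycles A X n)"
    and kk: "ker_arr M (Hom_diff M A X n) \<cdot> k = g n \<cdot> ker_arr M (Hom_diff M B X n)"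
    unfolding k_def by (rule ker_map[OF dB dA g g sq])+
  have ck: "cev A X n x \<cdot> k = cev B X n (f n x)" if x: "x \<in> carrier (Grp A n)" for x
    using Comp_assoc[OF k ker_arr_homs[OF dA] ev_Grp_homs[OF A X x]]
      Comp_eq_left[OF evg[OF x] ker_arr_homs[OF dB] g ev_Grp_homs[OF A X x]] kk by (simp add: cev_def)
  have sq': "bd A X n \<cdot> g (n + 1) = k \<cdot> bd B X n"
  proof (rule cev_eqI[OF A X Comp_homs[OF g bd_homs[OF A X]] Comp_homs[OF bd_homs[OF B X] k]])
    fix x assume x: "x \<in> carrier (Grp A n)"
    note e = cev_homs[OF A X x]
    have "cev A X n x \<cdot> (bd A X n \<cdot> g (n + 1)) = ev (Grp B (n + 1)) X (f (n + 1) (Diff A n x))"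
      using Comp_eq_left[OF cev_bd[OF A X x] g bd_homs[OF A X] e] evg[OF Diff_closed[OF A x]] by simp
    also have "\<dots> = cev A X n x \<cdot> (k \<cdot> bd B X n)"
      using Comp_eq_left[OF ck[OF x] bd_homs[OF B X] k e] cev_bd[OF B X fc[OF x]] chain_map_Diff[OF f x] by simp
    finally show "cev A X n x \<cdot> (bd A X n \<cdot> g (n + 1)) = cev A X n x \<cdot> (k \<cdot> bd B X n)" .
  qed
  note c = coker_map[OF bd_homs[OF B X] bd_homs[OF A X] g k sq']
  have "Hom_homology_arr M A B f X n = coker_map M (bd B X n) (bd A X n) k"
    by (simp add: Hom_homology_arr_def homology_map_def k_def g_def)
  then show thesis
    using that[OF k ck] c by (simp add: Hom_homology_def homology_def)
qed

lemma Hom_homology_push: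
  assumes A: "free_complex A" and u: "u \<in> homs M X Y"
  obtains k where "k \<in> homs M (cycles A X n) (cycles A Y n)"
    "\<And>x. x \<in> carrier (Grp A n) \<Longrightarrow> cev A Y n x \<cdot> k = u \<cdot> cev A X n x"
    "Hom_homology_push M A X Y u n \<in> homs M (Hom_homology M A X n) (Hom_homology M A Y n)"
    "Hom_homology_push M A X Y u n \<cdot> hq A X n = hq A Y n \<cdot> k"
proof -
  have X: "X \<in> Obj M" and Y: "Y \<in> Obj M" using homs_Obj[OF u] by auto
  define g where "g k = free_Hom_push M (Grp A k) X Y u" for k
  have g: "g k \<in> homs M (free_Hom M (Grp A k) X) (free_Hom M (Grp A k) Y)"
    and evg: "x \<in> carrier (Grp A k) \<Longrightarrow> ev (Grp A k) Y x \<cdot> g k = u \<cdot> ev (Grp A k) X x" for k x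
    using free_Hom_push[OF countable_free_abelian_Grp[OF A] u] unfolding g_def by blast+
  note dX = Hom_diff_homs[OF A X] and dY = Hom_diff_homs[OF A Y]
  have sq: "Hom_diff M A Y k \<cdot> g k = g (k - 1) \<cdot> Hom_diff M A X k" for k
  proof (rule represents_eqI[OF represents_Grp[OF A Y] Comp_homs[OF g dY] Comp_homs[OF dX g]])
    fix x assume x: "x \<in> carrier (Grp A (k - 1))"
    note e = ev_Grp_homs[OF A Y x] and e' = ev_Grp_homs[OF A X x]
    have Dx: "Diff A (k - 1) x \<in> carrier (Grp A k)" using Diff_closed[OF A x] by simp
    have "ev (Grp A (k - 1)) Y x \<cdot> (Hom_diff M A Y k \<cdot> g k) = u \<cdot> ev (Grp A k) X (Diff A (k - 1) x)"
      using Comp_eq_left[OF ev_Hom_diff[OF A Y x] g dY e] evg[OF Dx] by simp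
    also have "\<dots> = ev (Grp A (k - 1)) Y x \<cdot> (g (k - 1) \<cdot> Hom_diff M A X k)"
      using Comp_eq_left[OF evg[OF x] dX g e] Comp_assoc[OF dX e' u] ev_Hom_diff[OF A X x] by simp
    finally show "ev (Grp A (k - 1)) Y x \<cdot> (Hom_diff M A Y k \<cdot> g k)
      = ev (Grp A (k - 1)) Y x \<cdot> (g (k - 1) \<cdot> Hom_diff M A X k)" .
  qed
  define k where "k = ker_map M (Hom_diff M A X n) (Hom_diff M A Y n) (g n)"
  have k: "k \<in> homs M (cycles A X n) (cycles A Y n)"
    and kk: "ker_arr M (Hom_diff M A Y n) \<cdot> k = g n \<cdot> ker_arr M (Hom_diff M A X n)"
    unfolding k_def by (rule ker_map[OF dX dY g g sq])+
  have ck: "cev A Y n x \<cdot> k = u \<cdot> cev A X n x" if x: "x \<in> carrier (Grp A n)" for x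
    using Comp_assoc[OF k ker_arr_homs[OF dY] ev_Grp_homs[OF A Y x]]
      Comp_eq_left[OF evg[OF x] ker_arr_homs[OF dX] g ev_Grp_homs[OF A Y x]]
      Comp_assoc[OF ker_arr_homs[OF dX] ev_Grp_homs[OF A X x] u] kk by (simp add: cev_def)
  have sq': "bd A Y n \<cdot> g (n + 1) = k \<cdot> bd A X n"
  proof (rule cev_eqI[OF A Y Comp_homs[OF g bd_homs[OF A Y]] Comp_homs[OF bd_homs[OF A X] k]])
    fix x assume x: "x \<in> carrier (Grp A n)"
    note e = cev_homs[OF A Y x]
    have "cev A Y n x \<cdot> (bd A Y n \<cdot> g (n + 1)) = u \<cdot> ev (Grp A (n + 1)) X (Diff A n x)"
      using Comp_eq_left[OF cev_bd[OF A Y x] g bd_homs[OF A Y] e] evg[OF Diff_closed[OF A x]] by simp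
    also have "\<dots> = cev A Y n x \<cdot> (k \<cdot> bd A X n)"
      using Comp_eq_left[OF ck[OF x] bd_homs[OF A X] k e] Comp_assoc[OF bd_homs[OF A X] cev_homs[OF A X x] u]
        cev_bd[OF A X x] by simp
    finally show "cev A Y n x \<cdot> (bd A Y n \<cdot> g (n + 1)) = cev A Y n x \<cdot> (k \<cdot> bd A X n)" .
  qed
  note c = coker_map[OF bd_homs[OF A X] bd_homs[OF A Y] g k sq']
  have "Hom_homology_push M A X Y u n = coker_map M (bd A X n) (bd A Y n) k"
    by (simp add: Hom_homology_push_def homology_map_def k_def g_def)
  then show thesis
    using that[OF k ck] c by (simp add: Hom_homology_def homology_def)
qed

end

section \<open>The exact sequence\<close>

context complete_abelian_category
begin

text \<open>\<pi> takes a cycle, seen as a homomorphism that kills coboundaries, to the homomorphism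
  it induces on classes of cocycles. The equations determine \<pi>: the evaluations
  \<open>hev\<close> at classes are jointly monic, and \<open>hq\<close> can be cancelled.\<close>

definition uct_pr :: "'a cochain \<Rightarrow> 'o \<Rightarrow> int \<Rightarrow> 'm \<Rightarrow> bool"
  where "uct_pr A X n \<pi> \<longleftrightarrow> \<pi> \<in> homs M (Hom_homology M A X n) (Hom M (cohomology A n) X) \<and>
    (\<forall>z\<in>cocycles A n. hev (cohomology A n) X (coh_class A n z) \<cdot> (\<pi> \<cdot> hq A X n) = cev A X n z)"

text \<open>The arrow \<open>j\<close> is \<iota> before passing to quotients, the dual of
  \<open>Gen_lift\<close> after \<open>Diff\<close>. It is determined by its evaluations, and it
  determines \<iota> because the cokernel onto Ext can be cancelled.\<close>

definition uct_in :: "'a cochain \<Rightarrow> 'o \<Rightarrow> int \<Rightarrow> 'm \<Rightarrow> bool"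
  where "uct_in A X n \<iota> \<longleftrightarrow> \<iota> \<in> homs M (Ext M (cohomology A (n + 1)) X) (Hom_homology M A X n) \<and>
    (\<exists>j \<in> homs M (free_Hom M (Rel (cohomology A (n + 1))) X) (cycles A X n).
      \<iota> \<cdot> coker_arr M (restr M (cohomology A (n + 1)) X) = hq A X n \<cdot> j \<and>
      (\<forall>x\<in>carrier (Grp A n). cev A X n x \<cdot> j
        = ev (Rel (cohomology A (n + 1))) X (Gen_lift A (n + 1) (Diff A n x))))"

text \<open>Each arrow is dual to a homomorphism of groups: \<open>p\<close> to the passage from
  classes to cocycles, \<open>s'\<close> to the class of \<open>r0\<close>, \<open>j\<close> to
  \<open>?\<theta>\<close> after \<open>?D\<close>, \<open>\<tau>\<close> to \<open>s\<close> after
  \<open>\<sigma>\<close>. The arrows \<open>m\<close>, \<open>m'\<close>, \<open>w\<close> and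
  \<open>v\<close> witness the homotopies that let these descend to homology and Ext and satisfy the
  biproduct equations there.\<close>

lemma uct_sequence:
  assumes A: "free_complex A" and X: "X \<in> Obj M"
  obtains \<iota> \<pi> where "uct_in A X n \<iota>" "uct_pr A X n \<pi>"
    "short_exact M (Ext M (cohomology A (n + 1)) X) \<iota> (Hom_homology M A X n) \<pi> (Hom M (cohomology A n) X)"
    "splits M (Hom_homology M A X n) \<pi> (Hom M (cohomology A n) X)"
proof -
  let ?H0 = "cohomology A n" and ?H1 = "cohomology A (n + 1)"
  let ?G0 = "Grp A n" and ?G1 = "Grp A (n + 1)" and ?D = "Diff A n"
  let ?B = "coboundaries A (n + 1)" and ?\<theta> = "Gen_lift A (n + 1)"
  let ?cls0 = "coh_class A n" and ?cls1 = "coh_class A (n + 1)"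
  let ?P1 = "free_Hom M ?G1 X" and ?PG = "free_Hom M (Gen ?H1) X" and ?PR = "free_Hom M (Rel ?H1) X"
  let ?K = "cycles A X n" and ?b = "bd A X n" and ?q = "hq A X n" and ?HH = "Hom_homology M A X n"
  let ?r = "restr M ?H1 X"
  let ?e = "coker_arr M ?r"
  let ?Hom = "Hom M ?H0 X" and ?Ext = "Ext M ?H1 X"
  let ?ev1 = "ev ?G1 X" and ?evG = "ev (Gen ?H1) X" and ?evR = "ev (Rel ?H1) X"
  let ?hev = "hev ?H0 X" and ?cev = "cev A X n"

  note ca0 = countable_abelian_cohomology[OF A, of n] and ca1 = countable_abelian_cohomology[OF A, of "n + 1"]
  note R1 = represents_Grp[OF A X, of "n + 1"] and RG = represents_Gen[OF ca1 X]
    and RR = represents_Rel[OF ca1 X] and RH = represents_Hom[OF ca0 X]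
  note b = bd_homs[OF A X, of n] and q = hq_homs[OF A X, of n] and qb = hq_bd[OF A X, of n]
    and r = restr_homs[OF ca1 X] and e = coker_restr_homs[OF ca1 X] and er = coker_restr_restr[OF ca1 X]
  note cevh = cev_homs[OF A X, of _ n] and hevh = hev_homs[OF ca0 X] and ev1h = represents_homs[OF R1]
    and evGh = represents_homs[OF RG] and evRh = represents_homs[OF RR]
  have K: "?K \<in> Obj M" and Hom: "?Hom \<in> Obj M" and P1: "?P1 \<in> Obj M" and PG: "?PG \<in> Obj M"
    and PR: "?PR \<in> Obj M" and HH: "?HH \<in> Obj M" and Ext: "?Ext \<in> Obj M"
    using homs_Obj[OF b] homs_Obj[OF r] homs_Obj[OF q] homs_Obj[OF e] Hom_Obj[OF ca0 X] by auto
  interpret G0: comm_group ?G0 by (rule comm_group_Grp[OF A])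
  interpret G1: comm_group ?G1 by (rule comm_group_Grp[OF A])
  have z0: "x \<in> carrier ?G0" "?D x = \<one>\<^bsub>?G1\<^esub>" if "x \<in> cocycles A n" for x
    using that by (auto simp: cocycles_iff[OF A])
  have z1: "x \<in> carrier ?G1" if "x \<in> cocycles A (n + 1)" for x
    using that by (auto simp: cocycles_iff[OF A])
  have DB: "?D x \<in> ?B" if "x \<in> carrier ?G0" for x using that by (simp add: coboundaries_Suc[OF A])
  have BZ: "y \<in> cocycles A (n + 1)" if "y \<in> ?B" for y using that coboundaries_subset_cocycles[OF A] by blast
  have D: "?D \<in> hom ?G0 ?G1" by (rule Diff_hom[OF A])
  have DhomB: "?D \<in> hom ?G0 (?G1\<lparr>carrier := ?B\<rparr>)" using D DB by (auto simp: hom_def)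

  obtain s where s: "s \<in> hom (?G1\<lparr>carrier := ?B\<rparr>) ?G0" and Ds: "\<And>y. y \<in> ?B \<Longrightarrow> ?D (s y) = y"
    using coboundary_section[OF A, of n] by blast
  define r0 where "r0 x = x \<otimes>\<^bsub>?G0\<^esub> inv\<^bsub>?G0\<^esub> s (?D x)" for x
  have r0: "r0 \<in> hom ?G0 ?G0" "\<And>x. x \<in> carrier ?G0 \<Longrightarrow> r0 x \<in> cocycles A n"
    "\<And>x. x \<in> cocycles A n \<Longrightarrow> r0 x = x"
    using cocycle_retraction[OF A s] Ds by (simp_all add: r0_def[abs_def])
  obtain r1 where r1: "r1 \<in> hom ?G1 ?G1" "\<And>x. x \<in> carrier ?G1 \<Longrightarrow> r1 x \<in> cocycles A (n + 1)"
    "\<And>x. x \<in> cocycles A (n + 1) \<Longrightarrow> r1 x = x"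
    using ex_cocycle_retraction[OF A, of "n + 1"] by blast
  obtain \<sigma> where \<sigma>: "\<sigma> \<in> hom (Gen ?H1) ?G1" "\<And>g. g \<in> carrier (Gen ?H1) \<Longrightarrow> \<sigma> g \<in> cocycles A (n + 1)"
    "\<And>g. g \<in> carrier (Gen ?H1) \<Longrightarrow> ?cls1 (\<sigma> g) = lin_comb ?H1 g"
    using Gen_lift_to_cocycles[OF A, of "n + 1"] by blast
  note \<theta> = Gen_lift[OF A, where n = "n + 1"] and \<theta>D = Gen_lift_Diff_hom[OF A, of n]
  have sc: "s y \<in> carrier ?G0" if "y \<in> ?B" for y using hom_in_carrier[OF s] that by simp
  have RelG: "g \<in> carrier (Gen ?H1)" if "g \<in> carrier (Rel ?H1)" for g using that by (simp add: carrier_Rel)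
  have \<sigma>B: "\<sigma> g \<in> ?B" if "g \<in> carrier (Rel ?H1)" for g
    using that \<sigma>(2,3)[of g] coh_class_eq_one_iff[OF A, of "\<sigma> g"] by (auto simp: carrier_Rel)
  have \<theta>R: "?\<theta> y \<in> carrier (Rel ?H1)" if "y \<in> ?B" for y
    using that hom_in_carrier[OF \<theta>D] by (auto simp: coboundaries_Suc[OF A])
  have one_R: "?evR 0 = Zero M ?PR X" using represents_one[OF RR] by simp
  have \<theta>1: "?\<theta> \<one>\<^bsub>?G1\<^esub> = 0"
    using hom_one[OF \<theta>(1) G1.group_axioms comm_group.axioms(2)[OF comm_group_Gen]] by simp

  have cev_hom_Z: "?cev \<in> hom ?G0 (hom_group M ?K X)" by (rule cev_hom[OF A X])
  obtain t where t: "t \<in> hom ?H0 (hom_group M ?K X)" "\<And>z. z \<in> cocycles A n \<Longrightarrow> t (?cls0 z) = ?cev z"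
    using cohomology_hom[OF A group_hom_group[OF K X] cev_hom_Z] cev_coboundary[OF A X] by auto
  obtain p where p: "p \<in> homs M ?K ?Hom" and hp: "\<And>c. c \<in> carrier ?H0 \<Longrightarrow> ?hev c \<cdot> p = t c"
    using represents_arr[OF RH K t(1)] by blast
  have hpz: "?hev (?cls0 z) \<cdot> p = ?cev z" if "z \<in> cocycles A n" for z
    using hp t(2) coh_class_closed[OF A] that by simp
  have Hom_eqI: "h = k" if "h \<in> homs M T ?Hom" "k \<in> homs M T ?Hom"
    "\<And>z. z \<in> cocycles A n \<Longrightarrow> ?hev (?cls0 z) \<cdot> h = ?hev (?cls0 z) \<cdot> k" for h k T
    by (rule represents_eqI[OF RH that(1,2)]) (use that(3) in \<open>auto simp: carrier_cohomology[OF A]\<close>)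
  have "p \<cdot> ?b = Zero M ?P1 ?Hom"
  proof (rule Hom_eqI[OF Comp_homs[OF b p] Zero_homs[OF P1 Hom]])
    fix z assume z: "z \<in> cocycles A n"
    note h = hevh[OF coh_class_closed[OF A z]]
    have "?hev (?cls0 z) \<cdot> (p \<cdot> ?b) = ?ev1 (?D z)"
      using Comp_eq_left[OF hpz[OF z] b p h] cev_bd[OF A X z0(1)[OF z]] by simp
    then show "?hev (?cls0 z) \<cdot> (p \<cdot> ?b) = ?hev (?cls0 z) \<cdot> Zero M ?P1 ?Hom"
      using z0(2)[OF z] represents_one[OF R1] Comp_Zero[OF h P1] by simp
  qed
  then obtain \<pi> where \<pi>: "\<pi> \<in> homs M ?HH ?Hom" and \<pi>q: "\<pi> \<cdot> ?q = p"
    using hq_factor[OF A X p] by blast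

  \<comment> \<open>As \<open>r0\<close> fixes cocycles, a coboundary goes to the trivial class;
    this is what allows an arrow into the cycles.\<close>
  have "(\<lambda>x. ?hev (?cls0 (r0 x))) \<in> hom ?G0 (hom_group M ?Hom X)"
    using Group.hom_compose[OF coh_class_retraction_hom[OF A r0(1,2)], of ?hev "hom_group M ?Hom X"] RH
    by (simp add: o_def represents_def)
  moreover have "?hev (?cls0 (r0 y)) = Zero M ?Hom X" if y: "y \<in> coboundaries A n" for y
  proof -
    have "y \<in> cocycles A n" using y coboundaries_subset_cocycles[OF A] by blast
    then have "?cls0 (r0 y) = \<one>\<^bsub>?H0\<^esub>" using r0(3) coh_class_eq_one_iff[OF A] y by simp
    then show ?thesis using represents_one[OF RH] by simp
  qed
  ultimately obtain s' where s': "s' \<in> homs M ?Hom ?K"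
    and cs': "\<And>x. x \<in> carrier ?G0 \<Longrightarrow> ?cev x \<cdot> s' = ?hev (?cls0 (r0 x))"
    using cev_arr[OF A X Hom] by blast
  have ps: "p \<cdot> s' = Ident M ?Hom"
  proof (rule Hom_eqI[OF Comp_homs[OF s' p] Ident_homs[OF Hom]])
    fix z assume z: "z \<in> cocycles A n"
    note h = hevh[OF coh_class_closed[OF A z]]
    show "?hev (?cls0 z) \<cdot> (p \<cdot> s') = ?hev (?cls0 z) \<cdot> Ident M ?Hom"
      using Comp_eq_left[OF hpz[OF z] s' p h] cs'[OF z0(1)[OF z]] r0(3)[OF z] Comp_Ident_right[OF h] by simp
  qed

  have "(\<lambda>x. ?evR (?\<theta> (?D x))) \<in> hom ?G0 (hom_group M ?PR X)"
    using Group.hom_compose[OF \<theta>D, of ?evR "hom_group M ?PR X"] RR by (simp add: o_def represents_def)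
  moreover have "?evR (?\<theta> (?D y)) = Zero M ?PR X" if "y \<in> coboundaries A n" for y
  proof -
    have "y \<in> cocycles A n" using that coboundaries_subset_cocycles[OF A] by blast
    then show ?thesis using z0(2) \<theta>1 one_R by simp
  qed
  ultimately obtain j where j: "j \<in> homs M ?PR ?K"
    and cj: "\<And>x. x \<in> carrier ?G0 \<Longrightarrow> ?cev x \<cdot> j = ?evR (?\<theta> (?D x))"
    using cev_arr[OF A X PR] by blast
  \<comment> \<open>A homomorphism on relations that extends to all generators must give a
    null-homologous cycle. Composing the extension with \<open>?\<theta>\<close> on cocycles, and
    with \<open>r1\<close> to reach the whole group, gives the required homotopy
    \<open>m\<close>.\<close>
  have "(\<lambda>y. ?evG (?\<theta> (r1 y))) \<in> hom ?G1 (hom_group M ?PG X)"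
    using Group.hom_compose[OF Group.hom_compose[OF r1(1) \<theta>(1)], of ?evG "hom_group M ?PG X"] RG
    by (simp add: o_def represents_def)
  then obtain m where m: "m \<in> homs M ?PG ?P1" and em: "\<And>y. y \<in> carrier ?G1 \<Longrightarrow> ?ev1 y \<cdot> m = ?evG (?\<theta> (r1 y))"
    using represents_arr[OF R1 PG] by blast
  have "?q \<cdot> (j \<cdot> ?r) = ?q \<cdot> Zero M ?PG ?K"
  proof (rule hq_eqI[OF A X Comp_homs[OF r j] Zero_homs[OF PG K] m])
    fix x assume x: "x \<in> carrier ?G0"
    have "?cev x \<cdot> (j \<cdot> ?r) = ?evG (?\<theta> (?D x))"
      using Comp_eq_left[OF cj[OF x] r j cevh[OF x]] ev_restr[OF ca1 X \<theta>R[OF DB[OF x]]] by simp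
    also have "\<dots> = ?ev1 (?D x) \<cdot> m"
      using em z1[OF BZ[OF DB[OF x]]] r1(3)[OF BZ[OF DB[OF x]]] by simp
    finally show "?cev x \<cdot> (j \<cdot> ?r) = ?cev x \<cdot> Zero M ?PG ?K \<oplus> ?ev1 (?D x) \<cdot> m"
      using Comp_Zero[OF cevh[OF x] PG] Add_Zero_left[OF Comp_homs[OF m ev1h[OF z1[OF BZ[OF DB[OF x]]]]]] by simp
  qed
  then have "(?q \<cdot> j) \<cdot> ?r = Zero M ?PG ?HH"
    using Comp_assoc[OF r j q] Comp_Zero[OF q PG] by simp
  then obtain \<iota> where \<iota>: "\<iota> \<in> homs M ?Ext ?HH" and \<iota>e: "\<iota> \<cdot> ?e = ?q \<cdot> j"
    using coker_arr_factor[OF r Comp_homs[OF j q]] unfolding Ext_def by blast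

  have \<sigma>RB: "\<sigma> \<in> hom (Rel ?H1) (?G1\<lparr>carrier := ?B\<rparr>)"
    using \<sigma>B hom_mult[OF \<sigma>(1)] RelG by (intro homI) auto
  have "(\<lambda>g. ?cev (s (\<sigma> g))) \<in> hom (Rel ?H1) (hom_group M ?K X)"
    using Group.hom_compose[OF Group.hom_compose[OF \<sigma>RB s] cev_hom_Z] by (simp add: o_def)
  then obtain \<tau> where \<tau>: "\<tau> \<in> homs M ?K ?PR" and e\<tau>: "\<And>g. g \<in> carrier (Rel ?H1) \<Longrightarrow> ?evR g \<cdot> \<tau> = ?cev (s (\<sigma> g))"
    using represents_arr[OF RR K] by blast
  \<comment> \<open>On boundaries \<open>\<tau>\<close> cancels \<open>s\<close> against the
    differential and leaves \<open>\<sigma>\<close>, which is defined on all generators. So \<tau>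
    sends boundaries to homomorphisms that extend from the relations, and these vanish in
    Ext.\<close>
  have "(\<lambda>g. ?ev1 (\<sigma> g)) \<in> hom (Gen ?H1) (hom_group M ?P1 X)"
    using Group.hom_compose[OF \<sigma>(1), of ?ev1 "hom_group M ?P1 X"] R1 by (simp add: o_def represents_def)
  then obtain m' where m': "m' \<in> homs M ?P1 ?PG" and em': "\<And>g. g \<in> carrier (Gen ?H1) \<Longrightarrow> ?evG g \<cdot> m' = ?ev1 (\<sigma> g)"
    using represents_arr[OF RG P1] by blast
  have \<tau>b: "\<tau> \<cdot> ?b = ?r \<cdot> m'"
  proof (rule represents_eqI[OF RR Comp_homs[OF b \<tau>] Comp_homs[OF m' r]])
    fix g assume g: "g \<in> carrier (Rel ?H1)"
    have "?evR g \<cdot> (\<tau> \<cdot> ?b) = ?ev1 (\<sigma> g)"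
      using Comp_eq_left[OF e\<tau>[OF g] b \<tau> evRh[OF g]] cev_bd[OF A X sc[OF \<sigma>B[OF g]]] Ds[OF \<sigma>B[OF g]] by simp
    then show "?evR g \<cdot> (\<tau> \<cdot> ?b) = ?evR g \<cdot> (?r \<cdot> m')"
      using Comp_eq_left[OF ev_restr[OF ca1 X g] m' r evRh[OF g]] em'[OF RelG[OF g]] by simp
  qed
  have e0: "?e \<cdot> (?r \<cdot> h) = Zero M T ?Ext" if h: "h \<in> homs M T ?PG" for h T
    using Comp_eq_left[OF er h r e] Zero_Comp[OF h Ext] by simp
  have "(?e \<cdot> \<tau>) \<cdot> ?b = Zero M ?P1 ?Ext"
    using Comp_assoc[OF b \<tau> e] \<tau>b e0[OF m'] by simp
  then obtain \<rho> where \<rho>: "\<rho> \<in> homs M ?HH ?Ext" and \<rho>q: "\<rho> \<cdot> ?q = ?e \<cdot> \<tau>"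
    using hq_factor[OF A X Comp_homs[OF \<tau> e]] by blast

  \<comment> \<open>\<open>\<sigma> g\<close> is a cocycle in the class represented by
    \<open>g\<close>, and \<open>?\<theta>\<close> lifts that class again, so both terms have the
    same image in \<open>?H1\<close>.\<close>
  have \<theta>\<sigma>: "?\<theta> (\<sigma> g) - g \<in> carrier (Rel ?H1)" if g: "g \<in> carrier (Gen ?H1)" for g
  proof -
    interpret Gen: comm_group "Gen ?H1" by (rule comm_group_Gen)
    interpret H: comm_group ?H1 by (rule comm_group_cohomology[OF A])
    have lc: "lin_comb ?H1 \<in> hom (Gen ?H1) ?H1" by (rule lin_comb_Gen_hom[OF H.comm_group_axioms])
    have \<theta>g: "?\<theta> (\<sigma> g) \<in> carrier (Gen ?H1)" using hom_in_carrier[OF \<theta>(1)] z1 \<sigma>(2) g by blast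
    have inv: "inv\<^bsub>Gen ?H1\<^esub> g = - g" using g by (simp add: Gen_def)
    have eq: "?\<theta> (\<sigma> g) - g = ?\<theta> (\<sigma> g) \<otimes>\<^bsub>Gen ?H1\<^esub> inv\<^bsub>Gen ?H1\<^esub> g" using inv by simp
    have "lin_comb ?H1 (?\<theta> (\<sigma> g) - g) = \<one>\<^bsub>?H1\<^esub>"
      unfolding eq using hom_mult[OF lc \<theta>g Gen.inv_closed[OF g]]
        hom_apply_inv[OF Gen.group_axioms H.group_axioms lc g] \<theta>(2)[OF \<sigma>(2)[OF g]] \<sigma>(3)[OF g]
        hom_in_carrier[OF lc g] by (simp del: mult_Gen)
    moreover have "?\<theta> (\<sigma> g) - g \<in> carrier (Gen ?H1)"
      unfolding eq by (intro Gen.m_closed \<theta>g Gen.inv_closed g)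
    ultimately show ?thesis by (simp add: carrier_Rel)
  qed
  have "(\<lambda>g. ?\<theta> (\<sigma> g) - g) \<in> hom (Gen ?H1) (Rel ?H1)"
    using \<theta>\<sigma> hom_mult[OF \<theta>(1)] hom_mult[OF \<sigma>(1)] z1 \<sigma>(2) by (intro homI) auto
  then have "(\<lambda>g. ?evR (?\<theta> (\<sigma> g) - g)) \<in> hom (Gen ?H1) (hom_group M ?PR X)"
    using Group.hom_compose[of _ "Gen ?H1" "Rel ?H1" ?evR "hom_group M ?PR X"] RR by (fastforce simp: o_def represents_def)
  then obtain w where w: "w \<in> homs M ?PR ?PG"
    and ew: "\<And>g. g \<in> carrier (Gen ?H1) \<Longrightarrow> ?evG g \<cdot> w = ?evR (?\<theta> (\<sigma> g) - g)"
    using represents_arr[OF RG PR] by blast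
  note IdR = Ident_homs[OF PR] and rw = Comp_homs[OF w r]
  \<comment> \<open>The error term factors through the restriction \<open>?r\<close> and therefore
    dies in Ext.\<close>
  have \<tau>j: "\<tau> \<cdot> j = Ident M ?PR \<oplus> ?r \<cdot> w"
  proof (rule represents_eqI[OF RR Comp_homs[OF j \<tau>] Add_homs[OF IdR rw]])
    fix g assume g: "g \<in> carrier (Rel ?H1)"
    have "?evR g \<cdot> (\<tau> \<cdot> j) = ?evR (?\<theta> (\<sigma> g))"
      using Comp_eq_left[OF e\<tau>[OF g] j \<tau> evRh[OF g]] cj[OF sc[OF \<sigma>B[OF g]]] Ds[OF \<sigma>B[OF g]] by simp
    also have "\<dots> = ?evR g \<oplus> ?evR (?\<theta> (\<sigma> g) - g)"
      using represents_Add[OF RR g \<theta>\<sigma>[OF RelG[OF g]]] by simp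
    also have "\<dots> = ?evR g \<cdot> Ident M ?PR \<oplus> ?evR g \<cdot> (?r \<cdot> w)"
      using Comp_Ident_right[OF evRh[OF g]] Comp_eq_left[OF ev_restr[OF ca1 X g] w r evRh[OF g]] ew[OF RelG[OF g]] by simp
    finally show "?evR g \<cdot> (\<tau> \<cdot> j) = ?evR g \<cdot> (Ident M ?PR \<oplus> ?r \<cdot> w)"
      using Comp_Add_right[OF IdR rw evRh[OF g]] by simp
  qed
  have \<rho>\<iota>: "\<rho> \<cdot> \<iota> = Ident M ?Ext"
  proof (rule coker_arr_cancel[OF r])
    show "\<rho> \<cdot> \<iota> \<in> homs M (Coker M ?r) ?Ext" "Ident M ?Ext \<in> homs M (Coker M ?r) ?Ext"
      using Comp_homs[OF \<iota> \<rho>] Ident_homs[OF Ext] by (simp_all add: Ext_def)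
    have "(\<rho> \<cdot> \<iota>) \<cdot> ?e = (\<rho> \<cdot> ?q) \<cdot> j"
      using Comp_assoc[OF e \<iota> \<rho>] \<iota>e Comp_assoc[OF j q \<rho>] by simp
    also have "\<dots> = ?e \<cdot> (\<tau> \<cdot> j)" using \<rho>q Comp_assoc[OF j \<tau> e] by simp
    also have "\<dots> = ?e \<oplus> Zero M ?PR ?Ext"
      using \<tau>j Comp_Add_right[OF IdR rw e] e0[OF w] Comp_Ident_right[OF e] by simp
    finally show "(\<rho> \<cdot> \<iota>) \<cdot> ?e = Ident M ?Ext \<cdot> ?e"
      using Add_Zero_right[OF e] Comp_Ident_left[OF e] by simp
  qed

  \<comment> \<open>\<sigma> \<theta> deviates from the identity by coboundaries only on cocycles.
    Precomposition with \<open>r1\<close> extends the deviation to the whole group with values in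
    \<open>?B\<close>, so that \<open>s\<close> can be applied and the result dualized to
    \<open>v\<close>.\<close>
  let ?d = "\<lambda>y. \<sigma> (?\<theta> (r1 y)) \<otimes>\<^bsub>?G1\<^esub> inv\<^bsub>?G1\<^esub> r1 y"
  have \<theta>r: "?\<theta> (r1 y) \<in> carrier (Gen ?H1)" if "y \<in> carrier ?G1" for y
    using hom_in_carrier[OF \<theta>(1) z1[OF r1(2)[OF that]]] .
  have dB: "?d y \<in> ?B" if y: "y \<in> carrier ?G1" for y
  proof -
    let ?Z = "?G1\<lparr>carrier := cocycles A (n + 1)\<rparr>"
    interpret Z: comm_group ?Z by (rule comm_group_cocycles[OF A])
    interpret H: comm_group ?H1 by (rule comm_group_cohomology[OF A])
    have inv: "inv\<^bsub>?Z\<^esub> r1 y = inv\<^bsub>?G1\<^esub> r1 y"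
      using G1.m_inv_consistent[OF subgroup_cocycles[OF A]] r1(2)[OF y] by simp
    have "?cls1 (inv\<^bsub>?G1\<^esub> r1 y) = inv\<^bsub>?H1\<^esub> ?cls1 (r1 y)"
      using hom_apply_inv[OF Z.group_axioms H.group_axioms coh_class_hom[OF A], of "r1 y"] r1(2)[OF y] inv by simp
    moreover have iZ: "inv\<^bsub>?G1\<^esub> r1 y \<in> cocycles A (n + 1)"
      using Z.inv_closed[of "r1 y"] r1(2)[OF y] inv by simp
    ultimately have "?cls1 (?d y) = \<one>\<^bsub>?H1\<^esub>"
      using coh_class_mult[OF A \<sigma>(2)[OF \<theta>r[OF y]] iZ] \<sigma>(3)[OF \<theta>r[OF y]] \<theta>(2)[OF r1(2)[OF y]]
        coh_class_closed[OF A r1(2)[OF y]] by simp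
    moreover have "?d y \<in> cocycles A (n + 1)"
      by (rule subgroup.m_closed[OF subgroup_cocycles[OF A] \<sigma>(2)[OF \<theta>r[OF y]] iZ])
    ultimately show ?thesis using coh_class_eq_one_iff[OF A] by blast
  qed
  have "?d \<in> hom ?G1 ?G1"
    using hom_divide[OF G1.comm_group_axioms Group.hom_compose[OF Group.hom_compose[OF r1(1) \<theta>(1)] \<sigma>(1)] r1(1)]
    by (simp add: o_def)
  then have dh: "?d \<in> hom ?G1 (?G1\<lparr>carrier := ?B\<rparr>)"
    using dB by (auto simp: hom_def)
  have "(\<lambda>y. ?cev (s (?d y))) \<in> hom ?G1 (hom_group M ?K X)"
    using Group.hom_compose[OF Group.hom_compose[OF dh s] cev_hom_Z] by (simp add: o_def)
  then obtain v where v: "v \<in> homs M ?K ?P1" and evv: "\<And>y. y \<in> carrier ?G1 \<Longrightarrow> ?ev1 y \<cdot> v = ?cev (s (?d y))"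
    using represents_arr[OF R1 K] by blast
  note IdK = Ident_homs[OF K] and j\<tau> = Comp_homs[OF \<tau> j] and s'p = Comp_homs[OF p s']
  \<comment> \<open>The sum differs from the identity of the cycles by the dual of \<open>s\<close>
    after \<open>?d\<close> after \<open>?D\<close>. This map factors through the differential,
    hence is null-homologous.\<close>
  have hom: "?q \<cdot> (j \<cdot> \<tau> \<oplus> s' \<cdot> p) = ?q \<cdot> Ident M ?K"
  proof (rule hq_eqI[OF A X Add_homs[OF j\<tau> s'p] IdK v])
    fix x assume x: "x \<in> carrier ?G0"
    note Bx = DB[OF x] and Zx = BZ[OF DB[OF x]] and Gx = z1[OF BZ[OF DB[OF x]]]
    let ?y = "\<sigma> (?\<theta> (?D x))"
    have yB: "?y \<in> ?B" by (rule \<sigma>B[OF \<theta>R[OF Bx]])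
    have dx: "?d (?D x) = ?y \<otimes>\<^bsub>?G1\<^esub> inv\<^bsub>?G1\<^esub> ?D x" using r1(3)[OF Zx] by simp
    have iB: "inv\<^bsub>?G1\<^esub> ?D x \<in> ?B" by (rule subgroup.m_inv_closed[OF subgroup_coboundaries[OF A] Bx])
    have sBg: "group (?G1\<lparr>carrier := ?B\<rparr>)" by (rule subgroup.subgroup_is_group[OF subgroup_coboundaries[OF A] G1.group_axioms])
    have "s (inv\<^bsub>?G1\<^esub> ?D x) = inv\<^bsub>?G0\<^esub> s (?D x)"
      using hom_apply_inv[OF sBg G0.group_axioms s, of "?D x"] G1.m_inv_consistent[OF subgroup_coboundaries[OF A] Bx] Bx by simp
    then have "s (?d (?D x)) = s ?y \<otimes>\<^bsub>?G0\<^esub> inv\<^bsub>?G0\<^esub> s (?D x)"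
      using hom_mult[OF s, of ?y "inv\<^bsub>?G1\<^esub> ?D x"] yB iB dx by simp
    \<comment> \<open>In additive notation, \<open>r0 x = x - s (?D x)\<close> and
      \<open>s (?d (?D x)) = s ?y - s (?D x)\<close>. The terms \<open>s (?D x)\<close> match
      because \<open>r0\<close> and \<open>\<tau>\<close> were made from the same section.\<close>
    then have key: "s ?y \<otimes>\<^bsub>?G0\<^esub> r0 x = x \<otimes>\<^bsub>?G0\<^esub> s (?d (?D x))"
      unfolding r0_def using x sc[OF yB] sc[OF Bx] by (simp add: G0.m_ac)
    have "?cev x \<cdot> (j \<cdot> \<tau>) = ?cev (s ?y)"
      using Comp_eq_left[OF cj[OF x] \<tau> j cevh[OF x]] e\<tau>[OF \<theta>R[OF Bx]] by simp
    moreover have "?cev x \<cdot> (s' \<cdot> p) = ?cev (r0 x)"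
      using Comp_eq_left[OF cs'[OF x] p s' cevh[OF x]] hpz[OF r0(2)[OF x]] by simp
    ultimately have "?cev x \<cdot> (j \<cdot> \<tau> \<oplus> s' \<cdot> p) = ?cev (s ?y) \<oplus> ?cev (r0 x)"
      using Comp_Add_right[OF j\<tau> s'p cevh[OF x]] by simp
    also have "\<dots> = ?cev (x \<otimes>\<^bsub>?G0\<^esub> s (?d (?D x)))"
      using cev_Add[OF A X sc[OF yB] z0(1)[OF r0(2)[OF x]]] key by simp
    also have "\<dots> = ?cev x \<oplus> ?ev1 (?D x) \<cdot> v"
      using cev_Add[OF A X x sc[OF dB[OF Gx]]] evv[OF Gx] by simp
    finally show "?cev x \<cdot> (j \<cdot> \<tau> \<oplus> s' \<cdot> p) = ?cev x \<cdot> Ident M ?K \<oplus> ?ev1 (?D x) \<cdot> v"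
      using Comp_Ident_right[OF cevh[OF x]] by simp
  qed
  note qs' = Comp_homs[OF s' q]
  note \<iota>\<rho> = Comp_homs[OF \<rho> \<iota>] and qs'\<pi> = Comp_homs[OF \<pi> qs']
  have sum: "\<iota> \<cdot> \<rho> \<oplus> (?q \<cdot> s') \<cdot> \<pi> = Ident M ?HH"
  proof (rule hq_cancel[OF A X Add_homs[OF \<iota>\<rho> qs'\<pi>] Ident_homs[OF HH]])
    have "(\<iota> \<cdot> \<rho>) \<cdot> ?q = ?q \<cdot> (j \<cdot> \<tau>)"
      using Comp_assoc[OF q \<rho> \<iota>] \<rho>q Comp_eq_left[OF \<iota>e \<tau> e \<iota>] Comp_assoc[OF \<tau> j q] by simp
    moreover have "((?q \<cdot> s') \<cdot> \<pi>) \<cdot> ?q = ?q \<cdot> (s' \<cdot> p)"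
      using Comp_assoc[OF q \<pi> qs'] \<pi>q Comp_assoc[OF p s' q] by simp
    ultimately have "(\<iota> \<cdot> \<rho> \<oplus> (?q \<cdot> s') \<cdot> \<pi>) \<cdot> ?q = ?q \<cdot> (j \<cdot> \<tau> \<oplus> s' \<cdot> p)"
      using Comp_Add_left[OF q \<iota>\<rho> qs'\<pi>] Comp_Add_right[OF j\<tau> s'p q] by simp
    then show "(\<iota> \<cdot> \<rho> \<oplus> (?q \<cdot> s') \<cdot> \<pi>) \<cdot> ?q = Ident M ?HH \<cdot> ?q"
      using hom Comp_Ident_right[OF q] Comp_Ident_left[OF q] by simp
  qed
  have \<pi>s: "\<pi> \<cdot> (?q \<cdot> s') = Ident M ?Hom"
    using Comp_eq_left[OF \<pi>q s' q \<pi>] ps by simp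
  \<comment> \<open>\<open>p\<close> evaluates cycles only at cocycles, where the differential is
    trivial and so is the value of \<open>j\<close>.\<close>
  have pj: "p \<cdot> j = Zero M ?PR ?Hom"
  proof (rule Hom_eqI[OF Comp_homs[OF j p] Zero_homs[OF PR Hom]])
    fix z assume z: "z \<in> cocycles A n"
    note h = hevh[OF coh_class_closed[OF A z]]
    show "?hev (?cls0 z) \<cdot> (p \<cdot> j) = ?hev (?cls0 z) \<cdot> Zero M ?PR ?Hom"
      using Comp_eq_left[OF hpz[OF z] j p h] cj[OF z0(1)[OF z]] z0(2)[OF z] \<theta>1 one_R Comp_Zero[OF h PR] by simp
  qed
  have \<pi>\<iota>: "\<pi> \<cdot> \<iota> = Zero M ?Ext ?Hom"
  proof (rule coker_arr_cancel[OF r])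
    show "\<pi> \<cdot> \<iota> \<in> homs M (Coker M ?r) ?Hom" "Zero M ?Ext ?Hom \<in> homs M (Coker M ?r) ?Hom"
      using Comp_homs[OF \<iota> \<pi>] Zero_homs[OF Ext Hom] by (simp_all add: Ext_def)
    show "(\<pi> \<cdot> \<iota>) \<cdot> ?e = Zero M ?Ext ?Hom \<cdot> ?e"
      using Comp_assoc[OF e \<iota> \<pi>] \<iota>e Comp_eq_left[OF \<pi>q j q \<pi>] pj Zero_Comp[OF e Hom] by simp
  qed
  show thesis
  proof (rule that)
    show "uct_in A X n \<iota>" using \<iota> j \<iota>e cj by (auto simp: uct_in_def)
    show "uct_pr A X n \<pi>" using \<pi> \<pi>q hpz by (auto simp: uct_pr_def)
    show "short_exact M ?Ext \<iota> ?HH \<pi> ?Hom"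
      by (rule short_exact_if_split[OF \<iota> \<pi> \<rho> qs' \<rho>\<iota> \<pi>s \<pi>\<iota> sum])
    show "splits M ?HH \<pi> ?Hom" using qs' \<pi>s by (auto simp: splits_def)
  qed
qed

text \<open>Evaluated at the class of a cocycle \<open>z\<close>, both composites with the quotient
  give \<open>cev B X n (f n z)\<close>, and such evaluations are jointly monic.\<close>

lemma uct_pr_natural:
  assumes A: "free_complex A" and B: "free_complex B" and f: "chain_map A B f" and X: "X \<in> Obj M"
    and \<pi>A: "uct_pr A X n \<pi>A" and \<pi>B: "uct_pr B X n \<pi>B"
  shows "\<pi>A \<cdot> Hom_homology_arr M A B f X n
    = Hom_arr M (cohomology A n) (cohomology B n) (cohomology_map B f n) X \<cdot> \<pi>B"
proof -
  let ?HA = "cohomology A n" and ?HB = "cohomology B n" and ?F = "Hom_homology_arr M A B f X n"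
  let ?f = "cohomology_map B f n"
  let ?N = "Hom_arr M ?HA ?HB ?f X"
  note cA = countable_abelian_cohomology[OF A, of n] and cB = countable_abelian_cohomology[OF B, of n]
  note N = Hom_arr(1,2)[OF cA cB cohomology_map_hom[OF A B f] X]
  obtain k where k: "k \<in> homs M (cycles B X n) (cycles A X n)"
    "\<And>x. x \<in> carrier (Grp A n) \<Longrightarrow> cev A X n x \<cdot> k = cev B X n (f n x)"
    "?F \<in> homs M (Hom_homology M B X n) (Hom_homology M A X n)" "?F \<cdot> hq B X n = hq A X n \<cdot> k"
    using Hom_homology_arr[OF A B f X] by blast
  have pA: "\<pi>A \<in> homs M (Hom_homology M A X n) (Hom M ?HA X)"
    and pB: "\<pi>B \<in> homs M (Hom_homology M B X n) (Hom M ?HB X)"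
    and eA: "\<And>z. z \<in> cocycles A n \<Longrightarrow> hev ?HA X (coh_class A n z) \<cdot> (\<pi>A \<cdot> hq A X n) = cev A X n z"
    and eB: "\<And>z. z \<in> cocycles B n \<Longrightarrow> hev ?HB X (coh_class B n z) \<cdot> (\<pi>B \<cdot> hq B X n) = cev B X n z"
    using \<pi>A \<pi>B by (auto simp: uct_pr_def)
  note qA = hq_homs[OF A X, of n] and qB = hq_homs[OF B X, of n]
  note pqA = Comp_homs[OF qA pA] and pqB = Comp_homs[OF qB pB]
  have eq: "(\<pi>A \<cdot> hq A X n) \<cdot> k = ?N \<cdot> (\<pi>B \<cdot> hq B X n)"
  proof (rule represents_eqI[OF represents_Hom[OF cA X] Comp_homs[OF k(1) pqA] Comp_homs[OF pqB N(1)]])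
    fix c assume c: "c \<in> carrier ?HA"
    then obtain z where z: "z \<in> cocycles A n" "c = coh_class A n z" by (auto simp: carrier_cohomology[OF A])
    have zG: "z \<in> carrier (Grp A n)" using z by (simp add: cocycles_iff[OF A])
    note h = hev_homs[OF cA X c]
    have "hev ?HA X c \<cdot> ((\<pi>A \<cdot> hq A X n) \<cdot> k) = cev B X n (f n z)"
      using Comp_eq_left[OF eA[OF z(1)] k(1) pqA] h k(2)[OF zG] z(2) by simp
    also have "\<dots> = hev ?HB X (?f c) \<cdot> (\<pi>B \<cdot> hq B X n)"
      using eB[OF chain_map_cocycles[OF A B f z(1)]] cohomology_map_coh_class[OF A B f z(1)] z(2) by simp
    also have "\<dots> = hev ?HA X c \<cdot> (?N \<cdot> (\<pi>B \<cdot> hq B X n))"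
      using Comp_eq_left[OF N(2)[OF c] pqB N(1) h] by simp
    finally show "hev ?HA X c \<cdot> ((\<pi>A \<cdot> hq A X n) \<cdot> k) = hev ?HA X c \<cdot> (?N \<cdot> (\<pi>B \<cdot> hq B X n))" .
  qed
  show ?thesis
  proof (rule hq_cancel[OF B X Comp_homs[OF k(3) pA] Comp_homs[OF pB N(1)]])
    show "(\<pi>A \<cdot> ?F) \<cdot> hq B X n = (?N \<cdot> \<pi>B) \<cdot> hq B X n"
      using Comp_assoc[OF qB k(3) pA] k(4) Comp_assoc[OF k(1) qA pA] Comp_assoc[OF qB pB N(1)] eq by simp
  qed
qed

lemma uct_pr_push:
  assumes A: "free_complex A" and u: "u \<in> homs M X Y"
    and \<pi>X: "uct_pr A X n \<pi>X" and \<pi>Y: "uct_pr A Y n \<pi>Y"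
  shows "\<pi>Y \<cdot> Hom_homology_push M A X Y u n = Hom_push M (cohomology A n) X Y u \<cdot> \<pi>X"
proof -
  have X: "X \<in> Obj M" and Y: "Y \<in> Obj M" using homs_Obj[OF u] by auto
  let ?H = "cohomology A n" and ?F = "Hom_homology_push M A X Y u n"
  let ?N = "Hom_push M ?H X Y u"
  note cA = countable_abelian_cohomology[OF A, of n]
  note N = Hom_push(1,2)[OF cA u]
  obtain k where k: "k \<in> homs M (cycles A X n) (cycles A Y n)"
    "\<And>x. x \<in> carrier (Grp A n) \<Longrightarrow> cev A Y n x \<cdot> k = u \<cdot> cev A X n x"
    "?F \<in> homs M (Hom_homology M A X n) (Hom_homology M A Y n)" "?F \<cdot> hq A X n = hq A Y n \<cdot> k"
    using Hom_homology_push[OF A u] by blast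
  have pX: "\<pi>X \<in> homs M (Hom_homology M A X n) (Hom M ?H X)"
    and pY: "\<pi>Y \<in> homs M (Hom_homology M A Y n) (Hom M ?H Y)"
    and eX: "\<And>z. z \<in> cocycles A n \<Longrightarrow> hev ?H X (coh_class A n z) \<cdot> (\<pi>X \<cdot> hq A X n) = cev A X n z"
    and eY: "\<And>z. z \<in> cocycles A n \<Longrightarrow> hev ?H Y (coh_class A n z) \<cdot> (\<pi>Y \<cdot> hq A Y n) = cev A Y n z"
    using \<pi>X \<pi>Y by (auto simp: uct_pr_def)
  note qX = hq_homs[OF A X, of n] and qY = hq_homs[OF A Y, of n]
  note pqX = Comp_homs[OF qX pX] and pqY = Comp_homs[OF qY pY]
  have eq: "(\<pi>Y \<cdot> hq A Y n) \<cdot> k = ?N \<cdot> (\<pi>X \<cdot> hq A X n)"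
  proof (rule represents_eqI[OF represents_Hom[OF cA Y] Comp_homs[OF k(1) pqY] Comp_homs[OF pqX N(1)]])
    fix c assume c: "c \<in> carrier ?H"
    then obtain z where z: "z \<in> cocycles A n" "c = coh_class A n z" by (auto simp: carrier_cohomology[OF A])
    have zG: "z \<in> carrier (Grp A n)" using z by (simp add: cocycles_iff[OF A])
    note hX = hev_homs[OF cA X c] and hY = hev_homs[OF cA Y c]
    have "hev ?H Y c \<cdot> ((\<pi>Y \<cdot> hq A Y n) \<cdot> k) = u \<cdot> cev A X n z"
      using Comp_eq_left[OF eY[OF z(1)] k(1) pqY] hY k(2)[OF zG] z(2) by simp
    also have "\<dots> = u \<cdot> (hev ?H X c \<cdot> (\<pi>X \<cdot> hq A X n))"
      using eX[OF z(1)] z(2) by simp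
    also have "\<dots> = hev ?H Y c \<cdot> (?N \<cdot> (\<pi>X \<cdot> hq A X n))"
      using Comp_eq_left[OF N(2)[OF c] pqX N(1) hY] Comp_assoc[OF pqX hX u] by simp
    finally show "hev ?H Y c \<cdot> ((\<pi>Y \<cdot> hq A Y n) \<cdot> k) = hev ?H Y c \<cdot> (?N \<cdot> (\<pi>X \<cdot> hq A X n))" .
  qed
  show ?thesis
  proof (rule hq_cancel[OF A X Comp_homs[OF k(3) pY] Comp_homs[OF pX N(1)]])
    show "(\<pi>Y \<cdot> ?F) \<cdot> hq A X n = (?N \<cdot> \<pi>X) \<cdot> hq A X n"
      using Comp_assoc[OF qX k(3) pY] k(4) Comp_assoc[OF k(1) qY pY] Comp_assoc[OF qX pX N(1)] eq by simp
  qed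
qed

text \<open>The lift \<theta> depends on \<open>A\<close> alone and not on the object, so the square
  commutes before passing to homology and no homotopy enters.\<close>

lemma uct_in_push:
  assumes A: "free_complex A" and u: "u \<in> homs M X Y"
    and \<iota>X: "uct_in A X n \<iota>X" and \<iota>Y: "uct_in A Y n \<iota>Y"
  shows "\<iota>Y \<cdot> Ext_push M (cohomology A (n + 1)) X Y u = Hom_homology_push M A X Y u n \<cdot> \<iota>X"
proof -
  have X: "X \<in> Obj M" and Y: "Y \<in> Obj M" using homs_Obj[OF u] by auto
  let ?H = "cohomology A (n + 1)" and ?F = "Hom_homology_push M A X Y u n"
  let ?N = "Ext_push M ?H X Y u" and ?g = "free_Hom_push M (Rel ?H) X Y u"
  let ?\<theta>D = "\<lambda>x. Gen_lift A (n + 1) (Diff A n x)"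
  note cA = countable_abelian_cohomology[OF A, of "n + 1"]
  note N = Hom_push(3,4)[OF cA u] and g = free_Hom_push[OF cfa_Rel[OF cA] u]
  obtain k where k: "k \<in> homs M (cycles A X n) (cycles A Y n)"
    "\<And>x. x \<in> carrier (Grp A n) \<Longrightarrow> cev A Y n x \<cdot> k = u \<cdot> cev A X n x"
    "?F \<in> homs M (Hom_homology M A X n) (Hom_homology M A Y n)" "?F \<cdot> hq A X n = hq A Y n \<cdot> k"
    using Hom_homology_push[OF A u] by blast
  obtain jX jY where iX: "\<iota>X \<in> homs M (Ext M ?H X) (Hom_homology M A X n)"
    and jX: "jX \<in> homs M (free_Hom M (Rel ?H) X) (cycles A X n)"
    and ijX: "\<iota>X \<cdot> coker_arr M (restr M ?H X) = hq A X n \<cdot> jX"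
    and eX: "\<And>x. x \<in> carrier (Grp A n) \<Longrightarrow> cev A X n x \<cdot> jX = ev (Rel ?H) X (?\<theta>D x)"
    and iY: "\<iota>Y \<in> homs M (Ext M ?H Y) (Hom_homology M A Y n)"
    and jY: "jY \<in> homs M (free_Hom M (Rel ?H) Y) (cycles A Y n)"
    and ijY: "\<iota>Y \<cdot> coker_arr M (restr M ?H Y) = hq A Y n \<cdot> jY"
    and eY: "\<And>x. x \<in> carrier (Grp A n) \<Longrightarrow> cev A Y n x \<cdot> jY = ev (Rel ?H) Y (?\<theta>D x)"
    using \<iota>X \<iota>Y unfolding uct_in_def by blast
  note qX = hq_homs[OF A X, of n] and qY = hq_homs[OF A Y, of n]
  note eeX = coker_restr_homs[OF cA X] and eeY = coker_restr_homs[OF cA Y]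
  have eq: "jY \<cdot> ?g = k \<cdot> jX"
  proof (rule cev_eqI[OF A Y Comp_homs[OF g(1) jY] Comp_homs[OF jX k(1)]])
    fix x assume x: "x \<in> carrier (Grp A n)"
    note c = cev_homs[OF A Y x]
    have "cev A Y n x \<cdot> (jY \<cdot> ?g) = u \<cdot> ev (Rel ?H) X (?\<theta>D x)"
      using Comp_eq_left[OF eY[OF x] g(1) jY c] g(2)[OF hom_in_carrier[OF Gen_lift_Diff_hom[OF A] x]] by simp
    also have "\<dots> = cev A Y n x \<cdot> (k \<cdot> jX)"
      using Comp_eq_left[OF k(2)[OF x] jX k(1) c] Comp_assoc[OF jX cev_homs[OF A X x] u] eX[OF x] by simp
    finally show "cev A Y n x \<cdot> (jY \<cdot> ?g) = cev A Y n x \<cdot> (k \<cdot> jX)" .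
  qed
  show ?thesis
  proof (rule coker_arr_cancel[OF restr_homs[OF cA X]])
    show "\<iota>Y \<cdot> ?N \<in> homs M (Coker M (restr M ?H X)) (Hom_homology M A Y n)"
      "?F \<cdot> \<iota>X \<in> homs M (Coker M (restr M ?H X)) (Hom_homology M A Y n)"
      using Comp_homs[OF N(1) iY] Comp_homs[OF iX k(3)] by (simp_all add: Ext_def)
    have "(\<iota>Y \<cdot> ?N) \<cdot> coker_arr M (restr M ?H X) = hq A Y n \<cdot> (jY \<cdot> ?g)"
      using Comp_assoc[OF eeX N(1) iY] N(2) Comp_eq_left[OF ijY g(1) eeY iY] Comp_assoc[OF g(1) jY qY] by simp
    moreover have "(?F \<cdot> \<iota>X) \<cdot> coker_arr M (restr M ?H X) = hq A Y n \<cdot> (k \<cdot> jX)"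
      using Comp_assoc[OF eeX iX k(3)] ijX Comp_eq_left[OF k(4) jX qX k(3)] Comp_assoc[OF jX k(1) qY] by simp
    ultimately show "(\<iota>Y \<cdot> ?N) \<cdot> coker_arr M (restr M ?H X) = (?F \<cdot> \<iota>X) \<cdot> coker_arr M (restr M ?H X)"
      using eq by simp
  qed
qed

text \<open>The lifts for \<open>A\<close> and \<open>B\<close> are chosen independently of
  \<open>f\<close>, so lifting before or after applying \<open>f\<close> agrees only modulo
  relations. The difference, dualized, is the homotopy.\<close>

lemma uct_in_natural:
  assumes A: "free_complex A" and B: "free_complex B" and f: "chain_map A B f" and X: "X \<in> Obj M"
    and \<iota>A: "uct_in A X n \<iota>A" and \<iota>B: "uct_in B X n \<iota>B"
  shows "\<iota>A \<cdot> Ext_arr M (cohomology A (n + 1)) (cohomology B (n + 1)) (cohomology_map B f (n + 1)) X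
    = Hom_homology_arr M A B f X n \<cdot> \<iota>B"
proof -
  let ?HA = "cohomology A (n + 1)" and ?HB = "cohomology B (n + 1)" and ?F = "Hom_homology_arr M A B f X n"
  let ?f = "cohomology_map B f (n + 1)"
  let ?N = "Ext_arr M ?HA ?HB ?f X" and ?g = "free_Hom_arr M (Rel ?HA) (Rel ?HB) (Gen_map ?f) X"
  let ?\<theta>A = "Gen_lift A (n + 1)" and ?\<theta>B = "Gen_lift B (n + 1)"
  let ?PR = "free_Hom M (Rel ?HB) X"
  note cA = countable_abelian_cohomology[OF A, of "n + 1"] and cB = countable_abelian_cohomology[OF B, of "n + 1"]
  have gA: "comm_group ?HA" and gB: "comm_group ?HB" by (rule comm_group_cohomology[OF A] comm_group_cohomology[OF B])+
  have fh: "?f \<in> hom ?HA ?HB" by (rule cohomology_map_hom[OF A B f])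
  have Gh: "Gen_map ?f \<in> hom (Gen ?HA) (Gen ?HB)" by (rule Gen_map_hom[OF hom_carrier[OF fh]])
  note N = Hom_arr(3,4)[OF cA cB fh X]
    and g = free_Hom_arr[OF cfa_Rel[OF cA] cfa_Rel[OF cB] Gen_map_Rel_hom[OF gA gB fh] X]
  obtain k where k: "k \<in> homs M (cycles B X n) (cycles A X n)"
    "\<And>x. x \<in> carrier (Grp A n) \<Longrightarrow> cev A X n x \<cdot> k = cev B X n (f n x)"
    "?F \<in> homs M (Hom_homology M B X n) (Hom_homology M A X n)" "?F \<cdot> hq B X n = hq A X n \<cdot> k"
    using Hom_homology_arr[OF A B f X] by blast
  obtain jA jB where iA: "\<iota>A \<in> homs M (Ext M ?HA X) (Hom_homology M A X n)"
    and jA: "jA \<in> homs M (free_Hom M (Rel ?HA) X) (cycles A X n)"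
    and ijA: "\<iota>A \<cdot> coker_arr M (restr M ?HA X) = hq A X n \<cdot> jA"
    and eA: "\<And>x. x \<in> carrier (Grp A n) \<Longrightarrow> cev A X n x \<cdot> jA = ev (Rel ?HA) X (?\<theta>A (Diff A n x))"
    and iB: "\<iota>B \<in> homs M (Ext M ?HB X) (Hom_homology M B X n)"
    and jB: "jB \<in> homs M ?PR (cycles B X n)"
    and ijB: "\<iota>B \<cdot> coker_arr M (restr M ?HB X) = hq B X n \<cdot> jB"
    and eB: "\<And>x. x \<in> carrier (Grp B n) \<Longrightarrow> cev B X n x \<cdot> jB = ev (Rel ?HB) X (?\<theta>B (Diff B n x))"
    using \<iota>A \<iota>B unfolding uct_in_def by blast
  note qA = hq_homs[OF A X, of n] and qB = hq_homs[OF B X, of n]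
  note eeA = coker_restr_homs[OF cA X] and eeB = coker_restr_homs[OF cB X]
  note \<theta>A = Gen_lift[OF A, where n = "n + 1"] and \<theta>B = Gen_lift[OF B, where n = "n + 1"]
  obtain r where r: "r \<in> hom (Grp A (n + 1)) (Grp A (n + 1))"
    "\<And>x. x \<in> carrier (Grp A (n + 1)) \<Longrightarrow> r x \<in> cocycles A (n + 1)" "\<And>x. x \<in> cocycles A (n + 1) \<Longrightarrow> r x = x"
    using ex_cocycle_retraction[OF A, of "n + 1"] by blast
  have rG: "r y \<in> carrier (Grp A (n + 1))" if "y \<in> carrier (Grp A (n + 1))" for y
    using hom_in_carrier[OF r(1) that] .

  \<comment> \<open>Both terms are lifts of the same class only at cocycles. The retraction
    \<open>r\<close> makes the difference relation-valued on the whole group without changing it at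
    \<open>Diff A n x\<close>.\<close>
  let ?d = "\<lambda>y. Gen_map ?f (?\<theta>A (r y)) - ?\<theta>B (f (n + 1) (r y))"
  have fh1: "f (n + 1) \<in> hom (Grp A (n + 1)) (Grp B (n + 1))" by (rule chain_map_hom[OF f])
  have h1: "(\<lambda>y. Gen_map ?f (?\<theta>A (r y))) \<in> hom (Grp A (n + 1)) (Gen ?HB)"
    using Group.hom_compose[OF Group.hom_compose[OF r(1) \<theta>A(1)] Gh] by (simp add: o_def)
  have h2: "(\<lambda>y. ?\<theta>B (f (n + 1) (r y))) \<in> hom (Grp A (n + 1)) (Gen ?HB)"
    using Group.hom_compose[OF Group.hom_compose[OF r(1) fh1] \<theta>B(1)] by (simp add: o_def)
  have dR: "?d y \<in> carrier (Rel ?HB)" if y: "y \<in> carrier (Grp A (n + 1))" for y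
  proof -
    interpret G: comm_group "Gen ?HB" by (rule comm_group_Gen)
    interpret H: comm_group ?HB by (rule gB)
    have lc: "lin_comb ?HB \<in> hom (Gen ?HB) ?HB" by (rule lin_comb_Gen_hom[OF gB])
    note m1 = hom_in_carrier[OF h1 y] and m2 = hom_in_carrier[OF h2 y]
    have eq: "?d y = Gen_map ?f (?\<theta>A (r y)) \<otimes>\<^bsub>Gen ?HB\<^esub> inv\<^bsub>Gen ?HB\<^esub> ?\<theta>B (f (n + 1) (r y))"
      using m2 by (simp add: Gen_def)
    have "lin_comb ?HB (Gen_map ?f (?\<theta>A (r y))) = ?f (coh_class A (n + 1) (r y))"
      using lin_comb_Gen_map[OF gA gB fh hom_in_carrier[OF \<theta>A(1) rG[OF y]]] \<theta>A(2)[OF r(2)[OF y]] by simp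
    moreover have "lin_comb ?HB (?\<theta>B (f (n + 1) (r y))) = ?f (coh_class A (n + 1) (r y))"
      using \<theta>B(2)[OF chain_map_cocycles[OF A B f r(2)[OF y]]] cohomology_map_coh_class[OF A B f r(2)[OF y]] by simp
    ultimately have "lin_comb ?HB (?d y) = \<one>\<^bsub>?HB\<^esub>"
      unfolding eq using hom_mult[OF lc m1 G.inv_closed[OF m2]]
        hom_apply_inv[OF G.group_axioms H.group_axioms lc m2] hom_in_carrier[OF lc m1] by (simp del: mult_Gen)
    moreover have "?d y \<in> carrier (Gen ?HB)" unfolding eq by (intro G.m_closed m1 G.inv_closed m2)
    ultimately show ?thesis by (simp add: carrier_Rel)
  qed
  have dh: "?d \<in> hom (Grp A (n + 1)) (Rel ?HB)"
    using dR hom_mult[OF h1] hom_mult[OF h2] by (intro homI) auto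
  have "(\<lambda>y. ev (Rel ?HB) X (?d y)) \<in> hom (Grp A (n + 1)) (hom_group M ?PR X)"
    using Group.hom_compose[OF dh, of "ev (Rel ?HB) X" "hom_group M ?PR X"] represents_Rel[OF cB X]
    by (simp add: o_def represents_def)
  then obtain v where v: "v \<in> homs M ?PR (free_Hom M (Grp A (n + 1)) X)"
    and evv: "\<And>y. y \<in> carrier (Grp A (n + 1)) \<Longrightarrow> ev (Grp A (n + 1)) X y \<cdot> v = ev (Rel ?HB) X (?d y)"
    using represents_arr[OF represents_Grp[OF A X] homs_Obj(1)[OF jB]] by blast
  have eq: "hq A X n \<cdot> (jA \<cdot> ?g) = hq A X n \<cdot> (k \<cdot> jB)"
  proof (rule hq_eqI[OF A X Comp_homs[OF g(1) jA] Comp_homs[OF jB k(1)] v])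
    fix x assume x: "x \<in> carrier (Grp A n)"
    note c = cev_homs[OF A X x]
    have fx: "f n x \<in> carrier (Grp B n)" by (rule hom_in_carrier[OF chain_map_hom[OF f] x])
    have Dx: "Diff A n x \<in> carrier (Grp A (n + 1))" by (rule Diff_closed[OF A x])
    have "Diff A n x \<in> cocycles A (n + 1)"
      using x coboundaries_subset_cocycles[OF A, of "n + 1"] by (auto simp: coboundaries_Suc[OF A])
    then have rD: "r (Diff A n x) = Diff A n x" by (rule r(3))
    have R1: "?\<theta>A (Diff A n x) \<in> carrier (Rel ?HA)" by (rule hom_in_carrier[OF Gen_lift_Diff_hom[OF A] x])
    have R2: "?\<theta>B (Diff B n (f n x)) \<in> carrier (Rel ?HB)" by (rule hom_in_carrier[OF Gen_lift_Diff_hom[OF B] fx])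
    have "cev A X n x \<cdot> (jA \<cdot> ?g) = ev (Rel ?HB) X (Gen_map ?f (?\<theta>A (Diff A n x)))"
      using Comp_eq_left[OF eA[OF x] g(1) jA c] g(2)[OF R1] by simp
    also have "\<dots> = ev (Rel ?HB) X (?\<theta>B (Diff B n (f n x)) \<otimes>\<^bsub>Rel ?HB\<^esub> ?d (Diff A n x))"
      using chain_map_Diff[OF f x] rD by simp
    also have "\<dots> = ev (Rel ?HB) X (?\<theta>B (Diff B n (f n x))) \<oplus> ev (Grp A (n + 1)) X (Diff A n x) \<cdot> v"
      using represents_Add[OF represents_Rel[OF cB X] R2 dR[OF Dx]] evv[OF Dx] by simp
    also have "ev (Rel ?HB) X (?\<theta>B (Diff B n (f n x))) = cev A X n x \<cdot> (k \<cdot> jB)"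
      using Comp_eq_left[OF k(2)[OF x] jB k(1) c] eB[OF fx] by simp
    finally show "cev A X n x \<cdot> (jA \<cdot> ?g) = cev A X n x \<cdot> (k \<cdot> jB) \<oplus> ev (Grp A (n + 1)) X (Diff A n x) \<cdot> v" .
  qed
  show ?thesis
  proof (rule coker_arr_cancel[OF restr_homs[OF cB X]])
    show "\<iota>A \<cdot> ?N \<in> homs M (Coker M (restr M ?HB X)) (Hom_homology M A X n)"
      "?F \<cdot> \<iota>B \<in> homs M (Coker M (restr M ?HB X)) (Hom_homology M A X n)"
      using Comp_homs[OF N(1) iA] Comp_homs[OF iB k(3)] by (simp_all add: Ext_def)
    have "(\<iota>A \<cdot> ?N) \<cdot> coker_arr M (restr M ?HB X) = hq A X n \<cdot> (jA \<cdot> ?g)"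
      using Comp_assoc[OF eeB N(1) iA] N(2) Comp_eq_left[OF ijA g(1) eeA iA] Comp_assoc[OF g(1) jA qA] by simp
    moreover have "(?F \<cdot> \<iota>B) \<cdot> coker_arr M (restr M ?HB X) = hq A X n \<cdot> (k \<cdot> jB)"
      using Comp_assoc[OF eeB iB k(3)] ijB Comp_eq_left[OF k(4) jB qB k(3)] Comp_assoc[OF jB k(1) qA] by simp
    ultimately show "(\<iota>A \<cdot> ?N) \<cdot> coker_arr M (restr M ?HB X) = (?F \<cdot> \<iota>B) \<cdot> coker_arr M (restr M ?HB X)"
      using eq by simp
  qed
qed

end

theorem theorem2p1:
  fixes M :: "('o, 'm) ab_cat"
  assumes "abelian_category M"
    and "countably_complete M"
  shows "\<exists>\<iota> \<pi> :: 'a cochain \<Rightarrow> 'o \<Rightarrow> int \<Rightarrow> 'm.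
    (\<forall>A X n. free_complex A \<and> X \<in> Obj M \<longrightarrow>
      short_exact M (Ext M (cohomology A (n + 1)) X) (\<iota> A X n)
        (Hom_homology M A X n) (\<pi> A X n) (Hom M (cohomology A n) X) \<and>
      splits M (Hom_homology M A X n) (\<pi> A X n) (Hom M (cohomology A n) X)) \<and>
    (\<forall>A B f X n. free_complex A \<and> free_complex B \<and> chain_map A B f \<and> X \<in> Obj M \<longrightarrow>
      \<iota> A X n \<cdot>\<^bsub>M\<^esub>
          Ext_arr M (cohomology A (n + 1)) (cohomology B (n + 1)) (cohomology_map B f (n + 1)) X
        = Hom_homology_arr M A B f X n \<cdot>\<^bsub>M\<^esub> \<iota> B X n \<and>
      \<pi> A X n \<cdot>\<^bsub>M\<^esub> Hom_homology_arr M A B f X n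
        = Hom_arr M (cohomology A n) (cohomology B n) (cohomology_map B f n) X
            \<cdot>\<^bsub>M\<^esub> \<pi> B X n) \<and>
    (\<forall>A X Y u n. free_complex A \<and> u \<in> homs M X Y \<longrightarrow>
      \<iota> A Y n \<cdot>\<^bsub>M\<^esub> Ext_push M (cohomology A (n + 1)) X Y u
        = Hom_homology_push M A X Y u n \<cdot>\<^bsub>M\<^esub> \<iota> A X n \<and>
      \<pi> A Y n \<cdot>\<^bsub>M\<^esub> Hom_homology_push M A X Y u n
        = Hom_push M (cohomology A n) X Y u \<cdot>\<^bsub>M\<^esub> \<pi> A X n)"
proof -
  interpret complete_abelian_category M
    using assms by (simp add: complete_abelian_category_def complete_abelian_category_axioms_def)
  \<comment> \<open>One choice is made for the pair, since exactness concerns both arrows together.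
    \<open>uct_in\<close> and \<open>uct_pr\<close> are carried along because naturality is derived
    from them, whichever arrows are chosen.\<close>
  define S where "S A X n z \<longleftrightarrow> uct_in A X n (fst z) \<and> uct_pr A X n (snd z) \<and>
      short_exact M (Ext M (cohomology A (n + 1)) X) (fst z) (Hom_homology M A X n) (snd z) (Hom M (cohomology A n) X) \<and>
      splits M (Hom_homology M A X n) (snd z) (Hom M (cohomology A n) X)"
    for A :: "'a cochain" and X n z
  define \<iota> where "\<iota> A X n = fst (SOME z. S A X n z)" for A X n
  define \<pi> where "\<pi> A X n = snd (SOME z. S A X n z)" for A X n
  have S: "S A X n (\<iota> A X n, \<pi> A X n)" if A: "free_complex A" and X: "X \<in> Obj M" for A X n
  proof -
    obtain \<iota>' \<pi>' where "S A X n (\<iota>', \<pi>')"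
      by (rule uct_sequence[OF A X, of n]) (auto simp: S_def)
    then have "S A X n (SOME z. S A X n z)" by (rule someI)
    then show ?thesis by (simp add: \<iota>_def \<pi>_def)
  qed
  have i: "uct_in A X n (\<iota> A X n)" and p: "uct_pr A X n (\<pi> A X n)"
    and ex: "short_exact M (Ext M (cohomology A (n + 1)) X) (\<iota> A X n)
        (Hom_homology M A X n) (\<pi> A X n) (Hom M (cohomology A n) X)"
      "splits M (Hom_homology M A X n) (\<pi> A X n) (Hom M (cohomology A n) X)"
    if "free_complex A" "X \<in> Obj M" for A X n
    using S[OF that, of n] by (simp_all add: S_def)
  show ?thesis
  proof (rule exI[of _ \<iota>], rule exI[of _ \<pi>], intro conjI allI impI, goal_cases)
    case (1 A X n)
    then show ?case using ex by blast
  next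
    case (2 A X n)
    then show ?case using ex by blast
  next
    case (3 A B f X n)
    then show ?case using uct_in_natural[OF _ _ _ _ i i, of A B f X n] by simp
  next
    case (4 A B f X n)
    then show ?case using uct_pr_natural[OF _ _ _ _ p p, of A B f X n] by simp
  next
    case (5 A X Y u n)
    then show ?case using uct_in_push[OF _ _ i i, of A u X Y n] homs_Obj[of u X Y] by simp
  next
    case (6 A X Y u n)
    then show ?case using uct_pr_push[OF _ _ p p, of A u X Y n] homs_Obj[of u X Y] by simp
  qed
qed

end
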